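(* Let $1\le d\le n$ be integers, let $H\subset\mathbb{R}^n$ be closed and let $K_0\subset\mathbb{R}^n\setminus H$ be relatively closed in $\mathbb{R}^n\setminus H$. Assume that (i) $K_0$ is bounded and $d$-rectifiable with $\mathcal{H}^d(K_0)<\infty$; (ii) $\mathcal{H}^d(H)=0$ and for every $\eta>0$ there exist $\delta>0$ and $\Pi\in\Sigma(H)$ such that $$\operatorname{Lip}\Pi\le 1+\eta,\qquad \Pi(U_\delta(H))\subset H.$$ Let $(K_j)\subset\mathcal{A}(H,K_0)$ be any minimizing sequence, i.e. $\mathcal{H}^d(K_j)\downarrow\inf\{\mathcal{H}^d(J):J\in\mathcal{A}(H,K_0)\}$, and let $K$ be any set such that, up to subsequences, the measures $\mathcal{H}^d\llcorner K_j$ converge weakly$^\star$ as Radon measures in $\mathbb{R}^n\setminus H$ to a measure $\mu=\mathcal{H}^d\llcorner K$, where $K=\operatorname{spt}\mu\setminus H$ is countably $\mathcal{H}^d$-rectifiable. Then $$\inf\{\mathcal{H}^d(J):J\in\mathcal{A}(H,K_0)\}=\mathcal{H}^d(K)=\inf\{\mathcal{H}^d(J):J\in\mathcal{A}(H,K)\}.$$ In particular $K$ is a sliding minimizer.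
   Context: $\mathcal{H}^d$ is the $d$-dimensional Hausdorff measure in $\mathbb{R}^n$. A set is $d$-rectifiable (equivalently, countably $\mathcal{H}^d$-rectifiable) if it can be covered, up to an $\mathcal{H}^d$-negligible set, by countably many $d$-dimensional $C^1$ submanifolds. $U_\delta(E)$ denotes the $\delta$-neighborhood of a set $E\subset\mathbb{R}^n$, $\operatorname{Lip}\Pi$ the Lipschitz constant of $\Pi$, and $\mathcal{H}^d\llcorner K$ the restriction of $\mathcal{H}^d$ to $K$. Sliding minimizers. For $H\subset\mathbb{R}^n$ closed, $\Sigma(H)$ denotes the family of Lipschitz maps $\varphi:\mathbb{R}^n\to\mathbb{R}^n$ such that there exists a continuous map $\Phi:[0,1]\times\mathbb{R}^n\to\mathbb{R}^n$ with $\Phi(1,\cdot)=\varphi$, $\Phi(0,\cdot)=\mathrm{Id}$ and $\Phi(t,H)\subset H$ for every $t\in[0,1]$. For $K_0\subset\mathbb{R}^n\setminus H$ relatively closed, define $$\mathcal{A}(H,K_0)=\{K: K=\varphi(K_0)\text{ for some }\varphi\in\Sigma(H)\}.$$ $K_0$ is called a sliding minimizer if $\mathcal{H}^d(K_0)=\inf\{\mathcal{H}^d(J):J\in\mathcal{A}(H,K_0)\}$. Known fact fixing the meaning of $K$: for every minimizing sequence $(K_j)$ in $\mathcal{A}(H,K_0)$ there is a subsequence for which $\mathcal{H}^d\llcorner K_j$ converges weakly$^\star$ in $\mathbb{R}^n\setminus H$ to a measure $\mu=\mathcal{H}^d\llcorner K$ with $K=\operatorname{spt}\mu\setminus H$ countably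 $\mathcal{H}^d$-rectifiable; moreover the associated multiplicity-one varifold is stationary in $\mathbb{R}^n\setminus H$, $K$ is a real analytic submanifold outside a relatively closed set of Hausdorff dimension at most $d-1$, and $\liminf_j\mathcal{H}^d(K_j)\ge\mathcal{H}^d(K)$. *)

theory Defs
  imports "HOL-Analysis.Analysis"
begin

section \<open>Hausdorff measure\<close>

text \<open>
  Covering sets must be bounded, since \<^const>\<open>diameter\<close> is meaningless on unbounded sets.
  Empty covering sets contribute \<open>0\<close> also for \<open>d = 0\<close>, where \<open>0 ^ 0 = 1\<close>.
\<close>

definition hausdorff_premeasure :: "nat \<Rightarrow> real \<Rightarrow> 'a::euclidean_space set \<Rightarrow> ennreal" where
  "hausdorff_premeasure d \<delta> E =
     (INF A \<in> {A :: nat \<Rightarrow> 'a set. E \<subseteq> (\<Union>i. A i) \<and> (\<forall>i. bounded (A i) \<and> diameter (A i) \<le> \<delta>)}.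
        \<Sum>i. if A i = {} then 0
             else ennreal (unit_ball_vol (real d) * (diameter (A i) / 2) ^ d))"

text \<open>The \<open>d\<close>-dimensional Hausdorff (outer) measure, defined on all subsets.\<close>

definition hausdorff :: "nat \<Rightarrow> 'a::euclidean_space set \<Rightarrow> ennreal" where
  "hausdorff d E = (SUP \<delta> \<in> {0<..}. hausdorff_premeasure d \<delta> E)"

text \<open>
  The restriction of the Hausdorff measure to \<open>K\<close>, as a Borel measure. Borel sets are
  Caratheodory measurable for the metric outer measure \<^const>\<open>hausdorff\<close>, so the set function is
  countably additive on \<open>sets borel\<close> for every \<open>K\<close> and \<^const>\<open>measure_of\<close> does not degenerate.
\<close>

definition hausdorff_restrict :: "nat \<Rightarrow> 'a::euclidean_space set \<Rightarrow> 'a measure" where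
  "hausdorff_restrict d K = measure_of UNIV (sets borel) (\<lambda>A. hausdorff d (A \<inter> K))"

section \<open>Rectifiable sets\<close>

definition C1_on :: "'a::real_normed_vector set \<Rightarrow> ('a \<Rightarrow> 'b::real_normed_vector) \<Rightarrow> bool" where
  "C1_on U f \<longleftrightarrow>
     (\<exists>f' :: 'a \<Rightarrow> 'a \<Rightarrow>\<^sub>L 'b.
        (\<forall>x\<in>U. (f has_derivative blinfun_apply (f' x)) (at x)) \<and> continuous_on U f')"

text \<open>
  Embedded submanifolds: near each of its points, \<open>M\<close> is straightened to a \<open>d\<close>-dimensional
  linear subspace by a \<open>C\<^sup>1\<close> diffeomorphism between open sets of the ambient space.
\<close>

definition C1_submanifold :: "nat \<Rightarrow> 'a::euclidean_space set \<Rightarrow> bool" where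
  "C1_submanifold d M \<longleftrightarrow>
     (\<forall>p\<in>M. \<exists>(U :: 'a set) (V :: 'a set) \<psi> \<psi>' T.
        open U \<and> p \<in> U \<and> open V \<and>
        homeomorphism U V \<psi> \<psi>' \<and> C1_on U \<psi> \<and> C1_on V \<psi>' \<and>
        subspace T \<and> dim T = d \<and> \<psi> ` (M \<inter> U) = T \<inter> V)"

definition rectifiable :: "nat \<Rightarrow> 'a::euclidean_space set \<Rightarrow> bool" where
  "rectifiable d E \<longleftrightarrow>
     (\<exists>M :: nat \<Rightarrow> 'a set. (\<forall>i. C1_submanifold d (M i)) \<and> hausdorff d (E - (\<Union>i. M i)) = 0)"

section \<open>Radon measures on an open set\<close>

text \<open>
  A Radon measure on an open set \<open>U\<close> is represented by a Borel measure on the whole space that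
  is finite on the compact subsets of \<open>U\<close>; only its behaviour inside \<open>U\<close> is relevant.
  (Regularity is automatic on open subsets of a Euclidean space.)
\<close>

definition radon_on :: "'a::euclidean_space set \<Rightarrow> 'a measure \<Rightarrow> bool" where
  "radon_on U M \<longleftrightarrow> sets M = sets borel \<and> (\<forall>C. compact C \<and> C \<subseteq> U \<longrightarrow> emeasure M C < \<infinity>)"

text \<open>The test functions are \<open>C\<^sub>c(U)\<close>, extended by zero outside \<open>U\<close>.\<close>

definition weak_star_conv_on ::
    "'a::euclidean_space set \<Rightarrow> (nat \<Rightarrow> 'a measure) \<Rightarrow> 'a measure \<Rightarrow> bool" where
  "weak_star_conv_on U M \<mu> \<longleftrightarrow>
     (\<forall>j. radon_on U (M j)) \<and> radon_on U \<mu> \<and>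
     (\<forall>f :: 'a \<Rightarrow> real.
        continuous_on UNIV f \<and> compact (closure {x. f x \<noteq> 0}) \<and> closure {x. f x \<noteq> 0} \<subseteq> U \<longrightarrow>
        (\<lambda>j. integral\<^sup>L (M j) f) \<longlonglongrightarrow> integral\<^sup>L \<mu> f)"

definition spt :: "'a::euclidean_space measure \<Rightarrow> 'a set" where
  "spt \<mu> = {x. \<forall>V. open V \<and> x \<in> V \<longrightarrow> emeasure \<mu> V > 0}"

section \<open>Sliding deformations\<close>

definition nbhd :: "real \<Rightarrow> 'a::euclidean_space set \<Rightarrow> 'a set" where
  "nbhd \<delta> E = (\<Union>y\<in>E. ball y \<delta>)"

definition sliding_maps :: "'a::euclidean_space set \<Rightarrow> ('a \<Rightarrow> 'a) set" where
  "sliding_maps H =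
     {\<phi>. (\<exists>L. L-lipschitz_on UNIV \<phi>) \<and>
         (\<exists>\<Phi> :: real \<Rightarrow> 'a \<Rightarrow> 'a.
            continuous_on ({0..1} \<times> UNIV) (\<lambda>(t, x). \<Phi> t x) \<and>
            \<Phi> 1 = \<phi> \<and> \<Phi> 0 = id \<and> (\<forall>t\<in>{0..1}. \<Phi> t ` H \<subseteq> H))}"

definition sliding_class :: "'a::euclidean_space set \<Rightarrow> 'a set \<Rightarrow> 'a set set" where
  "sliding_class H K0 = {K. \<exists>\<phi>\<in>sliding_maps H. K = \<phi> ` K0}"

definition sliding_minimizer :: "nat \<Rightarrow> 'a::euclidean_space set \<Rightarrow> 'a set \<Rightarrow> bool" where
  "sliding_minimizer d H K0 \<longleftrightarrow>
     closedin (top_of_set (- H)) K0 \<and>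
     hausdorff d K0 = (INF J\<in>sliding_class H K0. hausdorff d J)"

end

theory Submission
  imports Defs
begin

text \<open>
  Let \<open>m\<close> be the infimum over the class of \<open>K\<^sub>0\<close>, and let \<open>K\<^sub>j\<close> be the minimizing sequence. Two
  things have to be shown: no area is lost in the limit, so that \<open>K\<close> has area \<open>m\<close>; and no sliding
  image of \<open>K\<close> has area less than \<open>m\<close>.

  \<^bold>\<open>No area is lost.\<close> Weak convergence only gives that \<open>K\<close> has area at most \<open>m\<close>; area of \<open>K\<^sub>j\<close> might
  disappear near \<open>H\<close> or at infinity. Near \<open>H\<close> this costs a single application of the almost
  retraction \<open>P\<close> of the hypothesis: it maps \<open>K\<^sub>j \<inter> nbhd \<delta> H\<close> into the null set \<open>H\<close> and is
  \<open>(1 + \<eta>)\<close>-Lipschitz, so \<open>P ` K\<^sub>j\<close> would beat \<open>m\<close> if \<open>K\<^sub>j\<close> kept much area close to \<open>H\<close>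
  (\<open>near_constraint_mass\<close>). Infinity is the delicate case, because \<open>K\<^sub>0\<close> is bounded but \<open>H\<close> and the
  sets \<open>K\<^sub>j\<close> are not uniformly so, because a radial contraction does not preserve \<open>H\<close>, and because \<open>P\<close>
  may fold the far part of \<open>K\<^sub>j\<close> back onto the near part without reducing its area.

  The way out rests on two observations. First, whether a Lipschitz map is sliding depends only on its
  restriction to \<open>H\<close> (\<open>sliding_maps_eq_on\<close>). Secondly, if \<open>\<phi>\<close> is sliding and \<open>G\<close> is any Lipschitz map
  that sends a neighbourhood of \<open>H\<close> to a null set and agrees with \<open>P\<close> on the bounded part of \<open>H\<close> near
  \<open>K\<^sub>0\<close>, then \<open>G \<circ> \<phi>\<close> can be turned into a sliding map at no cost: in a thin collar of \<open>H\<close> one replaces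
  \<open>\<phi>\<close> by an earlier stage of its homotopy, running back to the identity on \<open>H\<close>; in the collar the
  homotopy stays close to \<open>H\<close>, so \<open>G\<close> maps the collar to a null set (\<open>collar_competitor\<close>). Hence \<open>G\<close>
  need not preserve \<open>H\<close>, and can be taken to be \<open>P\<close> on a large ball and constant far away. In a shell
  in between, the factor that scales \<open>P\<close> down to the constant would sweep out positive area from \<open>H\<close>;
  therefore a map in the spirit of Federer and Fleming is applied first, which pushes a neighbourhood
  of the null set \<open>H\<close> into the \<open>(d - 1)\<close>-skeleton of a grid and multiplies the area of \<open>K\<^sub>j\<close> in the
  shell by at most a dimensional constant (\<open>grid_deformation\<close>). Comparing areas
  (\<open>area_outside_shell\<close>) bounds \<open>m\<close> by \<open>(1 + \<eta>) ^ d\<close> times the area of \<open>K\<^sub>j\<close> in a ball and away from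
  \<open>H\<close>, plus a constant times its area in the shell. The constant does not depend on the shell, so the
  shell may be chosen where the limit has little area, and \<open>no_mass_loss\<close> follows.

  \<^bold>\<open>The limit is minimal.\<close> Up to a set of small area, \<open>K\<close> is a compact set \<open>C\<close> contained in finitely
  many pieces of \<open>C\<^sup>1\<close> submanifolds, and a neighbourhood of \<open>C\<close> can be mapped onto these pieces by a
  Lipschitz map that fixes \<open>C\<close> (\<open>rectifiable_retractable_approx\<close>). Let \<open>q\<close> do this in \<open>nbhd s C\<close> and be
  the identity outside \<open>nbhd (2 * s) C\<close>; its Lipschitz constant does not depend on \<open>s\<close>
  (\<open>retraction_cutoff\<close>). Since the areas of \<open>K\<^sub>j\<close> converge to that of \<open>K\<close>, nearly all of \<open>K\<^sub>j\<close> lies in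
  \<open>nbhd s C\<close>, where \<open>q\<close> moves it into a set hardly larger than \<open>C\<close>, and its area in
  \<open>nbhd (2 * s) C - nbhd s C\<close> tends to zero with \<open>s\<close>. So \<open>m\<close>, being at most the area of
  \<open>\<phi> ` q ` K\<^sub>j\<close>, is at most the area of \<open>\<phi> ` K\<close> up to small terms
  (\<open>limit_beats_competitors\<close>).
\<close>

section \<open>Hausdorff measure\<close>

definition cover_weight :: "nat \<Rightarrow> 'a::euclidean_space set \<Rightarrow> ennreal" where
  "cover_weight d A = (if A = {} then 0 else ennreal (unit_ball_vol (real d) * (diameter A / 2) ^ d))"

lemma hausdorff_premeasure_alt:
  "hausdorff_premeasure d \<delta> E =
     (INF A \<in> {A :: nat \<Rightarrow> 'a::euclidean_space set.
        E \<subseteq> (\<Union>i. A i) \<and> (\<forall>i. bounded (A i) \<and> diameter (A i) \<le> \<delta>)}. \<Sum>i. cover_weight d (A i))"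
  by (simp add: hausdorff_premeasure_def cover_weight_def)

lemma cover_weight_empty [simp]: "cover_weight d {} = 0"
  by (simp add: cover_weight_def)

lemma hausdorff_premeasure_le:
  assumes "E \<subseteq> (\<Union>i. A i)" "\<And>i. bounded (A i)" "\<And>i. diameter (A i) \<le> \<delta>"
  shows "hausdorff_premeasure d \<delta> E \<le> (\<Sum>i. cover_weight d (A i))"
  unfolding hausdorff_premeasure_alt by (rule INF_lower) (use assms in auto)

lemma hausdorff_premeasure_cover:
  assumes "hausdorff_premeasure d \<delta> E < c"
  obtains A :: "nat \<Rightarrow> 'a::euclidean_space set"
  where "E \<subseteq> (\<Union>i. A i)" "\<And>i. bounded (A i)" "\<And>i. diameter (A i) \<le> \<delta>"
    "(\<Sum>i. cover_weight d (A i)) < c"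
  using assms unfolding hausdorff_premeasure_alt INF_less_iff by auto

lemma hausdorff_premeasure_mono:
  "E \<subseteq> F \<Longrightarrow> hausdorff_premeasure d \<delta> E \<le> hausdorff_premeasure d \<delta> F"
  unfolding hausdorff_premeasure_alt by (rule INF_superset_mono) auto

lemma hausdorff_premeasure_antimono:
  "\<delta> \<le> \<delta>' \<Longrightarrow> hausdorff_premeasure d \<delta>' E \<le> hausdorff_premeasure d \<delta> E"
  unfolding hausdorff_premeasure_alt by (rule INF_superset_mono) (auto intro: order_trans)

lemma hausdorff_premeasure_empty [simp]:
  assumes "0 \<le> \<delta>" shows "hausdorff_premeasure d \<delta> {} = 0"
  using hausdorff_premeasure_le[of "{}" "\<lambda>_. {}" \<delta> d] assms by simp

text \<open>
  Covers of the pieces, each optimal up to \<open>e / 2 ^ Suc i\<close>, are merged into one cover by enumerating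
  pairs of indices.
\<close>

lemma hausdorff_premeasure_UN_le:
  "hausdorff_premeasure d \<delta> (\<Union>i::nat. E i) \<le> (\<Sum>i. hausdorff_premeasure d \<delta> (E i))"
proof (cases "(\<Sum>i. hausdorff_premeasure d \<delta> (E i)) < top")
  case False
  then show ?thesis by (simp add: less_top[symmetric])
next
  case True
  show ?thesis
  proof (rule ennreal_le_epsilon)
    fix e :: real assume e: "0 < e"
    have fin: "hausdorff_premeasure d \<delta> (E i) < top" for i
      using True ennreal_suminf_lessD by blast
    have "\<exists>A. E i \<subseteq> (\<Union>k::nat. A k) \<and> (\<forall>k. bounded (A k)) \<and> (\<forall>k. diameter (A k) \<le> \<delta>) \<and>
       (\<Sum>k. cover_weight d (A k)) < hausdorff_premeasure d \<delta> (E i) + ennreal (e * (1/2)^Suc i)" for i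
    proof -
      have "hausdorff_premeasure d \<delta> (E i) < hausdorff_premeasure d \<delta> (E i) + ennreal (e * (1/2)^Suc i)"
        using fin[of i] e by (auto simp: ennreal_add_left_cancel_less[where b=0, simplified] )
      then show ?thesis
        by (rule hausdorff_premeasure_cover) blast
    qed
    then obtain A where A: "\<And>i. E i \<subseteq> (\<Union>k::nat. A i k)" "\<And>i k. bounded (A i k)"
        "\<And>i k. diameter (A i k) \<le> \<delta>"
        "\<And>i. (\<Sum>k. cover_weight d (A i k)) < hausdorff_premeasure d \<delta> (E i) + ennreal (e * (1/2)^Suc i)"
      by metis
    define B where "B = (\<lambda>n. A (fst (prod_decode n)) (snd (prod_decode n)))"
    have "hausdorff_premeasure d \<delta> (\<Union>i. E i) \<le> (\<Sum>n. cover_weight d (B n))"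
    proof (rule hausdorff_premeasure_le)
      show "(\<Union>i. E i) \<subseteq> (\<Union>n. B n)"
      proof clarify
        fix x i assume "x \<in> E i"
        then obtain k where "x \<in> A i k" using A(1) by blast
        then have "x \<in> B (prod_encode (i,k))" by (simp add: B_def)
        then show "x \<in> (\<Union>n. B n)" by blast
      qed
    qed (auto simp: B_def A)
    also have "\<dots> = (\<Sum>i. \<Sum>k. cover_weight d (A i k))"
      unfolding B_def
      using suminf_ennreal_2dimen[where f="\<lambda>(i,k). cover_weight d (A i k)", OF refl]
      by (simp add: case_prod_unfold)
    also have "\<dots> \<le> (\<Sum>i. hausdorff_premeasure d \<delta> (E i) + ennreal (e * (1/2)^Suc i))"
      by (intro suminf_le less_imp_le A(4)) auto
    also have "\<dots> = (\<Sum>i. hausdorff_premeasure d \<delta> (E i)) + (\<Sum>i. ennreal (e * (1/2)^Suc i))"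
      by (intro suminf_add[symmetric]) auto
    also have "(\<Sum>i. ennreal (e * (1/2)^Suc i)) = ennreal e"
    proof -
      have "(\<lambda>i. e * (1/2)^Suc i) sums (e * 1)"
        by (intro sums_mult power_half_series)
      then show ?thesis
        using e by (subst suminf_ennreal2) (auto simp: sums_iff)
    qed
    finally show "hausdorff_premeasure d \<delta> (\<Union>i. E i) \<le> (\<Sum>i. hausdorff_premeasure d \<delta> (E i)) + ennreal e" .
  qed
qed

lemma hausdorff_premeasure_le_hausdorff:
  "0 < \<delta> \<Longrightarrow> hausdorff_premeasure d \<delta> E \<le> hausdorff d E"
  unfolding hausdorff_def by (rule SUP_upper) simp

lemma hausdorff_leI:
  assumes "\<And>\<delta>. 0 < \<delta> \<Longrightarrow> hausdorff_premeasure d \<delta> E \<le> c"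
  shows "hausdorff d E \<le> c"
  unfolding hausdorff_def by (rule SUP_least) (use assms in auto)

lemma hausdorff_mono: "E \<subseteq> F \<Longrightarrow> hausdorff d E \<le> hausdorff d F"
  unfolding hausdorff_def by (intro SUP_mono) (auto intro: hausdorff_premeasure_mono)

lemma hausdorff_empty [simp]: "hausdorff d {} = 0"
  unfolding hausdorff_def by (rule antisym) (auto intro!: SUP_least)

lemma hausdorff_UN_le: "hausdorff d (\<Union>i::nat. E i) \<le> (\<Sum>i. hausdorff d (E i))"
proof (rule hausdorff_leI)
  fix \<delta> :: real assume "0 < \<delta>"
  have "hausdorff_premeasure d \<delta> (\<Union>i. E i) \<le> (\<Sum>i. hausdorff_premeasure d \<delta> (E i))"
    by (rule hausdorff_premeasure_UN_le)
  also have "\<dots> \<le> (\<Sum>i. hausdorff d (E i))"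
    by (intro suminf_le) (auto intro: hausdorff_premeasure_le_hausdorff \<open>0 < \<delta>\<close>)
  finally show "hausdorff_premeasure d \<delta> (\<Union>i. E i) \<le> (\<Sum>i. hausdorff d (E i))" .
qed

lemma countably_subadditive_hausdorff: "countably_subadditive (Pow UNIV) (hausdorff d)"
  unfolding countably_subadditive_def by (auto intro: hausdorff_UN_le)

lemma hausdorff_Un_le: "hausdorff d (A \<union> B) \<le> hausdorff d A + hausdorff d B"
proof -
  have "hausdorff d (\<Union>i::nat. if i = 0 then A else if i = 1 then B else {})
      \<le> (\<Sum>i::nat. hausdorff d (if i = 0 then A else if i = 1 then B else {}))"
    by (rule hausdorff_UN_le)
  also have "\<dots> = (\<Sum>i\<in>{0,1::nat}. hausdorff d (if i = 0 then A else if i = 1 then B else {}))"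
    by (rule suminf_finite) auto
  finally have "hausdorff d (\<Union>i::nat. if i = 0 then A else if i = 1 then B else {})
      \<le> hausdorff d A + hausdorff d B" by simp
  moreover have "A \<union> B \<subseteq> (\<Union>i::nat. if i = 0 then A else if i = 1 then B else {})"
    by (auto split: if_splits)
  ultimately show ?thesis by (meson hausdorff_mono order_trans)
qed

lemma hausdorff_finite_UN_le:
  "finite I \<Longrightarrow> hausdorff d (\<Union>i\<in>I. E i) \<le> (\<Sum>i\<in>I. hausdorff d (E i))"
  by (induction rule: finite_induct) (auto intro: order_trans[OF hausdorff_Un_le add_left_mono])

lemma hausdorff_premeasure_finite_UN_le:
  assumes "0 \<le> \<delta>" "finite I"
  shows "hausdorff_premeasure d \<delta> (\<Union>i\<in>I. E i) \<le> (\<Sum>i\<in>I. hausdorff_premeasure d \<delta> (E i))"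
proof -
  obtain f :: "nat \<Rightarrow> _" and n where f: "bij_betw f {..<n} I"
    using ex_bij_betw_nat_finite[OF assms(2)] by (auto simp: atLeast0LessThan)
  define F where "F = (\<lambda>k. if k < n then E (f k) else {})"
  have "(\<Union>i\<in>I. E i) = (\<Union>k. F k)"
    using f by (auto simp: F_def bij_betw_def split: if_splits)
  then have "hausdorff_premeasure d \<delta> (\<Union>i\<in>I. E i) \<le> (\<Sum>k. hausdorff_premeasure d \<delta> (F k))"
    using hausdorff_premeasure_UN_le[of d \<delta> F] by simp
  also have "\<dots> = (\<Sum>k<n. hausdorff_premeasure d \<delta> (F k))"
    by (rule suminf_finite) (auto simp: F_def assms(1))
  also have "\<dots> = (\<Sum>i\<in>I. hausdorff_premeasure d \<delta> (E i))"
    by (subst sum.reindex_bij_betw[OF f, symmetric]) (auto simp: F_def)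
  finally show ?thesis .
qed

lemma hausdorff_null_subset: "hausdorff d F = 0 \<Longrightarrow> E \<subseteq> F \<Longrightarrow> hausdorff d E = 0"
  using hausdorff_mono[of E F d] by simp

lemma hausdorff_null_UN: "(\<And>i::nat. hausdorff d (E i) = 0) \<Longrightarrow> hausdorff d (\<Union>i. E i) = 0"
  using hausdorff_UN_le[of d E] by simp

lemma hausdorff_null_Un: "hausdorff d A = 0 \<Longrightarrow> hausdorff d B = 0 \<Longrightarrow> hausdorff d (A \<union> B) = 0"
  using hausdorff_Un_le[of d A B] by simp

lemma hausdorff_premeasure_Un_ge:
  assumes sep: "\<And>x y. x \<in> A \<Longrightarrow> y \<in> B \<Longrightarrow> \<delta> < dist x y"
  shows "hausdorff_premeasure d \<delta> A + hausdorff_premeasure d \<delta> B \<le> hausdorff_premeasure d \<delta> (A \<union> B)"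
  unfolding hausdorff_premeasure_alt[of d \<delta> "A \<union> B"]
proof (rule INF_greatest, clarify)
  fix X :: "nat \<Rightarrow> 'a set"
  assume X: "A \<union> B \<subseteq> (\<Union>i. X i)" "\<forall>i. bounded (X i) \<and> diameter (X i) \<le> \<delta>"
  define Y where "Y = (\<lambda>i. if X i \<inter> A = {} then {} else X i)"
  define Z where "Z = (\<lambda>i. if X i \<inter> A = {} then X i else {})"
  have dl: "dist x y \<le> \<delta>" if "x \<in> X i" "y \<in> X i" for x y i
    using diameter_bounded_bound[of "X i" x y] X(2) that by (meson order_trans)
  have "0 \<le> \<delta>"
    using X(2) diameter_ge_0[of "X 0"] by (meson order_trans)
  have Y: "hausdorff_premeasure d \<delta> A \<le> (\<Sum>i. cover_weight d (Y i))" 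
    and Z: "hausdorff_premeasure d \<delta> B \<le> (\<Sum>i. cover_weight d (Z i))"
  proof -
    have "A \<subseteq> (\<Union>i. Y i)" using X(1) by (fastforce simp: Y_def)
    moreover have "B \<subseteq> (\<Union>i. Z i)"
    proof
      fix b assume b: "b \<in> B"
      then obtain i where i: "b \<in> X i" using X(1) by blast
      have "X i \<inter> A = {}"
        using sep[of _ b] b i dl[of _ i b] by (metis disjoint_iff not_le)
      then show "b \<in> (\<Union>i. Z i)" using i by (auto simp: Z_def)
    qed
    moreover have "bounded (Y i)" "bounded (Z i)" for i using X(2) by (auto simp: Y_def Z_def)
    moreover have "diameter (Y i) \<le> \<delta>" "diameter (Z i) \<le> \<delta>" for i
      using X(2) by (auto simp: Y_def Z_def simp: \<open>0 \<le> \<delta>\<close>)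
    ultimately show "hausdorff_premeasure d \<delta> A \<le> (\<Sum>i. cover_weight d (Y i))"
      "hausdorff_premeasure d \<delta> B \<le> (\<Sum>i. cover_weight d (Z i))"
      by (auto intro!: hausdorff_premeasure_le)
  qed
  have "(\<Sum>i. cover_weight d (Y i)) + (\<Sum>i. cover_weight d (Z i)) = (\<Sum>i. cover_weight d (Y i) + cover_weight d (Z i))"
    by (intro suminf_add) auto
  also have "\<dots> = (\<Sum>i. cover_weight d (X i))"
    by (intro suminf_cong) (auto simp: Y_def Z_def)
  finally show "hausdorff_premeasure d \<delta> A + hausdorff_premeasure d \<delta> B \<le> (\<Sum>i. cover_weight d (X i))"
    using add_mono[OF Y Z] by simp
qed

text \<open>
  At scales below the distance \<open>e\<close>, no covering set meets both parts, so every cover splits.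
\<close>

lemma hausdorff_Un_separated:
  assumes "0 < e" and sep: "\<And>x y. x \<in> A \<Longrightarrow> y \<in> B \<Longrightarrow> e \<le> dist x y"
  shows "hausdorff d (A \<union> B) = hausdorff d A + hausdorff d B"
proof (rule antisym[OF hausdorff_Un_le])
  have *: "hausdorff_premeasure d \<delta> A + hausdorff_premeasure d \<delta>' B \<le> hausdorff d (A \<union> B)"
    if "0 < \<delta>" "0 < \<delta>'" for \<delta> \<delta>'
  proof -
    define r where "r = min (min \<delta> \<delta>') (e/2)"
    have r: "0 < r" "r \<le> \<delta>" "r \<le> \<delta>'" "r < e" using that assms(1) by (auto simp: r_def)
    have "hausdorff_premeasure d \<delta> A + hausdorff_premeasure d \<delta>' B \<le> hausdorff_premeasure d r A + hausdorff_premeasure d r B"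
      using r by (intro add_mono hausdorff_premeasure_antimono)
    also have "\<dots> \<le> hausdorff_premeasure d r (A \<union> B)"
      using sep r by (intro hausdorff_premeasure_Un_ge) (meson less_le_trans)
    also have "\<dots> \<le> hausdorff d (A \<union> B)" using r by (intro hausdorff_premeasure_le_hausdorff)
    finally show ?thesis .
  qed
  have 1: "hausdorff_premeasure d \<delta> A + hausdorff d B \<le> hausdorff d (A \<union> B)" if "0 < \<delta>" for \<delta>
    unfolding hausdorff_def[of d B] using * that
    by (subst ennreal_SUP_add_right) (auto intro!: SUP_least)
  have "hausdorff d B + hausdorff d A \<le> hausdorff d (A \<union> B)"
    unfolding hausdorff_def[of d A] using 1
    by (subst ennreal_SUP_add_right) (auto intro!: SUP_least simp: add.commute)
  then show "hausdorff d A + hausdorff d B \<le> hausdorff d (A \<union> B)" by (simp add: add.commute)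
qed


text \<open>
  Closed sets satisfy Caratheodory's condition. The part of \<open>A\<close> at distance at least \<open>1 / (k + 1)\<close> from
  \<open>C\<close> is separated from \<open>A \<inter> C\<close>. The shells between consecutive such distances, taken every other
  one, are separated from each other as well; so their measures are summable, and the tail that is
  missed for given \<open>k\<close> tends to zero.
\<close>

lemma hausdorff_split_closed:
  fixes C :: "'a::euclidean_space set"
  assumes C: "closed C"
  shows "hausdorff d (A \<inter> C) + hausdorff d (A - C) \<le> hausdorff d A"
proof (cases "C = {} \<or> hausdorff d A = top")
  case True
  then show ?thesis by (auto simp: hausdorff_mono)
next
  case False
  then have ne: "C \<noteq> {}" and fin: "hausdorff d A < top" by (auto simp: less_top)
  define S where "S = (\<lambda>k::nat. {x\<in>A. 1 / (real k + 1) \<le> infdist x C})"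
  define D where "D = (\<lambda>k. S (Suc k) - S k)"
  have sep: "hausdorff d (X \<union> Y) = hausdorff d X + hausdorff d Y"
    if X: "X \<subseteq> S m" and Y: "\<And>y. y \<in> Y \<Longrightarrow> infdist y C \<le> 1 / (real m + 2)" for X Y m
  proof (rule hausdorff_Un_separated)
    show "0 < 1 / (real m + 1) - 1 / (real m + 2)" by (simp add: frac_less2)
    fix x y assume "x \<in> X" "y \<in> Y"
    then have "1 / (real m + 1) \<le> infdist x C" "infdist y C \<le> 1 / (real m + 2)"
      using X Y by (auto simp: S_def)
    moreover have "infdist x C \<le> infdist y C + dist x y" by (rule infdist_triangle)
    ultimately show "1 / (real m + 1) - 1 / (real m + 2) \<le> dist x y" by linarith
  qed
  have Smono: "S k \<subseteq> S (Suc k)" for k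
  proof -
    have "1 / (real (Suc k) + 1) \<le> 1 / (real k + 1)" by (intro divide_left_mono) auto
    then show ?thesis unfolding S_def by (auto intro: order_trans)
  qed
  have Smono': "k \<le> l \<Longrightarrow> S k \<subseteq> S l" for k l
    using lift_Suc_mono_le[of S] Smono by blast
  have D_le: "infdist y C \<le> 1 / (real k + 1)" if "y \<in> D k" for y k
    using that by (auto simp: D_def S_def)
  have part: "(\<Sum>k<n. hausdorff d (D (2*k+p))) \<le> hausdorff d A" if "p \<le> 1" for n p
  proof -
    have "(\<Sum>k<n. hausdorff d (D (2*k+p))) = hausdorff d (\<Union>k<n. D (2*k+p))"
    proof (induction n)
      case (Suc n)
      have "hausdorff d ((\<Union>k<n. D (2*k+p)) \<union> D (2*n+p)) 
          = hausdorff d (\<Union>k<n. D (2*k+p)) + hausdorff d (D (2*n+p))"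
      proof (cases "n = 0")
        case False
        then obtain m where m: "2 * n + p = Suc m" by (metis add_is_0 mult_is_0 not0_implies_Suc zero_neq_numeral)
        show ?thesis
        proof (rule sep[of _ m])
          show "(\<Union>k<n. D (2*k+p)) \<subseteq> S m"
          proof
            fix x assume "x \<in> (\<Union>k<n. D (2*k+p))"
            then obtain k where "k < n" "x \<in> D (2*k+p)" by blast
            then have "x \<in> S (Suc (2*k+p))" "Suc (2*k+p) \<le> m" using m by (auto simp: D_def)
            then show "x \<in> S m" using Smono' by blast
          qed
          show "infdist y C \<le> 1 / (real m + 2)" if "y \<in> D (2*n+p)" for y
          proof -
            have "real (2 * n + p) + 1 = real m + 2" using m by simp
            then show ?thesis using D_le[OF that] by metis
          qed
        qed
      qed simp
      then show ?case using Suc.IH by (simp add: Un_commute lessThan_Suc)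
    qed simp
    also have "\<dots> \<le> hausdorff d A" by (intro hausdorff_mono) (auto simp: D_def S_def)
    finally show ?thesis .
  qed
  have Dsum: "(\<Sum>k<n. hausdorff d (D k)) \<le> 2 * hausdorff d A" for n
  proof -
    have "(\<Sum>k<n. hausdorff d (D k)) \<le> (\<Sum>k<2*n. hausdorff d (D k))"
      by (rule sum_mono2) auto
    also have "\<dots> = (\<Sum>k<n. hausdorff d (D (2*k+0))) + (\<Sum>k<n. hausdorff d (D (2*k+1)))"
      by (induction n) (auto simp: algebra_simps)
    also have "\<dots> \<le> hausdorff d A + hausdorff d A" by (intro add_mono part) auto
    finally show ?thesis by (simp add: mult_2)
  qed
  then have "(\<Sum>k. hausdorff d (D k)) \<le> 2 * hausdorff d A"
    by (intro suminf_le_const) auto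
  then have Dfin: "(\<Sum>k. hausdorff d (D k)) < top"
    using fin by (auto simp: ennreal_mult_less_top intro: le_less_trans)
  have AC: "A - C \<subseteq> S k \<union> (\<Union>i. D (i + k))" for k
  proof
    fix x assume x: "x \<in> A - C"
    then have "0 < infdist x C"
      using C ne in_closed_iff_infdist_zero[of C x] infdist_nonneg[of x C] by (metis DiffD2 order_less_le)
    then obtain n where "inverse (real (Suc n)) < infdist x C" using reals_Archimedean by blast
    then have n: "x \<in> S n" using x by (auto simp: S_def inverse_eq_divide add.commute)
    show "x \<in> S k \<union> (\<Union>i. D (i + k))"
    proof (cases "x \<in> S k")
      case False
      define l where "l = (LEAST l. x \<in> S l)"
      have l: "x \<in> S l" using n unfolding l_def by (rule LeastI)
      have "k < l" using l False Smono'[of l k] by (meson not_le subsetD)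
      have "x \<notin> S (l - 1)"
        using not_less_Least[of "l - 1" "\<lambda>l. x \<in> S l"] \<open>k < l\<close> by (auto simp: l_def)
      then have "x \<in> D (l - 1)" using l \<open>k < l\<close> by (auto simp: D_def)
      moreover have "l - 1 = (l - 1 - k) + k" using \<open>k < l\<close> by simp
      ultimately show ?thesis by (metis UN_I UNIV_I UnI2)
    qed simp
  qed
  have main: "hausdorff d (A \<inter> C) + hausdorff d (A - C) \<le> hausdorff d A + (\<Sum>i. hausdorff d (D (i + k)))" for k
  proof -
    have "hausdorff d (A \<inter> C) + hausdorff d (A - C) 
        \<le> hausdorff d (A \<inter> C) + (hausdorff d (S k) + (\<Sum>i. hausdorff d (D (i + k))))"
    proof (rule add_left_mono)
      have "hausdorff d (A - C) \<le> hausdorff d (S k \<union> (\<Union>i. D (i + k)))" by (rule hausdorff_mono[OF AC])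
      also have "\<dots> \<le> hausdorff d (S k) + hausdorff d (\<Union>i. D (i + k))" by (rule hausdorff_Un_le)
      also have "\<dots> \<le> hausdorff d (S k) + (\<Sum>i. hausdorff d (D (i + k)))"
        by (rule add_left_mono[OF hausdorff_UN_le])
      finally show "hausdorff d (A - C) \<le> hausdorff d (S k) + (\<Sum>i. hausdorff d (D (i + k)))" .
    qed
    also have "\<dots> = (hausdorff d (S k) + hausdorff d (A \<inter> C)) + (\<Sum>i. hausdorff d (D (i + k)))"
      by (simp add: ac_simps)
    also have "hausdorff d (S k) + hausdorff d (A \<inter> C) = hausdorff d (S k \<union> (A \<inter> C))"
      by (rule sep[symmetric, of _ k]) auto
    also have "\<dots> \<le> hausdorff d A" by (intro hausdorff_mono) (auto simp: S_def)
    finally show ?thesis by (simp add: add_right_mono)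
  qed
  show ?thesis
  proof (rule ennreal_le_epsilon)
    fix e :: real assume "0 < e"
    define g where "g = (\<lambda>i. enn2real (hausdorff d (D i)))"
    have Dlt: "hausdorff d (D i) < top" for i using Dfin ennreal_suminf_lessD by blast
    then have g: "hausdorff d (D i) = ennreal (g i)" "0 \<le> g i" for i by (auto simp: g_def less_top)
    have sg: "summable g"
    proof (rule summable_suminf_not_top)
      show "(\<Sum>i. ennreal (g i)) \<noteq> top" using Dfin unfolding g(1)[symmetric] by simp
    qed (rule g(2))
    have "\<exists>N. \<forall>n\<ge>N. norm (\<Sum>i. g (i + n)) < e"
      using suminf_exist_split[OF \<open>0 < e\<close> sg] by simp
    then obtain k where "norm (\<Sum>i. g (i + k)) < e" by blast
    then have "(\<Sum>i. g (i + k)) < e" by simp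
    then have "(\<Sum>i. hausdorff d (D (i + k))) \<le> ennreal e"
      unfolding g(1) using g(2) sg
      by (subst suminf_ennreal2) (auto simp: summable_ignore_initial_segment ennreal_leI)
    then show "hausdorff d (A \<inter> C) + hausdorff d (A - C) \<le> hausdorff d A + ennreal e"
      using order_trans[OF main[of k] add_left_mono] by simp
  qed
qed

text \<open>
  The Caratheodory measurable sets form a sigma algebra that contains the closed sets. Intersecting
  with an arbitrary \<open>K\<close> keeps additivity, since it holds when tested with every set.
\<close>

lemma measure_space_hausdorff:
  "measure_space UNIV (sets borel) (\<lambda>A. hausdorff d (A \<inter> K :: 'a::euclidean_space set))"
proof -
  let ?f = "hausdorff d :: 'a set \<Rightarrow> ennreal"
  let ?L = "lambda_system UNIV (Pow UNIV) ?f"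
  interpret P: sigma_algebra "UNIV :: 'a set" "Pow UNIV" by (rule sigma_algebra_Pow)
  have oms: "outer_measure_space (Pow UNIV) ?f"
    unfolding outer_measure_space_def
    by (intro conjI countably_subadditive_hausdorff)
      (auto simp: positive_def increasing_def hausdorff_mono)
  have ms: "measure_space UNIV ?L ?f" by (rule P.caratheodory_lemma[OF oms])
  then interpret L: sigma_algebra UNIV ?L by (simp add: measure_space_def)
  have "closed C \<Longrightarrow> C \<in> ?L" for C
    unfolding P.lambda_system_eq using hausdorff_split_closed[of C d]
    by (auto intro!: antisym order_trans[OF hausdorff_mono hausdorff_Un_le])
  then have "sigma_sets UNIV (Collect closed) \<subseteq> ?L"
    by (intro L.sigma_sets_subset) auto
  then have sub: "sets borel \<subseteq> ?L"
    by (simp add: borel_eq_closed)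
  show ?thesis
    unfolding measure_space_def
  proof (intro conjI)
    show "sigma_algebra UNIV (sets borel)" using sets.sigma_algebra_axioms[of borel] by simp
    show "positive (sets borel) (\<lambda>A. ?f (A \<inter> K))" by (auto simp: positive_def)
    show "countably_additive (sets borel) (\<lambda>A. ?f (A \<inter> K))"
    proof (rule countably_additiveI)
      fix A :: "nat \<Rightarrow> 'a set"
      assume A: "range A \<subseteq> sets borel" "disjoint_family A"
      show "(\<Sum>i. ?f (A i \<inter> K)) = ?f ((\<Union>i. A i) \<inter> K)"
      proof (rule antisym)
        show "?f ((\<Union>i. A i) \<inter> K) \<le> (\<Sum>i. ?f (A i \<inter> K))"
          using hausdorff_UN_le[of d "\<lambda>i. A i \<inter> K"] by simp
        show "(\<Sum>i. ?f (A i \<inter> K)) \<le> ?f ((\<Union>i. A i) \<inter> K)"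
        proof (rule suminf_le_const)
          fix n
          have "(\<Sum>i<n. ?f (A i \<inter> K)) = ?f (K \<inter> (\<Union>i\<in>{0..<n}. A i))"
            using P.lambda_system_strong_sum[of ?f K A n] A sub oms
            by (auto simp: outer_measure_space_def atLeast0LessThan Int_commute)
          also have "\<dots> \<le> ?f ((\<Union>i. A i) \<inter> K)" by (intro hausdorff_mono) auto
          finally show "(\<Sum>i<n. ?f (A i \<inter> K)) \<le> ?f ((\<Union>i. A i) \<inter> K)" .
        qed simp
      qed
    qed
  qed
qed

lemma sets_hausdorff_restrict [simp, measurable_cong]: "sets (hausdorff_restrict d K) = sets borel"
  unfolding hausdorff_restrict_def by (simp add: sets.sigma_sets_eq[of borel, simplified])

lemma space_hausdorff_restrict [simp]: "space (hausdorff_restrict d K) = UNIV"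
  unfolding hausdorff_restrict_def by (simp add: space_measure_of_conv)

lemma emeasure_hausdorff_restrict:
  assumes "A \<in> sets borel"
  shows "emeasure (hausdorff_restrict d K) A = hausdorff d (A \<inter> K)"
  unfolding hausdorff_restrict_def
  using measure_space_hausdorff[of d K] assms
  by (intro emeasure_measure_of_sigma) (auto simp: measure_space_def)


section \<open>Images and boxes\<close>

lemma hausdorff_premeasure_small:
  assumes "bounded X" "diameter X \<le> a" "a \<le> \<delta>"
  shows "hausdorff_premeasure d \<delta> X \<le> ennreal (unit_ball_vol (real d) * (a / 2) ^ d)"
proof -
  have a: "0 \<le> a" using assms(1,2) diameter_ge_0 order_trans by blast
  have "hausdorff_premeasure d \<delta> X \<le> (\<Sum>i::nat. cover_weight d (if i = 0 then X else {}))"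
    by (rule hausdorff_premeasure_le) (use assms a in \<open>auto split: if_splits\<close>)
  also have "\<dots> = (\<Sum>i\<in>{0::nat}. cover_weight d (if i = 0 then X else {}))"
    by (rule suminf_finite) auto
  also have "\<dots> \<le> ennreal (unit_ball_vol (real d) * (a / 2) ^ d)"
    using assms a diameter_ge_0[of X]
    by (auto simp: cover_weight_def intro!: ennreal_leI mult_left_mono power_mono)
  finally show ?thesis .
qed

lemma hausdorff_premeasure_pieces:
  assumes "finite I" "X \<subseteq> (\<Union>i\<in>I. P i)" "\<And>i. i \<in> I \<Longrightarrow> bounded (P i)"
    "\<And>i. i \<in> I \<Longrightarrow> diameter (P i) \<le> a" "0 \<le> a" "a \<le> \<delta>"
  shows "hausdorff_premeasure d \<delta> X \<le> ennreal (real (card I) * (unit_ball_vol (real d) * (a / 2) ^ d))"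
proof -
  have "hausdorff_premeasure d \<delta> X \<le> (\<Sum>i\<in>I. hausdorff_premeasure d \<delta> (P i))"
    using hausdorff_premeasure_mono[OF assms(2)] hausdorff_premeasure_finite_UN_le[of \<delta> I d P] assms
    by (meson order_trans)
  also have "\<dots> \<le> (\<Sum>i\<in>I. ennreal (unit_ball_vol (real d) * (a / 2) ^ d))"
    by (intro sum_mono hausdorff_premeasure_small) (use assms in auto)
  also have "\<dots> = ennreal (real (card I) * (unit_ball_vol (real d) * (a / 2) ^ d))"
    using assms by (simp add: ennreal_mult ennreal_of_nat_eq_real_of_nat)
  finally show ?thesis .
qed

text \<open>
  A bound for the images of small pieces, at a scale proportional to the diameter of the piece, passes
  to Hausdorff measures. Positivity of \<open>c\<close> matters when the right-hand side is \<open>c * \<infinity>\<close>.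
\<close>

lemma hausdorff_image_le:
  fixes f :: "'a::euclidean_space \<Rightarrow> 'b::euclidean_space"
  assumes "0 < \<rho>" "0 \<le> L" "0 < c"
    and le: "\<And>A. A \<subseteq> E \<Longrightarrow> A \<noteq> {} \<Longrightarrow> bounded A \<Longrightarrow> diameter A \<le> \<rho> \<Longrightarrow>
       hausdorff_premeasure d (L * diameter A) (f ` A)
         \<le> ennreal c * ennreal (unit_ball_vol (real d) * (diameter A / 2) ^ d)"
  shows "hausdorff d (f ` E) \<le> ennreal c * hausdorff d E"
proof (rule hausdorff_leI)
  fix \<delta> :: real assume \<delta>: "0 < \<delta>"
  define \<delta>' where "\<delta>' = min \<rho> (\<delta> / (L + 1))"
  have \<delta>': "0 < \<delta>'" "\<delta>' \<le> \<rho>" using assms(1,2) \<delta> by (auto simp: \<delta>'_def)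
  have "L * \<delta>' \<le> (L + 1) * (\<delta> / (L + 1))"
    using assms(1,2) \<delta> by (intro mult_mono) (auto simp: \<delta>'_def)
  then have L\<delta>': "L * \<delta>' \<le> \<delta>" using assms(2) by (simp split: if_splits)
  have "hausdorff_premeasure d \<delta> (f ` E) \<le> ennreal c * hausdorff_premeasure d \<delta>' E"
    if fin: "hausdorff_premeasure d \<delta>' E < top"
  proof -
    have "hausdorff_premeasure d \<delta> (f ` E) \<le> ennreal c * t" if lt: "hausdorff_premeasure d \<delta>' E < t" for t
    proof -
      obtain A where A: "E \<subseteq> (\<Union>i::nat. A i)" "\<And>i. bounded (A i)" "\<And>i. diameter (A i) \<le> \<delta>'"
         "(\<Sum>i. cover_weight d (A i)) < t"
        using hausdorff_premeasure_cover[OF lt] by metis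
      have "hausdorff_premeasure d \<delta> (f ` E) \<le> hausdorff_premeasure d \<delta> (\<Union>i. f ` (A i \<inter> E))"
        using A(1) by (intro hausdorff_premeasure_mono) blast
      also have "\<dots> \<le> (\<Sum>i. hausdorff_premeasure d \<delta> (f ` (A i \<inter> E)))"
        by (rule hausdorff_premeasure_UN_le)
      also have "\<dots> \<le> (\<Sum>i. ennreal c * cover_weight d (A i))"
      proof (rule suminf_le)
        fix i
        show "hausdorff_premeasure d \<delta> (f ` (A i \<inter> E)) \<le> ennreal c * cover_weight d (A i)"
        proof (cases "A i \<inter> E = {}")
          case True
          then show ?thesis using \<delta> by simp
        next
          case False
          have b: "bounded (A i \<inter> E)" using A(2) by (meson bounded_Int)
          have dm: "diameter (A i \<inter> E) \<le> diameter (A i)"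
            using A(2) by (intro diameter_subset) auto
          have "L * diameter (A i \<inter> E) \<le> L * \<delta>'"
            using dm A(3)[of i] assms(2) by (intro mult_left_mono) auto
          then have "hausdorff_premeasure d \<delta> (f ` (A i \<inter> E))
              \<le> hausdorff_premeasure d (L * diameter (A i \<inter> E)) (f ` (A i \<inter> E))"
            using L\<delta>' by (intro hausdorff_premeasure_antimono) linarith
          also have "\<dots> \<le> ennreal c * ennreal (unit_ball_vol (real d) * (diameter (A i \<inter> E) / 2) ^ d)"
            using b False dm A(3)[of i] \<delta>' by (intro le) auto
          also have "\<dots> \<le> ennreal c * cover_weight d (A i)"
            using False dm b diameter_ge_0[of "A i \<inter> E"]
            by (auto simp: cover_weight_def intro!: mult_left_mono ennreal_leI power_mono)
          finally show ?thesis .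
        qed
      qed auto
      also have "\<dots> = ennreal c * (\<Sum>i. cover_weight d (A i))" by simp
      also have "\<dots> \<le> ennreal c * t" using A(4) by (intro mult_left_mono) auto
      finally show ?thesis .
    qed
    note * = this
    show ?thesis
    proof (rule ennreal_le_epsilon)
      fix e :: real assume e: "0 < e"
      define h where "h = hausdorff_premeasure d \<delta>' E"
      have "h < h + ennreal (e / c)"
        using fin e \<open>0 < c\<close> by (auto simp: h_def ennreal_add_left_cancel_less[where b=0, simplified])
      then have "hausdorff_premeasure d \<delta> (f ` E) \<le> ennreal c * (h + ennreal (e / c))"
        using * by (simp add: h_def)
      also have "\<dots> = ennreal c * h + ennreal e"
        using \<open>0 < c\<close> e by (simp add: distrib_left ennreal_mult[symmetric])
      finally show "hausdorff_premeasure d \<delta> (f ` E) \<le> ennreal c * hausdorff_premeasure d \<delta>' E + ennreal e"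
        by (simp add: h_def)
    qed
  qed
  then have "hausdorff_premeasure d \<delta> (f ` E) \<le> ennreal c * hausdorff_premeasure d \<delta>' E"
    using \<open>0 < c\<close> by (cases "hausdorff_premeasure d \<delta>' E = top")
      (auto simp: less_top ennreal_mult_top ennreal_top_mult)
  also have "\<dots> \<le> ennreal c * hausdorff d E"
    using \<delta>' by (intro mult_left_mono hausdorff_premeasure_le_hausdorff) auto
  finally show "hausdorff_premeasure d \<delta> (f ` E) \<le> ennreal c * hausdorff d E" .
qed

lemma hausdorff_lipschitz_image_le:
  fixes f :: "'a::euclidean_space \<Rightarrow> 'b::euclidean_space"
  assumes f: "L-lipschitz_on E f" and L: "0 < L"
  shows "hausdorff d (f ` E) \<le> ennreal (L ^ d) * hausdorff d E"
proof (rule hausdorff_image_le[of 1 L])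
  fix A assume A: "A \<subseteq> E" "A \<noteq> {}" "bounded A" "diameter A \<le> 1"
  have d: "dist (f x) (f y) \<le> L * diameter A" if "x \<in> A" "y \<in> A" for x y
  proof -
    have "dist (f x) (f y) \<le> L * dist x y" using lipschitz_onD[OF f] that A by blast
    also have "\<dots> \<le> L * diameter A"
      using L A(3) that by (intro mult_left_mono diameter_bounded_bound) auto
    finally show ?thesis .
  qed
  have dia: "diameter (f ` A) \<le> L * diameter A"
    using A d by (intro diameter_le) (auto simp: dist_norm)
  obtain a where "a \<in> A" using A by auto
  then have "bounded (f ` A)"
    unfolding bounded_def using d by (intro exI[of _ "f a"] exI[of _ "L * diameter A"]) auto
  then have "hausdorff_premeasure d (L * diameter A) (f ` A)
      \<le> ennreal (unit_ball_vol (real d) * (L * diameter A / 2) ^ d)"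
    using dia by (intro hausdorff_premeasure_small) auto
  also have "\<dots> = ennreal (L ^ d) * ennreal (unit_ball_vol (real d) * (diameter A / 2) ^ d)"
    using L diameter_ge_0[OF A(3)]
    by (simp add: ennreal_mult[symmetric] power_divide power_mult_distrib mult.left_commute)
  finally show "hausdorff_premeasure d (L * diameter A) (f ` A)
      \<le> ennreal (L ^ d) * ennreal (unit_ball_vol (real d) * (diameter A / 2) ^ d)" .
qed (use L in auto)

lemma norm_le_DIM:
  fixes x :: "'a::euclidean_space" and a :: real
  assumes "\<And>i. i \<in> Basis \<Longrightarrow> \<bar>x \<bullet> i\<bar> \<le> a"
  shows "norm x \<le> DIM('a) * a"
  using norm_le_l1[of x] sum_mono[of Basis "\<lambda>i. \<bar>x \<bullet> i\<bar>" "\<lambda>_. a"] assms by simp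

text \<open>
  A map that stretches distances by a factor \<open>C * m\<close> in the coordinates of \<open>B\<close> but only by \<open>C\<close> in the
  others increases area by a factor \<open>m ^ card B\<close> rather than \<open>m ^ d\<close>: the image of a set of diameter \<open>a\<close>
  lies in a box that is long in the directions \<open>B\<close> only, and is cut into about \<open>m ^ card B\<close> pieces of
  diameter comparable to \<open>a\<close>. It suffices to know the estimates at distances up to \<open>\<rho>\<close>, because
  Hausdorff measure only sees small scales; this allows jumps of \<open>f\<close> between far apart points.
\<close>

lemma hausdorff_anisotropic_image_le:
  fixes f :: "'a::euclidean_space \<Rightarrow> 'b::euclidean_space" and C :: real
  assumes d: "1 \<le> d" and C: "0 < C" and m: "1 \<le> m" and B: "B \<subseteq> Basis" and \<rho>: "0 < \<rho>"
    and slow: "\<And>x y i. x \<in> E \<Longrightarrow> y \<in> E \<Longrightarrow> dist x y \<le> \<rho> \<Longrightarrow> i \<in> Basis - B \<Longrightarrow>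
                \<bar>f x \<bullet> i - f y \<bullet> i\<bar> \<le> C * dist x y"
    and fast: "\<And>x y i. x \<in> E \<Longrightarrow> y \<in> E \<Longrightarrow> dist x y \<le> \<rho> \<Longrightarrow> i \<in> B \<Longrightarrow>
                \<bar>f x \<bullet> i - f y \<bullet> i\<bar> \<le> C * real m * dist x y"
  shows "hausdorff d (f ` E) \<le> ennreal ((3 * real m) ^ card B * (DIM('b) * C) ^ d) * hausdorff d E"
proof (rule hausdorff_image_le[OF \<rho>])
  fix A assume A: "A \<subseteq> E" "A \<noteq> {}" "bounded A" "diameter A \<le> \<rho>"
  have finB: "finite B" by (rule finite_subset[OF B finite_Basis])
  obtain x0 where x0: "x0 \<in> A" using A by auto
  let ?a = "diameter A"
  have a0: "0 \<le> ?a" by (rule diameter_ge_0[OF A(3)])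
  have da: "dist x y \<le> ?a" "dist x y \<le> \<rho>" if "x \<in> A" "y \<in> A" for x y
    using diameter_bounded_bound[OF A(3) that] A(4) by auto
  have fast': "\<bar>f x \<bullet> i - f y \<bullet> i\<bar> \<le> C * real m * ?a" if "x \<in> A" "y \<in> A" "i \<in> B" for x y i
  proof -
    have "\<bar>f x \<bullet> i - f y \<bullet> i\<bar> \<le> C * real m * dist x y"
      using that A(1) da(2)[OF that(1,2)] by (intro fast) auto
    also have "\<dots> \<le> C * real m * ?a"
      using C da(1)[OF that(1,2)] by (intro mult_left_mono) auto
    finally show ?thesis .
  qed
  have slow': "\<bar>f x \<bullet> i - f y \<bullet> i\<bar> \<le> C * ?a" if "x \<in> A" "y \<in> A" "i \<in> Basis - B" for x y i
  proof -
    have "\<bar>f x \<bullet> i - f y \<bullet> i\<bar> \<le> C * dist x y"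
      using that A(1) da(2)[OF that(1,2)] by (intro slow) auto
    also have "\<dots> \<le> C * ?a"
      using C da(1)[OF that(1,2)] by (intro mult_left_mono) auto
    finally show ?thesis .
  qed
  define q where "q = (\<lambda>y i. \<lfloor>(y \<bullet> i - f x0 \<bullet> i) / (C * ?a)\<rfloor>)"
  define W where "W = (PiE B (\<lambda>_. {- int m .. int m}))"
  define P where "P = (\<lambda>w. {y \<in> f ` A. \<forall>i\<in>B. q y i = w i})"
  have near: "\<bar>y \<bullet> i - z \<bullet> i\<bar> \<le> C * ?a" if yz: "y \<in> P w" "z \<in> P w" and i: "i \<in> Basis" for y z w i
  proof (cases "i \<in> B \<and> ?a > 0")
    case False
    obtain y' z' where "y' \<in> A" "z' \<in> A" "y = f y'" "z = f z'" using yz by (auto simp: P_def)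
    then show ?thesis using slow'[of y' z' i] fast'[of y' z' i] i False a0 by force
  next
    case True
    let ?u = "(y \<bullet> i - f x0 \<bullet> i) / (C * ?a)" and ?v = "(z \<bullet> i - f x0 \<bullet> i) / (C * ?a)"
    have "q y i = q z i" using yz True by (auto simp: P_def)
    then have "\<bar>?u - ?v\<bar> \<le> 1" unfolding q_def by linarith
    moreover have "?u - ?v = (y \<bullet> i - z \<bullet> i) / (C * ?a)" by (simp add: diff_divide_distrib)
    ultimately show ?thesis using True C by (simp add: abs_mult field_simps)
  qed
  have dP: "dist y z \<le> DIM('b) * (C * ?a)" if "y \<in> P w" "z \<in> P w" for y z w
    unfolding dist_norm by (rule norm_le_DIM) (use near that in \<open>auto simp: inner_diff_left\<close>)
  have 1: "hausdorff_premeasure d (DIM('b) * (C * ?a)) (f ` A)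
      \<le> ennreal (real (card W) * (unit_ball_vol (real d) * (DIM('b) * (C * ?a) / 2) ^ d))"
  proof (rule hausdorff_premeasure_pieces[where P = P])
    show "finite W" unfolding W_def by (rule finite_PiE) (use finB in simp_all)
    show "f ` A \<subseteq> (\<Union>w\<in>W. P w)"
    proof clarify
      fix x assume x: "x \<in> A"
      have "q (f x) i \<in> {- int m .. int m}" if "i \<in> B" for i
      proof (cases "?a = 0")
        case False
        then have "0 < C * ?a" using C a0 by simp
        then have "\<bar>(f x \<bullet> i - f x0 \<bullet> i) / (C * ?a)\<bar> \<le> real m"
          using fast'[OF x x0 that] unfolding abs_divide by (simp add: pos_divide_le_eq ac_simps)
        then have "- real m \<le> (f x \<bullet> i - f x0 \<bullet> i) / (C * ?a)" "(f x \<bullet> i - f x0 \<bullet> i) / (C * ?a) \<le> real m"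
          by linarith+
        then show ?thesis unfolding q_def by (simp add: floor_le_iff le_floor_iff)
      qed (simp add: q_def)
      then have "restrict (q (f x)) B \<in> W" by (auto simp: W_def)
      moreover have "f x \<in> P (restrict (q (f x)) B)" using x by (auto simp: P_def)
      ultimately show "f x \<in> (\<Union>w\<in>W. P w)" by blast
    qed
    show "bounded (P w)" for w
      unfolding bounded_two_points using dP[of _ w] by blast
    show "diameter (P w) \<le> DIM('b) * (C * ?a)" for w
      using dP[of _ w] a0 C by (intro diameter_le) (auto simp: dist_norm)
  qed (use a0 C in auto)
  have 2: "ennreal (real (card W) * (unit_ball_vol (real d) * (DIM('b) * (C * ?a) / 2) ^ d)) \<le> ennreal ((3 * real m) ^ card B * (unit_ball_vol (real d) * (DIM('b) * (C * ?a) / 2) ^ d))"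
  proof (intro ennreal_leI mult_right_mono)
    have "card {- int m..int m} = 2 * m + 1" by simp
    then have "real (card W) = real (2 * m + 1) ^ card B"
      using finB by (simp add: W_def card_PiE)
    also have "\<dots> \<le> (3 * real m) ^ card B"
      by (rule power_mono) (use m in simp_all)
    finally show "real (card W) \<le> (3 * real m) ^ card B" .
  qed (use a0 C in auto)
  have 3: "(3 * real m) ^ card B * (unit_ball_vol (real d) * (DIM('b) * (C * ?a) / 2) ^ d)
      = (3 * real m) ^ card B * (DIM('b) * C) ^ d * (unit_ball_vol (real d) * (?a / 2) ^ d)"
  proof -
    have "(real DIM('b) * (C * ?a) / 2) ^ d = (DIM('b) * C) ^ d * (?a / 2) ^ d"
      unfolding power_mult_distrib[symmetric] by (simp add: mult.assoc)
    then show ?thesis by (simp only: ac_simps)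
  qed
  have 4: "ennreal ((3 * real m) ^ card B * (DIM('b) * C) ^ d * (unit_ball_vol (real d) * (?a / 2) ^ d))
      = ennreal ((3 * real m) ^ card B * (DIM('b) * C) ^ d) * ennreal (unit_ball_vol (real d) * (?a / 2) ^ d)"
    by (rule ennreal_mult) (use C a0 in simp_all)
  show "hausdorff_premeasure d (DIM('b) * C * ?a) (f ` A)
     \<le> ennreal ((3 * real m) ^ card B * (DIM('b) * C) ^ d) * ennreal (unit_ball_vol (real d) * (?a / 2) ^ d)"
    using order_trans[OF 1 2] unfolding 3 4 by (simp only: mult.assoc)
qed (use C m in auto)

text \<open>
  The box with free coordinates \<open>B\<close> is cut into cubes of side \<open>1 / m\<close>, about \<open>m ^ card B\<close> of them, each
  of weight comparable to \<open>1 / m ^ d\<close>.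
\<close>

lemma hausdorff_premeasure_box_le:
  fixes c :: "'a::euclidean_space" and X B :: "'a set"
  assumes B: "B \<subseteq> Basis" and m: "1 \<le> m" and \<delta>: "real DIM('a) / real m \<le> \<delta>"
    and X: "\<And>x i. x \<in> X \<Longrightarrow> i \<in> Basis - B \<Longrightarrow> x \<bullet> i = c \<bullet> i"
      "\<And>x i. x \<in> X \<Longrightarrow> i \<in> B \<Longrightarrow> \<bar>x \<bullet> i\<bar> \<le> real r"
  shows "hausdorff_premeasure d \<delta> X \<le>
     ennreal ((2 * real r + 1) ^ card B * (unit_ball_vol (real d) * (DIM('a) / 2) ^ d) * (real m ^ card B / real m ^ d))"
proof -
  have finB: "finite B" by (rule finite_subset[OF B finite_Basis])
  define q where "q = (\<lambda>x i::'a. \<lfloor>real m * (x \<bullet> i)\<rfloor>)"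
  define W where "W = (PiE B (\<lambda>_. {- int (m * r) .. int (m * r)}))"
  define P where "P = (\<lambda>w. {x \<in> X. \<forall>i\<in>B. q x i = w i})"
  have near: "\<bar>y \<bullet> i - z \<bullet> i\<bar> \<le> 1 / m" if yz: "y \<in> P w" "z \<in> P w" and i: "i \<in> Basis" for y z w i
  proof (cases "i \<in> B")
    case False
    then show ?thesis using yz i X(1)[of y i] X(1)[of z i] by (auto simp: P_def)
  next
    case True
    have "q y i = q z i" using yz True by (auto simp: P_def)
    then have "\<bar>real m * (y \<bullet> i) - real m * (z \<bullet> i)\<bar> \<le> 1" unfolding q_def by linarith
    then have "real m * \<bar>y \<bullet> i - z \<bullet> i\<bar> \<le> 1"
      by (simp add: right_diff_distrib[symmetric] abs_mult)
    then show ?thesis using m by (simp add: field_simps)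
  qed
  have dP: "dist y z \<le> DIM('a) * (1 / m)" if "y \<in> P w" "z \<in> P w" for y z w
    unfolding dist_norm by (rule norm_le_DIM) (use near that in \<open>auto simp: inner_diff_left\<close>)
  have 1: "hausdorff_premeasure d \<delta> X
      \<le> ennreal (real (card W) * (unit_ball_vol (real d) * (DIM('a) * (1 / m) / 2) ^ d))"
  proof (rule hausdorff_premeasure_pieces[where P = P])
    show "finite W" unfolding W_def by (rule finite_PiE) (use finB in simp_all)
    show "X \<subseteq> (\<Union>w\<in>W. P w)"
    proof
      fix x assume x: "x \<in> X"
      have "q x i \<in> {- int (m * r) .. int (m * r)}" if "i \<in> B" for i
      proof -
        have "\<bar>real m * (x \<bullet> i)\<bar> \<le> real m * real r"
          using X(2)[OF x that] by (simp add: abs_mult mult_left_mono)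
        then show ?thesis unfolding q_def by (auto simp: abs_le_iff floor_le_iff le_floor_iff)
      qed
      then have "restrict (q x) B \<in> W" by (auto simp: W_def)
      moreover have "x \<in> P (restrict (q x) B)" using x by (auto simp: P_def)
      ultimately show "x \<in> (\<Union>w\<in>W. P w)" by blast
    qed
    show "bounded (P w)" for w
      unfolding bounded_two_points using dP[of _ w] by blast
    show "diameter (P w) \<le> DIM('a) * (1 / m)" for w
      using dP[of _ w] by (intro diameter_le) (auto simp: dist_norm)
  qed (use \<delta> in auto)
  have 2: "ennreal (real (card W) * (unit_ball_vol (real d) * (DIM('a) * (1 / m) / 2) ^ d)) \<le> ennreal ((real m * (2 * real r + 1)) ^ card B * (unit_ball_vol (real d) * (DIM('a) * (1 / m) / 2) ^ d))"
  proof (intro ennreal_leI mult_right_mono)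
    have "card {- int (m * r)..int (m * r)} = 2 * (m * r) + 1" by (simp add: nat_add_distrib nat_mult_distrib)
    then have "real (card W) = real (2 * (m * r) + 1) ^ card B"
      using finB by (simp add: W_def card_PiE)
    also have "\<dots> \<le> (real m * (2 * real r + 1)) ^ card B"
      by (rule power_mono) (use m in \<open>simp_all add: algebra_simps\<close>)
    finally show "real (card W) \<le> (real m * (2 * real r + 1)) ^ card B" .
  qed auto
  have 3: "(real m * (2 * real r + 1)) ^ card B * (unit_ball_vol (real d) * (DIM('a) * (1 / m) / 2) ^ d) = ((2 * real r + 1) ^ card B * (unit_ball_vol (real d) * (DIM('a) / 2) ^ d) * (real m ^ card B / real m ^ d))"
  proof -
    have "(real DIM('a) * (1 / real m) / 2) ^ d = (DIM('a) / 2) ^ d / real m ^ d"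
      unfolding power_divide[symmetric] by (simp add: mult.commute)
    then show ?thesis unfolding power_mult_distrib by simp
  qed
  show ?thesis using order_trans[OF 1 2] unfolding 3 .
qed

lemma hausdorff_box_finite:
  fixes c :: "'a::euclidean_space" and X B :: "'a set"
  assumes B: "B \<subseteq> Basis" "card B = d"
    and X: "\<And>x i. x \<in> X \<Longrightarrow> i \<in> Basis - B \<Longrightarrow> x \<bullet> i = c \<bullet> i"
      "\<And>x i. x \<in> X \<Longrightarrow> i \<in> B \<Longrightarrow> \<bar>x \<bullet> i\<bar> \<le> real r"
  shows "hausdorff d X < top"
proof -
  have "hausdorff d X \<le> ennreal ((2 * real r + 1) ^ d * (unit_ball_vol (real d) * (DIM('a) / 2) ^ d))"
  proof (rule hausdorff_leI)
    fix \<delta> :: real assume \<delta>: "0 < \<delta>"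
    obtain m :: nat where m: "real DIM('a) / \<delta> < m" using reals_Archimedean2 by blast
    have "0 < real DIM('a) / \<delta>" using \<delta> by simp
    then have m1: "1 \<le> m" using m by linarith
    have m\<delta>: "real DIM('a) / real m \<le> \<delta>" using m \<delta> m1 by (simp add: field_simps)
    show "hausdorff_premeasure d \<delta> X \<le> ennreal ((2 * real r + 1) ^ d * (unit_ball_vol (real d) * (DIM('a) / 2) ^ d))"
      using hausdorff_premeasure_box_le[where X = X and d = d and c = c, OF B(1) m1 m\<delta> X] m1 B(2) by simp
  qed
  then show ?thesis by (rule le_less_trans) simp
qed

lemma hausdorff_box_null:
  fixes c :: "'a::euclidean_space" and X B :: "'a set"
  assumes B: "B \<subseteq> Basis" "card B < d"
    and X: "\<And>x i. x \<in> X \<Longrightarrow> i \<in> Basis - B \<Longrightarrow> x \<bullet> i = c \<bullet> i"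
      "\<And>x i. x \<in> X \<Longrightarrow> i \<in> B \<Longrightarrow> \<bar>x \<bullet> i\<bar> \<le> real r"
  shows "hausdorff d X = 0"
proof -
  define K where "K = (2 * real r + 1) ^ card B * (unit_ball_vol (real d) * (DIM('a) / 2) ^ d)"
  have K: "0 \<le> K" by (simp add: K_def)
  have "hausdorff d X \<le> 0"
  proof (rule hausdorff_leI)
    fix \<delta> :: real assume \<delta>: "0 < \<delta>"
    show "hausdorff_premeasure d \<delta> X \<le> 0"
    proof (rule ennreal_le_epsilon)
      fix e :: real assume e: "0 < e"
      obtain m :: nat where m: "max (max 1 (real DIM('a) / \<delta>)) (K / e) < m" using reals_Archimedean2 by blast
      then have m1: "1 \<le> m" and mK: "K / e < m" and m\<delta>: "real DIM('a) / \<delta> < m" by linarith+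
      have "real m ^ card B * real m \<le> real m ^ d"
        using B(2) m1 power_increasing[of "Suc (card B)" d "real m"] by (simp add: mult.commute)
      then have "real m ^ card B / real m ^ d \<le> 1 / real m" using m1 by (simp add: divide_simps)
      then have le1: "K * (real m ^ card B / real m ^ d) \<le> K * (1 / real m)" using K by (rule mult_left_mono)
      have "K * (1 / real m) \<le> e"
        using mK e m1 by (simp add: pos_divide_less_eq pos_divide_le_eq mult.commute)
      with le1 have "K * (real m ^ card B / real m ^ d) \<le> e" by linarith
      then have "ennreal (K * (real m ^ card B / real m ^ d)) \<le> ennreal e" by (rule ennreal_leI)
      moreover have m\<delta>': "real DIM('a) / real m \<le> \<delta>" using m\<delta> \<delta> m1 by (simp add: field_simps)
      ultimately show "hausdorff_premeasure d \<delta> X \<le> 0 + ennreal e"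
        using hausdorff_premeasure_box_le[where X = X and d = d and c = c, OF B(1) m1 m\<delta>' X]
        unfolding K_def by (auto simp: add_0 intro: order_trans)
    qed
  qed
  then show ?thesis by simp
qed


section \<open>Pushing into the skeleton of a grid\<close>

text \<open>
  Climbs from \<open>k\<close> to \<open>k + 1\<close> with slope \<open>m\<close> on the interval from \<open>k\<close> to \<open>k + 1/m\<close> and is constant on
  the rest of the unit interval. Applied in every coordinate, such a function moves all points to the
  grid except those in thin slabs.
\<close>

definition stair :: "nat \<Rightarrow> real \<Rightarrow> real" where
  "stair m s = of_int \<lfloor>s\<rfloor> + min 1 (real m * frac s)"

lemma stair_diff_le:
  assumes m: "1 \<le> m" and "s \<le> s'"
  shows "stair m s \<le> stair m s'" "stair m s' - stair m s \<le> real m * (s' - s)"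
proof -
  have "stair m s \<le> stair m s' \<and> stair m s' - stair m s \<le> real m * (s' - s)"
  proof (cases "\<lfloor>s\<rfloor> = \<lfloor>s'\<rfloor>")
    case True
    then have f: "frac s' - frac s = s' - s" by (simp add: frac_def)
    then have "real m * frac s \<le> real m * frac s'" 
      using \<open>s \<le> s'\<close> by (intro mult_left_mono) auto
    moreover have "real m * frac s' - real m * frac s = real m * (s' - s)"
      using f by (metis right_diff_distrib)
    moreover have "0 \<le> real m * (s' - s)" using \<open>s \<le> s'\<close> by simp
    ultimately show ?thesis unfolding stair_def True by linarith
  next
    case False
    define k k' where "k = \<lfloor>s\<rfloor>" and "k' = \<lfloor>s'\<rfloor>"
    have kk: "k + 1 \<le> k'" using False floor_mono[OF \<open>s \<le> s'\<close>] by (simp add: k_def k'_def)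
    have s: "of_int k \<le> s" "s < of_int k + 1" and s': "of_int k' \<le> s'"
      by (auto simp: k_def k'_def)
    have k'r: "real_of_int k + 1 \<le> real_of_int k'" using kk by linarith
    have up: "stair m s' \<le> of_int k' + real m * (s' - of_int k')" "of_int k' \<le> stair m s'"
      using s' by (auto simp: stair_def frac_def k'_def)
    have lo: "of_int k' - real m * (of_int k' - s) \<le> stair m s"
    proof (cases "real m * frac s \<le> 1")
      case True
      have "0 \<le> (real m - 1) * (real_of_int k' - of_int k)" using m k'r by (intro mult_nonneg_nonneg) auto
      moreover have "stair m s = of_int k + real m * (s - of_int k)"
        using True by (simp add: stair_def k_def frac_def)
      ultimately show ?thesis by (simp add: algebra_simps)
    next
      case False
      have "1 * (of_int k' - s) \<le> real m * (of_int k' - s)" using m s k'r by (intro mult_right_mono) auto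
      moreover have "stair m s = of_int k + 1" using False by (simp add: stair_def k_def)
      ultimately have "of_int k' - real m * (of_int k' - s) \<le> s" "s \<le> stair m s" using s by simp_all
      then show ?thesis by (rule order_trans)
    qed
    have "stair m s \<le> of_int k + 1" by (simp add: stair_def k_def)
    then show ?thesis using up lo k'r by (simp add: algebra_simps)
  qed
  then show "stair m s \<le> stair m s'" "stair m s' - stair m s \<le> real m * (s' - s)" by auto
qed

lemma stair_lipschitz: "1 \<le> m \<Longrightarrow> \<bar>stair m s - stair m s'\<bar> \<le> real m * \<bar>s - s'\<bar>"
  using stair_diff_le[of m s s'] stair_diff_le[of m s' s] by (cases "s \<le> s'") auto

lemma stair_near: assumes "1 \<le> m" shows "0 \<le> stair m s - s" "stair m s - s \<le> 1"
proof -
  have "1 * frac s \<le> real m * frac s" using assms by (intro mult_right_mono) auto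
  moreover have "stair m s - s = min 1 (real m * frac s) - frac s" by (simp add: stair_def frac_def)
  ultimately show "0 \<le> stair m s - s" "stair m s - s \<le> 1"
    using frac_lt_1[of s] frac_ge_0[of s] by linarith+
qed

lemma stair_flat: "1 \<le> real m * frac s \<Longrightarrow> stair m s = of_int (\<lfloor>s\<rfloor> + 1)"
  by (simp add: stair_def)

text \<open>
  The first digit of \<open>t / h\<close> after the point, in base \<open>m\<close>. The points of the line with digit \<open>v\<close> make up
  the intervals in which the staircase shifted by \<open>v\<close> is steep; so for each point exactly one of the \<open>m\<close>
  possible shifts is bad.
\<close>

definition digit :: "nat \<Rightarrow> real \<Rightarrow> real \<Rightarrow> int" where
  "digit m h t = \<lfloor>real m * t / h\<rfloor> mod int m"

definition grid_stair :: "nat \<Rightarrow> real \<Rightarrow> int \<Rightarrow> real \<Rightarrow> real" where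
  "grid_stair m h v t = h * (stair m (t / h - v / m) + v / m)"

lemma flat_if_digit_neq:
  assumes m: "1 \<le> m" and v: "v \<in> {0..<int m}" and ne: "digit m h t \<noteq> v"
  shows "1 \<le> real m * frac (t / h - v / m)"
proof (rule ccontr)
  assume "\<not> ?thesis"
  then have lt: "real m * frac (t / h - v / m) < 1" by simp
  define u where "u = real m * t / h"
  define s where "s = t / h - v / m"
  have ms: "real m * s = u - v" using m by (simp add: u_def s_def field_simps)
  have "real m * frac s = u - v - m * \<lfloor>s\<rfloor>"
    using ms by (simp add: frac_def algebra_simps)
  moreover have "0 \<le> real m * frac s" by simp
  ultimately have "\<lfloor>u\<rfloor> = v + int m * \<lfloor>s\<rfloor>"
    using lt unfolding s_def[symmetric] by (intro floor_unique) auto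
  then have "digit m h t = v"
    using v by (simp add: digit_def u_def)
  with ne show False by simp
qed

lemma grid_stair_near:
  assumes "1 \<le> m" "0 < h" shows "\<bar>grid_stair m h v t - t\<bar> \<le> h"
proof -
  have "grid_stair m h v t - t = h * (stair m (t / h - v / m) - (t / h - v / m))"
    using assms by (simp add: grid_stair_def field_simps)
  moreover have "\<bar>stair m (t / h - v / m) - (t / h - v / m)\<bar> \<le> 1"
    using stair_near[OF assms(1)] by (simp add: abs_le_iff)
  ultimately show ?thesis using assms(2) by (simp add: abs_mult)
qed

lemma grid_stair_lipschitz:
  assumes "1 \<le> m" "0 < h" shows "\<bar>grid_stair m h v t - grid_stair m h v t'\<bar> \<le> real m * \<bar>t - t'\<bar>"
proof -
  have "\<bar>grid_stair m h v t - grid_stair m h v t'\<bar> = h * \<bar>stair m (t / h - v / m) - stair m (t' / h - v / m)\<bar>"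
    using assms by (simp add: grid_stair_def right_diff_distrib[symmetric] abs_mult)
  also have "\<dots> \<le> h * (real m * \<bar>(t / h - v / m) - (t' / h - v / m)\<bar>)"
    using assms by (intro mult_left_mono stair_lipschitz) auto
  also have "\<bar>(t / h - v / m) - (t' / h - v / m)\<bar> = \<bar>t - t'\<bar> / h"
    using assms by (simp add: diff_divide_distrib[symmetric])
  finally show ?thesis using assms by (simp add: ac_simps)
qed

lemma grid_stair_flat:
  assumes "1 \<le> m" "v \<in> {0..<int m}" "digit m h t \<noteq> v"
  shows "grid_stair m h v t = h * (of_int (\<lfloor>t / h - v / m\<rfloor> + 1) + v / m)"
  using stair_flat[OF flat_if_digit_neq[OF assms]] by (simp add: grid_stair_def)

lemma grid_stair_eq:
  assumes m: "1 \<le> m" and h: "0 < h" and v: "v \<in> {0..<int m}" and t: "digit m h t \<noteq> v" "digit m h t' \<noteq> v"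
    and close: "\<bar>t - t'\<bar> \<le> h / m"
  shows "grid_stair m h v t = grid_stair m h v t'"
proof -
  have *: "\<lfloor>t / h - v / m\<rfloor> = \<lfloor>t' / h - v / m\<rfloor>"
    if t: "digit m h t \<noteq> v" "digit m h t' \<noteq> v" and close: "\<bar>t - t'\<bar> \<le> h / m" and le: "t \<le> t'" for t t'
  proof (rule ccontr)
    let ?s = "t / h - v / m" and ?s' = "t' / h - v / m"
    assume ne: "\<lfloor>?s\<rfloor> \<noteq> \<lfloor>?s'\<rfloor>"
    have "?s \<le> ?s'" using le h by (simp add: divide_right_mono)
    then have "\<lfloor>?s\<rfloor> + 1 \<le> \<lfloor>?s'\<rfloor>" using ne floor_mono[of ?s ?s'] by linarith
    then have "real_of_int \<lfloor>?s\<rfloor> + 1 \<le> real_of_int \<lfloor>?s'\<rfloor>" by linarith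
    moreover have "1 / m \<le> frac ?s'"
      using flat_if_digit_neq[OF m v t(2)] m by (simp add: pos_divide_le_eq mult.commute)
    ultimately have "?s + 1 / m < ?s'"
      unfolding frac_def by linarith
    moreover have "?s' - ?s = (t' - t) / h" by (simp add: diff_divide_distrib)
    moreover have "(t' - t) / h \<le> (h / m) / h" using close h by (intro divide_right_mono) auto
    ultimately show False using h by simp
  qed
  have "\<lfloor>t / h - v / m\<rfloor> = \<lfloor>t' / h - v / m\<rfloor>"
  proof (cases "t \<le> t'")
    case True
    then show ?thesis using *[OF t close] by simp
  next
    case False
    then show ?thesis using *[OF t(2,1)] close abs_minus_commute[of t t'] by simp
  qed
  then show ?thesis using grid_stair_flat[OF m v] t by simp
qed

text \<open>
  The staircase with shift \<open>v i\<close> in the \<open>i\<close>-th coordinate, faded out where \<open>l\<close> decreases from \<open>1\<close> to \<open>0\<close>.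
\<close>

definition grid_map :: "nat \<Rightarrow> real \<Rightarrow> ('a::euclidean_space \<Rightarrow> int) \<Rightarrow> ('a \<Rightarrow> real) \<Rightarrow> 'a \<Rightarrow> 'a" where
  "grid_map m h v l y = y + (\<Sum>i\<in>Basis. (l y * (grid_stair m h (v i) (y \<bullet> i) - y \<bullet> i)) *\<^sub>R i)"

lemma grid_map_inner:
  "i \<in> Basis \<Longrightarrow> grid_map m h v l y \<bullet> i = y \<bullet> i + l y * (grid_stair m h (v i) (y \<bullet> i) - y \<bullet> i)"
  by (simp add: grid_map_def inner_add_left inner_sum_left_Basis)

lemma grid_map_id: "l y = 0 \<Longrightarrow> grid_map m h v l y = y"
  by (simp add: grid_map_def)

lemma grid_map_near:
  fixes y :: "'a::euclidean_space" and h :: real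
  assumes m: "1 \<le> m" and h: "0 < h" and l: "0 \<le> l y" "l y \<le> 1"
  shows "norm (grid_map m h v l y - y) \<le> DIM('a) * h"
proof (rule norm_le_DIM)
  fix i :: 'a assume i: "i \<in> Basis"
  have "\<bar>(grid_map m h v l y - y) \<bullet> i\<bar> = l y * \<bar>grid_stair m h (v i) (y \<bullet> i) - y \<bullet> i\<bar>"
    using i l by (simp add: grid_map_inner inner_diff_left abs_mult)
  also have "\<dots> \<le> 1 * h"
    using l h grid_stair_near[OF m h] by (intro mult_mono) auto
  finally show "\<bar>(grid_map m h v l y - y) \<bullet> i\<bar> \<le> h" by simp
qed

context
  fixes m :: nat and h :: real and v :: "'a::euclidean_space \<Rightarrow> int" and l :: "'a \<Rightarrow> real"
  assumes m: "1 \<le> m" and h: "0 < h" "h \<le> 1"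
    and l: "\<And>y. 0 \<le> l y" "\<And>y. l y \<le> 1" and l_lip: "1-lipschitz_on UNIV l"
begin

lemma grid_map_fast:
  assumes i: "i \<in> Basis"
  shows "\<bar>grid_map m h v l x \<bullet> i - grid_map m h v l y \<bullet> i\<bar> \<le> 4 * real m * dist x y"
proof -
  let ?a = "\<lambda>z. grid_stair m h (v i) (z \<bullet> i) - z \<bullet> i"
  have xy: "\<bar>x \<bullet> i - y \<bullet> i\<bar> \<le> dist x y"
    using Basis_le_norm[OF i, of "x - y"] by (simp add: inner_diff_left dist_norm)
  have "real m * \<bar>x \<bullet> i - y \<bullet> i\<bar> \<le> real m * dist x y" using xy by (rule mult_left_mono) simp
  then have a: "\<bar>?a x - ?a y\<bar> \<le> real m * dist x y + dist x y"
    using grid_stair_lipschitz[OF m h(1), of "v i" "x \<bullet> i" "y \<bullet> i"] xy by linarith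
  have ll: "\<bar>l x - l y\<bar> \<le> dist x y" using lipschitz_onD[OF l_lip, of x y] by (simp add: dist_real_def)
  have ax: "\<bar>?a x\<bar> \<le> 1" using grid_stair_near[OF m h(1), of "v i" "x \<bullet> i"] h(2) by linarith
  have 1: "\<bar>(l x - l y) * ?a x\<bar> \<le> dist x y * 1"
    unfolding abs_mult by (rule mult_mono[OF ll ax]) auto
  have 2: "\<bar>l y * (?a x - ?a y)\<bar> \<le> 1 * (real m * dist x y + dist x y)"
    unfolding abs_mult using l[of y] by (intro mult_mono a) auto
  have "grid_map m h v l x \<bullet> i - grid_map m h v l y \<bullet> i
      = (x \<bullet> i - y \<bullet> i) + ((l x - l y) * ?a x + l y * (?a x - ?a y))"
    using i by (simp add: grid_map_inner algebra_simps)
  then have "\<bar>grid_map m h v l x \<bullet> i - grid_map m h v l y \<bullet> i\<bar>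
      \<le> \<bar>x \<bullet> i - y \<bullet> i\<bar> + (\<bar>(l x - l y) * ?a x\<bar> + \<bar>l y * (?a x - ?a y)\<bar>)"
    by (simp only: order_trans[OF abs_triangle_ineq add_left_mono[OF abs_triangle_ineq]])
  also have "\<dots> \<le> dist x y + (dist x y * 1 + 1 * (real m * dist x y + dist x y))"
    by (intro add_mono xy 1 2)
  also have "\<dots> = (3 + real m) * dist x y" by (simp add: algebra_simps)
  also have "\<dots> \<le> 4 * real m * dist x y"
    using m by (intro mult_right_mono) auto
  finally show ?thesis .
qed

text \<open>
  Where the staircase of coordinate \<open>i\<close> is flat at both points, and these are so close that they lie on
  the same step, the coordinate is stretched by a bounded factor only. This is also true where the map
  is faded out, hence the whole deformation has bounded area cost on average.
\<close>

lemma grid_map_slow: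
  assumes i: "i \<in> Basis" and v: "v i \<in> {0..<int m}"
    and x: "digit m h (x \<bullet> i) \<noteq> v i" and y: "digit m h (y \<bullet> i) \<noteq> v i" and close: "dist x y \<le> h / m"
  shows "\<bar>grid_map m h v l x \<bullet> i - grid_map m h v l y \<bullet> i\<bar> \<le> 4 * dist x y"
proof -
  let ?a = "\<lambda>z. grid_stair m h (v i) (z \<bullet> i) - z \<bullet> i"
  have xy: "\<bar>x \<bullet> i - y \<bullet> i\<bar> \<le> dist x y"
    using Basis_le_norm[OF i, of "x - y"] by (simp add: inner_diff_left dist_norm)
  have eq: "grid_stair m h (v i) (x \<bullet> i) = grid_stair m h (v i) (y \<bullet> i)"
    using grid_stair_eq[OF m h(1) v x y] xy close by linarith
  have ll: "\<bar>l x - l y\<bar> \<le> dist x y" using lipschitz_onD[OF l_lip, of x y] by (simp add: dist_real_def)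
  have ax: "\<bar>?a x\<bar> \<le> 1" using grid_stair_near[OF m h(1), of "v i" "x \<bullet> i"] h(2) by linarith
  have 1: "\<bar>(l x - l y) * ?a x\<bar> \<le> dist x y * 1"
    unfolding abs_mult by (rule mult_mono[OF ll ax]) auto
  have 2: "\<bar>l y * (?a x - ?a y)\<bar> \<le> 1 * dist x y"
    unfolding abs_mult using l[of y] xy eq by (intro mult_mono) auto
  have "grid_map m h v l x \<bullet> i - grid_map m h v l y \<bullet> i
      = (x \<bullet> i - y \<bullet> i) + ((l x - l y) * ?a x + l y * (?a x - ?a y))"
    using i by (simp add: grid_map_inner algebra_simps)
  then have "\<bar>grid_map m h v l x \<bullet> i - grid_map m h v l y \<bullet> i\<bar>
      \<le> \<bar>x \<bullet> i - y \<bullet> i\<bar> + (\<bar>(l x - l y) * ?a x\<bar> + \<bar>l y * (?a x - ?a y)\<bar>)"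
    by (simp only: order_trans[OF abs_triangle_ineq add_left_mono[OF abs_triangle_ineq]])
  also have "\<dots> \<le> dist x y + (dist x y * 1 + 1 * dist x y)"
    by (intro add_mono xy 1 2)
  also have "\<dots> \<le> 4 * dist x y" by simp
  finally show ?thesis .
qed

lemma grid_map_lipschitz: "(DIM('a) * (4 * real m))-lipschitz_on UNIV (grid_map m h v l)"
proof (rule lipschitz_onI)
  fix x y
  show "dist (grid_map m h v l x) (grid_map m h v l y) \<le> DIM('a) * (4 * real m) * dist x y"
    using norm_le_DIM[of "grid_map m h v l x - grid_map m h v l y" "4 * real m * dist x y"] grid_map_fast
    by (simp add: inner_diff_left dist_norm mult.assoc)
qed simp

text \<open>
  \<open>E\<close> is split according to the set \<open>B\<close> of coordinates in which the staircase is steep. The factor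
  \<open>m ^ card B\<close> by which the piece for \<open>B\<close> is stretched will be compensated by the fraction
  \<open>1 / m ^ card B\<close> of shifts for which a given point belongs to this piece.
\<close>

lemma hausdorff_grid_map_le:
  assumes d: "1 \<le> d" and v: "\<And>i. i \<in> Basis \<Longrightarrow> v i \<in> {0..<int m}"
  shows "hausdorff d (grid_map m h v l ` E) \<le>
    ennreal (3 ^ DIM('a) * (real DIM('a) * 4) ^ d) *
      (\<Sum>B\<in>Pow Basis. ennreal (real m ^ card B) * hausdorff d (E \<inter> {y. \<forall>i\<in>B. digit m h (y \<bullet> i) = v i}))"
proof -
  define EB where "EB = (\<lambda>B. {y\<in>E. {i\<in>Basis. digit m h (y \<bullet> i) = v i} = B})"
  have sub: "grid_map m h v l ` E \<subseteq> (\<Union>B\<in>Pow Basis. grid_map m h v l ` EB B)"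
  proof
    fix z assume "z \<in> grid_map m h v l ` E"
    then obtain y where y: "y \<in> E" "z = grid_map m h v l y" by blast
    then have "y \<in> EB {i\<in>Basis. digit m h (y \<bullet> i) = v i}" unfolding EB_def by simp
    moreover have "{i\<in>Basis. digit m h (y \<bullet> i) = v i} \<in> Pow Basis" by simp
    ultimately show "z \<in> (\<Union>B\<in>Pow Basis. grid_map m h v l ` EB B)" using y(2) by blast
  qed
  have "hausdorff d (grid_map m h v l ` E) \<le> (\<Sum>B\<in>Pow Basis. hausdorff d (grid_map m h v l ` EB B))"
    by (rule order_trans[OF hausdorff_mono[OF sub] hausdorff_finite_UN_le[OF finite_Pow_iff[THEN iffD2, OF finite_Basis]]])
  also have "\<dots> \<le> (\<Sum>B\<in>Pow Basis. ennreal (3 ^ DIM('a) * (real DIM('a) * 4) ^ d) *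
      (ennreal (real m ^ card B) * hausdorff d (E \<inter> {y. \<forall>i\<in>B. digit m h (y \<bullet> i) = v i})))"
  proof (rule sum_mono)
    fix B :: "'a set" assume "B \<in> Pow Basis"
    then have B: "B \<subseteq> Basis" by simp
    have 1: "hausdorff d (grid_map m h v l ` EB B) \<le> ennreal ((3 * real m) ^ card B * (real DIM('a) * 4) ^ d) * hausdorff d (EB B)"
    proof (rule hausdorff_anisotropic_image_le[OF d _ m B, where \<rho> = "h / m"])
      show "0 < h / m" using h m by simp
      show "\<bar>grid_map m h v l x \<bullet> i - grid_map m h v l y \<bullet> i\<bar> \<le> 4 * dist x y"
        if "x \<in> EB B" "y \<in> EB B" "dist x y \<le> h / m" "i \<in> Basis - B" for x y i
        using that v by (intro grid_map_slow) (auto simp: EB_def)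
      show "\<bar>grid_map m h v l x \<bullet> i - grid_map m h v l y \<bullet> i\<bar> \<le> 4 * real m * dist x y"
        if "i \<in> B" for x y i
        using grid_map_fast[of i x y] that B by blast
    qed simp
    have 2: "ennreal ((3 * real m) ^ card B * (real DIM('a) * 4) ^ d) * hausdorff d (EB B) \<le> ennreal ((3 ^ DIM('a) * real m ^ card B) * (real DIM('a) * 4) ^ d) *
        hausdorff d (E \<inter> {y. \<forall>i\<in>B. digit m h (y \<bullet> i) = v i})"
    proof (rule mult_mono)
      have "(3::real) ^ card B \<le> 3 ^ DIM('a)" using card_mono[OF finite_Basis B] by (intro power_increasing) auto
      then show "ennreal ((3 * real m) ^ card B * (real DIM('a) * 4) ^ d)
          \<le> ennreal ((3 ^ DIM('a) * real m ^ card B) * (real DIM('a) * 4) ^ d)"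
        unfolding power_mult_distrib[of 3] by (intro ennreal_leI mult_right_mono) auto
      show "hausdorff d (EB B) \<le> hausdorff d (E \<inter> {y. \<forall>i\<in>B. digit m h (y \<bullet> i) = v i})"
        by (rule hausdorff_mono) (auto simp: EB_def)
    qed auto
    have 3: "ennreal ((3 ^ DIM('a) * real m ^ card B) * (real DIM('a) * 4) ^ d)
        = ennreal (3 ^ DIM('a) * (real DIM('a) * 4) ^ d) * ennreal (real m ^ card B)"
    proof -
      have "(3 ^ DIM('a) * real m ^ card B) * (real DIM('a) * 4) ^ d = (3 ^ DIM('a) * (real DIM('a) * 4) ^ d) * real m ^ card B"
        by (simp only: ac_simps)
      moreover have "ennreal (3 ^ DIM('a) * (real DIM('a) * 4) ^ d * real m ^ card B)
          = ennreal (3 ^ DIM('a) * (real DIM('a) * 4) ^ d) * ennreal (real m ^ card B)"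
        by (rule ennreal_mult) simp_all
      ultimately show ?thesis by (simp only:)
    qed
    show "hausdorff d (grid_map m h v l ` EB B) \<le> ennreal (3 ^ DIM('a) * (real DIM('a) * 4) ^ d) *
      (ennreal (real m ^ card B) * hausdorff d (E \<inter> {y. \<forall>i\<in>B. digit m h (y \<bullet> i) = v i}))"
      using order_trans[OF 1 2] unfolding 3 by (simp only: mult.assoc)
  qed
  finally show ?thesis by (simp add: sum_distrib_left)
qed

end


section \<open>Choosing the position of the grid\<close>

definition shifts :: "nat \<Rightarrow> ('a::euclidean_space \<Rightarrow> int) set" where
  "shifts m = PiE Basis (\<lambda>_. {0..<int m})"

lemma finite_shifts: "finite (shifts m)"
  unfolding shifts_def by (rule finite_PiE) simp_all

lemma card_shifts: "card (shifts m :: ('a::euclidean_space \<Rightarrow> int) set) = m ^ DIM('a)"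
  by (simp add: shifts_def card_PiE)

lemma card_shifts_with_digits:
  fixes B :: "'a::euclidean_space set" and k :: real
  assumes B: "B \<subseteq> Basis" and D: "\<And>i. i \<in> B \<Longrightarrow> finite (D i)" "\<And>i. i \<in> B \<Longrightarrow> real (card (D i)) \<le> k"
  shows "real (card {v \<in> shifts m. \<forall>i\<in>B. v i \<in> D i}) \<le> k ^ card B * real m ^ (DIM('a) - card B)"
proof -
  let ?F = "\<lambda>i. if i \<in> B then D i \<inter> {0..<int m} else {0..<int m}"
  have finB: "finite B" by (rule finite_subset[OF B finite_Basis])
  have eq: "{v \<in> shifts m. \<forall>i\<in>B. v i \<in> D i} = PiE Basis ?F"
  proof (rule set_eqI)
    fix v :: "'a \<Rightarrow> int"
    have "(\<forall>i\<in>Basis. v i \<in> {0..<int m}) \<and> (\<forall>i\<in>B. v i \<in> D i) \<longleftrightarrow> (\<forall>i\<in>Basis. v i \<in> ?F i)"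
      using B by (auto split: if_splits)
    then show "v \<in> {v \<in> shifts m. \<forall>i\<in>B. v i \<in> D i} \<longleftrightarrow> v \<in> PiE Basis ?F"
      unfolding shifts_def PiE_iff mem_Collect_eq by blast
  qed
  have "real (card (PiE Basis ?F)) = (\<Prod>i\<in>Basis. real (card (?F i)))"
    using card_PiE[OF finite_Basis, of ?F] by simp
  also have "\<dots> = (\<Prod>i\<in>Basis - B. real (card (?F i))) * (\<Prod>i\<in>B. real (card (?F i)))"
    by (rule prod.subset_diff[OF B finite_Basis])
  also have "(\<Prod>i\<in>Basis - B. real (card (?F i))) = (\<Prod>i\<in>Basis - B. real m)"
    by (rule prod.cong) simp_all
  also have "\<dots> = real m ^ (DIM('a) - card B)"
    using card_Diff_subset[OF finB B] by simp
  also have "real m ^ (DIM('a) - card B) * (\<Prod>i\<in>B. real (card (?F i))) \<le> real m ^ (DIM('a) - card B) * (\<Prod>i\<in>B. k)"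
  proof (intro mult_left_mono prod_mono conjI)
    fix i assume i: "i \<in> B"
    have "card (D i \<inter> {0..<int m}) \<le> card (D i)" using D(1)[OF i] by (intro card_mono) auto
    then show "real (card (?F i)) \<le> k" using D(2)[OF i] i by simp
  qed simp_all
  finally show ?thesis using eq by (simp add: mult.commute)
qed

lemma sets_digits:
  fixes B :: "'a::euclidean_space set"
  assumes "finite B"
  shows "{y::'a. \<forall>i\<in>B. digit m h (y \<bullet> i) = w i} \<in> sets borel"
proof -
  have "{y \<in> space borel. \<forall>i\<in>B. digit m h (y \<bullet> i) = w i} \<in> sets borel"
  proof (rule sets.sets_Collect_finite_All[OF _ assms])
    fix i assume "i \<in> B"
    have m1: "(\<lambda>y::'a. \<lfloor>real m * (y \<bullet> i) / h\<rfloor>) \<in> measurable borel (count_space UNIV)"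
      by measurable
    have "(\<lambda>y::'a. digit m h (y \<bullet> i)) \<in> measurable borel (count_space UNIV)"
      unfolding digit_def
      by (rule measurable_compose[OF m1, where g="\<lambda>k. k mod int m"]) simp
    then show "{y \<in> space borel. digit m h (y \<bullet> i) = w i} \<in> sets borel"
      by measurable
  qed
  then show ?thesis by simp
qed

text \<open>
  Interchanging the sum over the shifts with the integral over \<open>E\<close>: a point of \<open>E\<close> is counted for
  those shifts whose coordinates in \<open>B\<close> are its digits.
\<close>

lemma sum_shifts_hausdorff_le:
  fixes E :: "'a::euclidean_space set"
  assumes B: "B \<subseteq> Basis"
  shows "(\<Sum>v\<in>shifts m. hausdorff d (E \<inter> {y. \<forall>i\<in>B. digit m h (y \<bullet> i) = v i}))
     \<le> ennreal (real m ^ (DIM('a) - card B)) * hausdorff d E"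
proof -
  have finB: "finite B" by (rule finite_subset[OF B finite_Basis])
  let ?M = "hausdorff_restrict d E"
  let ?S = "\<lambda>v. {y::'a. \<forall>i\<in>B. digit m h (y \<bullet> i) = v i}"
  have S: "?S v \<in> sets borel" for v by (rule sets_digits[OF finB])
  have "(\<Sum>v\<in>shifts m. hausdorff d (E \<inter> ?S v)) = (\<Sum>v\<in>shifts m. \<integral>\<^sup>+y. indicator (?S v) y \<partial>?M)"
    using S by (intro sum.cong) (auto simp: emeasure_hausdorff_restrict Int_commute)
  also have "\<dots> = (\<integral>\<^sup>+y. (\<Sum>v\<in>shifts m. indicator (?S v) y) \<partial>?M)"
    using S by (intro nn_integral_sum[symmetric]) simp
  also have "\<dots> \<le> (\<integral>\<^sup>+y. ennreal (real m ^ (DIM('a) - card B)) \<partial>?M)"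
  proof (rule nn_integral_mono)
    fix y :: 'a
    have "(\<Sum>v\<in>shifts m. indicator (?S v) y :: ennreal) = (\<Sum>v\<in>shifts m. if v \<in> {v. y \<in> ?S v} then 1 else 0)"
      by (rule sum.cong) (auto simp: indicator_def)
    also have "\<dots> = of_nat (card {v \<in> shifts m. y \<in> ?S v})"
      using finite_shifts by (subst sum.inter_restrict[symmetric]) (auto simp: Int_def)
    also have "\<dots> = ennreal (real (card {v \<in> shifts m. \<forall>i\<in>B. v i \<in> {digit m h (y \<bullet> i)}}))"
      by (simp add: ennreal_of_nat_eq_real_of_nat eq_commute)
    also have "\<dots> \<le> ennreal (1 ^ card B * real m ^ (DIM('a) - card B))"
      by (intro ennreal_leI card_shifts_with_digits[OF B]) simp_all
    finally show "(\<Sum>v\<in>shifts m. indicator (?S v) y) \<le> ennreal (real m ^ (DIM('a) - card B))" by simp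
  qed
  also have "\<dots> = ennreal (real m ^ (DIM('a) - card B)) * hausdorff d E"
    by (simp add: emeasure_hausdorff_restrict)
  finally show ?thesis .
qed

text \<open>
  Averaging over the shifts that remain after discarding fewer than half of them.
\<close>

lemma exists_good_shift:
  fixes E :: "'a::euclidean_space set"
  assumes V: "V \<subseteq> shifts m" "2 * card V < m ^ DIM('a)"
  shows "\<exists>v\<in>shifts m - V.
    (\<Sum>B\<in>Pow Basis. ennreal (real m ^ card B) * hausdorff d (E \<inter> {y. \<forall>i\<in>B. digit m h (y \<bullet> i) = v i}))
      \<le> ennreal (2 * 2 ^ DIM('a)) * hausdorff d E"
proof -
  define q where "q = (\<lambda>v. \<Sum>B\<in>Pow Basis. ennreal (real m ^ card B) *
      hausdorff d (E \<inter> {y. \<forall>i\<in>B. digit m h (y \<bullet> i) = v i}))"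
  let ?G = "shifts m - V :: ('a \<Rightarrow> int) set"
  have finG: "finite ?G" using finite_shifts by blast
  have cG: "card ?G = m ^ DIM('a) - card V"
    using card_Diff_subset[OF finite_subset[OF V(1) finite_shifts] V(1)] card_shifts by metis
  then have cG2: "m ^ DIM('a) \<le> 2 * card ?G" and cpos: "0 < card ?G" using V(2) by linarith+
  have "Min (q ` ?G) \<in> q ` ?G" using finG cpos by (intro Min_in) (auto simp: card_gt_0_iff)
  then obtain v where v: "v \<in> ?G" "q v = Min (q ` ?G)" by force
  have vmin: "q v \<le> q w" if "w \<in> ?G" for w using v(2) finG that by simp
  have "of_nat (card ?G) * q v \<le> (\<Sum>w\<in>?G. q w)"
    using sum_mono[of ?G "\<lambda>_. q v" q] vmin by simp
  also have "\<dots> \<le> (\<Sum>w\<in>shifts m. q w)"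
    using finite_shifts by (intro sum_mono2) auto
  also have "\<dots> = (\<Sum>B\<in>Pow Basis. \<Sum>w\<in>shifts m. ennreal (real m ^ card B) *
      hausdorff d (E \<inter> {y. \<forall>i\<in>B. digit m h (y \<bullet> i) = w i}))"
    unfolding q_def by (rule sum.swap)
  also have "\<dots> \<le> (\<Sum>B\<in>Pow (Basis :: 'a set). ennreal (real m ^ DIM('a)) * hausdorff d E)"
  proof (rule sum_mono)
    fix B :: "'a set" assume "B \<in> Pow Basis"
    then have B: "B \<subseteq> Basis" by simp
    have le: "card B \<le> DIM('a)" using card_mono[OF finite_Basis B] .
    have "(\<Sum>w\<in>shifts m. ennreal (real m ^ card B) * hausdorff d (E \<inter> {y. \<forall>i\<in>B. digit m h (y \<bullet> i) = w i}))
        \<le> ennreal (real m ^ card B) * (ennreal (real m ^ (DIM('a) - card B)) * hausdorff d E)"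
      unfolding sum_distrib_left[symmetric] by (intro mult_left_mono sum_shifts_hausdorff_le B) simp
    also have "\<dots> = ennreal (real m ^ card B * real m ^ (DIM('a) - card B)) * hausdorff d E"
      by (subst ennreal_mult) (simp_all add: mult.assoc)
    also have "real m ^ card B * real m ^ (DIM('a) - card B) = real m ^ DIM('a)"
      using le by (simp add: power_add[symmetric])
    finally show "(\<Sum>w\<in>shifts m. ennreal (real m ^ card B) * hausdorff d (E \<inter> {y. \<forall>i\<in>B. digit m h (y \<bullet> i) = w i}))
        \<le> ennreal (real m ^ DIM('a)) * hausdorff d E" .
  qed
  also have "\<dots> = ennreal (2 ^ DIM('a)) * (ennreal (real m ^ DIM('a)) * hausdorff d E)"
    by (simp add: card_Pow ennreal_of_nat_eq_real_of_nat)
  also have "\<dots> \<le> ennreal (2 ^ DIM('a)) * (ennreal (2 * real (card ?G)) * hausdorff d E)"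
  proof (intro mult_left_mono mult_right_mono ennreal_leI)
    show "real m ^ DIM('a) \<le> 2 * real (card ?G)" using of_nat_mono[OF cG2, where 'a=real] by simp
  qed simp_all
  also have "\<dots> = of_nat (card ?G) * (ennreal (2 * 2 ^ DIM('a)) * hausdorff d E)"
    by (simp add: ennreal_of_nat_eq_real_of_nat ennreal_mult ac_simps)
  finally have "of_nat (card ?G) * q v \<le> of_nat (card ?G) * (ennreal (2 * 2 ^ DIM('a)) * hausdorff d E)" .
  then have "q v \<le> ennreal (2 * 2 ^ DIM('a)) * hausdorff d E"
    using cpos by (simp add: ennreal_mult_le_mult_iff)
  with v(1) show ?thesis unfolding q_def by blast
qed

lemma exists_slightly_larger_power:
  fixes a e :: real
  assumes "0 < e" shows "\<exists>s>a. s ^ d < a ^ d + e"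
proof -
  have "((\<lambda>s. s ^ d) \<longlongrightarrow> a ^ d) (at_right a)" by (intro tendsto_intros)
  then have "eventually (\<lambda>s. s ^ d < a ^ d + e) (at_right a)"
    by (rule order_tendstoD) (use assms in simp)
  then obtain b where "b > a" "\<And>s. a < s \<Longrightarrow> s < b \<Longrightarrow> s ^ d < a ^ d + e"
    unfolding eventually_at_right_field by blast
  then show ?thesis using dense[of a b] by blast
qed

text \<open>
  The sizes \<open>s l\<close> are positive even for covering sets that are points; later the mesh of the digits has
  to be finer than all of them.
\<close>

lemma null_compact_open_cover:
  fixes N :: "'a::euclidean_space set"
  assumes N: "compact N" "hausdorff d N = 0" and c: "0 < c"
  obtains F :: "nat set" and U :: "nat \<Rightarrow> 'a set" and s :: "nat \<Rightarrow> real"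
  where "finite F" "N \<subseteq> (\<Union>l\<in>F. U l)" "\<And>l. open (U l)" "\<And>l. 0 < s l"
    "\<And>l x y. x \<in> U l \<Longrightarrow> y \<in> U l \<Longrightarrow> dist x y \<le> s l" "(\<Sum>l\<in>F. s l ^ d) \<le> c"
proof -
  define w where "w = unit_ball_vol (real d) / 2 ^ d"
  have w: "0 < w" by (simp add: w_def)
  have "hausdorff_premeasure d 1 N \<le> 0"
    using hausdorff_premeasure_le_hausdorff[of 1 d N] N(2) by simp
  then have "hausdorff_premeasure d 1 N < ennreal (w * (c / 2))"
    using w c by (simp add: order_le_less_trans)
  then obtain A where A: "N \<subseteq> (\<Union>i::nat. A i)" "\<And>i. bounded (A i)"
      "(\<Sum>i. cover_weight d (A i)) < ennreal (w * (c / 2))"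
    by (rule hausdorff_premeasure_cover) (rule that)
  have "\<forall>l. \<exists>s>diameter (A l). s ^ d < diameter (A l) ^ d + c / 2 * (1/2) ^ Suc l"
    using c by (intro allI exists_slightly_larger_power) simp
  then obtain s where s: "\<And>l. diameter (A l) < s l" "\<And>l. s l ^ d < diameter (A l) ^ d + c / 2 * (1/2) ^ Suc l"
    by metis
  define U where "U = (\<lambda>l. \<Union>a\<in>A l. ball a ((s l - diameter (A l)) / 2))"
  have AU: "A l \<subseteq> U l" for l using s(1)[of l] by (auto simp: U_def)
  have oU: "open (U l)" for l by (auto simp: U_def)
  have "N \<subseteq> (\<Union>l\<in>{l. A l \<noteq> {}}. U l)" using A(1) AU by blast
  then obtain F where F: "F \<subseteq> {l. A l \<noteq> {}}" "finite F" "N \<subseteq> (\<Union>l\<in>F. U l)"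
    using compactE_image[OF N(1), of "{l. A l \<noteq> {}}" U] oU by metis
  have dU: "dist x y \<le> s l" if xy: "x \<in> U l" "y \<in> U l" for l x y
  proof -
    obtain a b where ab: "a \<in> A l" "b \<in> A l" "dist a x < (s l - diameter (A l)) / 2" "dist b y < (s l - diameter (A l)) / 2"
      using xy by (auto simp: U_def)
    have "dist a b \<le> diameter (A l)" using ab A(2) by (intro diameter_bounded_bound)
    moreover have "dist x y \<le> dist a x + dist a b + dist b y"
      using dist_triangle[of x y a] dist_triangle[of a y b] by (simp add: dist_commute)
    ultimately show ?thesis using ab by argo
  qed
  have s0: "0 < s l" for l using s(1)[of l] diameter_ge_0[OF A(2), of l] by linarith
  have "(\<Sum>l\<in>F. ennreal (w * diameter (A l) ^ d)) = (\<Sum>l\<in>F. cover_weight d (A l))"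
    using F(1) by (intro sum.cong) (auto simp: cover_weight_def w_def power_divide)
  also have "\<dots> \<le> (\<Sum>i. cover_weight d (A i))"
    by (rule sum_le_suminf) (use F(2) in auto)
  also have "\<dots> \<le> ennreal (w * (c / 2))" using A(3) by simp
  finally have "ennreal (\<Sum>l\<in>F. w * diameter (A l) ^ d) \<le> ennreal (w * (c / 2))"
    using w diameter_ge_0[OF A(2)] by (subst sum_ennreal[symmetric]) auto
  then have "(\<Sum>l\<in>F. w * diameter (A l) ^ d) \<le> w * (c / 2)"
    using w c by (subst (asm) ennreal_le_iff) auto
  then have d1: "(\<Sum>l\<in>F. diameter (A l) ^ d) \<le> c / 2"
    using w by (simp add: sum_distrib_left[symmetric])
  have "(\<lambda>l. c / 2 * (1/2) ^ Suc l) sums (c / 2 * 1)" by (intro sums_mult power_half_series)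
  then have "(\<Sum>l\<in>F. c / 2 * (1/2) ^ Suc l) \<le> c / 2"
    using sum_le_suminf[of "\<lambda>l. c / 2 * (1/2) ^ Suc l" F] F(2) c by (simp add: sums_iff)
  then have "(\<Sum>l\<in>F. diameter (A l) ^ d + c / 2 * (1/2) ^ Suc l) \<le> c"
    using d1 by (simp add: sum.distrib)
  moreover have "(\<Sum>l\<in>F. s l ^ d) \<le> (\<Sum>l\<in>F. diameter (A l) ^ d + c / 2 * (1/2) ^ Suc l)"
    using s(2) by (intro sum_mono less_imp_le)
  ultimately have "(\<Sum>l\<in>F. s l ^ d) \<le> c" by linarith
  with that[of F U s] F(2,3) oU s0 dU show thesis by blast
qed

text \<open>
  A set of diameter \<open>s\<close> on the line meets about \<open>m * s / h\<close> of the \<open>m\<close> digits.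
\<close>

lemma digits_of_small_set:
  assumes m: "1 \<le> m" and h: "0 < h" and s: "h / m \<le> s" and T: "\<And>t t'. t \<in> T \<Longrightarrow> t' \<in> T \<Longrightarrow> \<bar>t - t'\<bar> \<le> s"
  shows "finite (digit m h ` T)" "real (card (digit m h ` T)) \<le> 4 * (real m * s / h)"
proof -
  have "finite (digit m h ` T) \<and> real (card (digit m h ` T)) \<le> 4 * (real m * s / h)"
  proof (cases "T = {}")
    case True
    have "0 \<le> s" using s h by (meson divide_nonneg_nonneg less_imp_le of_nat_0_le_iff order_trans)
    then show ?thesis using True h by simp
  next
    case False
    then obtain t0 where t0: "t0 \<in> T" by blast
    define u where "u = real m * t0 / h"
    define x where "x = real m * s / h"
    have x1: "1 \<le> x" using s m h by (simp add: x_def field_simps)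
    have sub: "digit m h ` T \<subseteq> (\<lambda>k. k mod int m) ` {\<lfloor>u - x\<rfloor>..\<lfloor>u + x\<rfloor>}"
    proof
      fix a assume "a \<in> digit m h ` T"
      then obtain t where t: "t \<in> T" "a = \<lfloor>real m * t / h\<rfloor> mod int m" by (auto simp: digit_def)
      have "\<bar>t - t0\<bar> \<le> s" using T t(1) t0 by blast
      then have "real m * \<bar>t - t0\<bar> / h \<le> x"
        unfolding x_def using h by (intro divide_right_mono mult_left_mono) auto
      moreover have "\<bar>real m * t / h - u\<bar> = real m * \<bar>t - t0\<bar> / h"
        unfolding u_def using h
        by (simp add: diff_divide_distrib[symmetric] right_diff_distrib[symmetric] abs_mult)
      ultimately have "\<bar>real m * t / h - u\<bar> \<le> x" by simp
      then have "u - x \<le> real m * t / h" "real m * t / h \<le> u + x" by (simp_all add: abs_le_iff)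
      then have "\<lfloor>real m * t / h\<rfloor> \<in> {\<lfloor>u - x\<rfloor>..\<lfloor>u + x\<rfloor>}" using floor_mono by auto
      then show "a \<in> (\<lambda>k. k mod int m) ` {\<lfloor>u - x\<rfloor>..\<lfloor>u + x\<rfloor>}" using t(2) by blast
    qed
    have "card (digit m h ` T) \<le> card {\<lfloor>u - x\<rfloor>..\<lfloor>u + x\<rfloor>}"
      using card_mono[OF _ sub] card_image_le[of "{\<lfloor>u - x\<rfloor>..\<lfloor>u + x\<rfloor>}" "\<lambda>k. k mod int m"] by force
    also have "real (card {\<lfloor>u - x\<rfloor>..\<lfloor>u + x\<rfloor>}) \<le> 4 * x" using x1 by simp linarith
    finally show ?thesis using finite_subset[OF sub] by (simp add: x_def)
  qed
  then show "finite (digit m h ` T)" "real (card (digit m h ` T)) \<le> 4 * (real m * s / h)" by auto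
qed

text \<open>
  For most positions of the grid, no point near the null set \<open>N\<close> is steep in \<open>d\<close> coordinates at once.
  A covering set of size \<open>s\<close> makes a fraction of order \<open>s ^ d\<close> of the shifts bad, and the
  sum of these fractions is small because \<open>N\<close> is null. In other words, a generic grid has a dual
  \<open>(n - d)\<close>-skeleton that keeps a distance from \<open>N\<close>.
\<close>

lemma few_shifts_meet_null_compact:
  fixes N :: "'a::euclidean_space set"
  assumes N: "compact N" "hausdorff d N = 0" and h: "0 < h"
  obtains m :: nat and U :: "'a set" and V :: "('a \<Rightarrow> int) set"
  where "1 \<le> m" "open U" "N \<subseteq> U" "V \<subseteq> shifts m" "2 * card V < m ^ DIM('a)"
    "\<And>v y. v \<in> shifts m - V \<Longrightarrow> y \<in> U \<Longrightarrow> card {i\<in>Basis. digit m h (y \<bullet> i) = v i} < d"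
proof -
  \<comment> \<open>Each cover element spoils a fraction \<open>(4 * s l / h) ^ d\<close> of the shifts for each of at most
    \<open>2 ^ DIM('a)\<close> sets of coordinates; this \<open>c\<close> keeps the total below a quarter.\<close>
  define c where "c = (h / 4) ^ d / (4 * 2 ^ DIM('a))"
  have c: "0 < c" using h by (simp add: c_def)
  obtain F :: "nat set" and U :: "nat \<Rightarrow> 'a set" and s :: "nat \<Rightarrow> real"
    where F: "finite F" "N \<subseteq> (\<Union>l\<in>F. U l)" "\<And>l. open (U l)" "\<And>l. 0 < s l"
    "\<And>l x y. x \<in> U l \<Longrightarrow> y \<in> U l \<Longrightarrow> dist x y \<le> s l" "(\<Sum>l\<in>F. s l ^ d) \<le> c"
    using null_compact_open_cover[OF N c] by metis
  obtain m :: nat where m: "1 + (\<Sum>l\<in>F. h / s l) < m" using reals_Archimedean2 by blast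
  have s_sum: "0 \<le> (\<Sum>l\<in>F. h / s l)" using h F(4) by (intro sum_nonneg) (simp add: less_imp_le)
  have m1: "1 \<le> m" using m s_sum by linarith
  have ms: "h / m \<le> s l" if "l \<in> F" for l
  proof -
    have "h / s l \<le> (\<Sum>l\<in>F. h / s l)"
      using h F(4) that F(1) by (intro member_le_sum) (auto simp: less_imp_le)
    then have "h / s l \<le> m" using m by linarith
    then show ?thesis using F(4)[of l] m1 by (simp add: field_simps)
  qed
  define J where "J = {B. B \<subseteq> (Basis :: 'a set) \<and> card B = d}"
  have finJ: "finite J" and cJ: "card J \<le> 2 ^ DIM('a)"
  proof -
    have sub: "J \<subseteq> Pow Basis" by (auto simp: J_def)
    show "finite J" by (rule finite_subset[OF sub]) simp
    have "card J \<le> card (Pow (Basis :: 'a set))" by (rule card_mono[OF _ sub]) simp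
    then show "card J \<le> 2 ^ DIM('a)" by (simp add: card_Pow)
  qed
  define W where "W = (\<lambda>l B. {v \<in> shifts m. \<forall>i\<in>B. v i \<in> digit m h ` (\<lambda>y. y \<bullet> i) ` U l})"
  define V where "V = (\<Union>l\<in>F. \<Union>B\<in>J. W l B)"
  have cW: "real (card (W l B)) \<le> (4 / h) ^ d * s l ^ d * real m ^ DIM('a)" if l: "l \<in> F" and B: "B \<in> J" for l B
  proof -
    have B': "B \<subseteq> Basis" "card B = d" using B by (auto simp: J_def)
    have le: "d \<le> DIM('a)" using card_mono[OF finite_Basis B'(1)] B'(2) by simp
    have small: "\<bar>t - t'\<bar> \<le> s l" if iB: "i \<in> B" and tt: "t \<in> (\<lambda>y. y \<bullet> i) ` U l" "t' \<in> (\<lambda>y. y \<bullet> i) ` U l" for i t t'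
    proof -
      obtain y y' where y: "y \<in> U l" "y' \<in> U l" "t = y \<bullet> i" "t' = y' \<bullet> i" using tt by (elim imageE)
      have "\<bar>(y - y') \<bullet> i\<bar> \<le> norm (y - y')" using iB B'(1) by (intro Basis_le_norm) auto
      then show ?thesis using F(5)[OF y(1,2)] y by (simp add: inner_diff_left dist_norm)
    qed
    have "real (card (W l B)) \<le> (4 * (real m * s l / h)) ^ card B * real m ^ (DIM('a) - card B)"
      unfolding W_def
      using digits_of_small_set[OF m1 h ms[OF l] small] by (intro card_shifts_with_digits[OF B'(1)])
    also have "\<dots> = (4 / h) ^ d * s l ^ d * (real m ^ d * real m ^ (DIM('a) - d))"
    proof -
      have "4 * (real m * s l / h) = (4 / h) * s l * real m" by simp
      then show ?thesis unfolding B'(2) by (simp only: power_mult_distrib mult.assoc)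
    qed
    also have "real m ^ d * real m ^ (DIM('a) - d) = real m ^ DIM('a)"
      using le by (simp add: power_add[symmetric])
    finally show ?thesis .
  qed
  have "card V \<le> (\<Sum>l\<in>F. \<Sum>B\<in>J. card (W l B))"
    unfolding V_def using F(1) finJ
    by (intro order_trans[OF card_UN_le] sum_mono card_UN_le)
  then have "real (card V) \<le> real (\<Sum>l\<in>F. \<Sum>B\<in>J. card (W l B))" by (rule of_nat_mono)
  also have "\<dots> = (\<Sum>l\<in>F. \<Sum>B\<in>J. real (card (W l B)))" by simp
  also have "\<dots> \<le> (\<Sum>l\<in>F. \<Sum>B\<in>J. (4 / h) ^ d * s l ^ d * real m ^ DIM('a))"
    by (intro sum_mono cW)
  also have "\<dots> = real (card J) * ((4 / h) ^ d * real m ^ DIM('a) * (\<Sum>l\<in>F. s l ^ d))"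
    by (simp add: sum_distrib_left sum_distrib_right ac_simps)
  also have "\<dots> \<le> 2 ^ DIM('a) * ((4 / h) ^ d * real m ^ DIM('a) * c)"
  proof (rule mult_mono)
    show "real (card J) \<le> 2 ^ DIM('a)" using of_nat_mono[OF cJ, where 'a=real] by simp
    have "0 \<le> (\<Sum>l\<in>F. s l ^ d)"
      using F(4) by (intro sum_nonneg) (simp add: less_imp_le)
    then show "0 \<le> (4 / h) ^ d * real m ^ DIM('a) * (\<Sum>l\<in>F. s l ^ d)" using h by simp
    show "(4 / h) ^ d * real m ^ DIM('a) * (\<Sum>l\<in>F. s l ^ d) \<le> (4 / h) ^ d * real m ^ DIM('a) * c"
      using h by (intro mult_left_mono F(6)) simp
  qed simp
  also have "\<dots> = real m ^ DIM('a) / 4"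
  proof -
    have "(4 / h) ^ d * (h / 4) ^ d = 1" using h by (simp add: power_mult_distrib[symmetric])
    then have "(4 / h) ^ d * c = 1 / (4 * 2 ^ DIM('a))" by (simp add: c_def)
    moreover have "2 ^ DIM('a) * ((4 / h) ^ d * real m ^ DIM('a) * c) = 2 ^ DIM('a) * real m ^ DIM('a) * ((4 / h) ^ d * c)"
      by (simp only: ac_simps)
    ultimately have "2 ^ DIM('a) * ((4 / h) ^ d * real m ^ DIM('a) * c) = 2 ^ DIM('a) * real m ^ DIM('a) * (1 / (4 * 2 ^ DIM('a)))"
      by (simp only:)
    then show ?thesis by simp
  qed
  finally have "real (card V) \<le> real m ^ DIM('a) / 4" .
  moreover have "0 < real m ^ DIM('a)" using m1 by simp
  ultimately have "real (2 * card V) < real (m ^ DIM('a))" unfolding of_nat_mult of_nat_power of_nat_numeral by argo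
  then have cV: "2 * card V < m ^ DIM('a)" by (rule of_nat_less_imp_less)
  show thesis
  proof (rule that[OF m1 _ F(2) _ cV])
    show "open (\<Union>l\<in>F. U l)" using F(3) by blast
    show "V \<subseteq> shifts m" by (auto simp: V_def W_def)
    fix v y assume v: "v \<in> shifts m - V" and y: "y \<in> (\<Union>l\<in>F. U l)"
    obtain l where l: "l \<in> F" "y \<in> U l" using y by blast
    show "card {i\<in>Basis. digit m h (y \<bullet> i) = v i} < d"
    proof (rule ccontr)
      assume "\<not> ?thesis"
      then obtain B where B: "B \<subseteq> {i\<in>Basis. digit m h (y \<bullet> i) = v i}" "card B = d"
        by (meson not_less obtain_subset_with_card_n)
      then have "B \<in> J" by (auto simp: J_def)
      moreover have "v \<in> W l B"
        unfolding W_def using v l B(1) by (auto intro!: image_eqI)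
      ultimately have "v \<in> V" using l(1) by (auto simp: V_def)
      then show False using v by blast
    qed
  qed
qed


lemma hausdorff_null_countable_UN:
  assumes "countable I" "\<And>i. i \<in> I \<Longrightarrow> hausdorff d (E i) = 0"
  shows "hausdorff d (\<Union>i\<in>I. E i) = 0"
proof (cases "I = {}")
  case False
  then have "(\<Union>i\<in>I. E i) = (\<Union>n. E (from_nat_into I n))"
    using range_from_nat_into[OF False assms(1)] by (metis image_image)
  moreover have "hausdorff d (\<Union>n. E (from_nat_into I n)) = 0"
    using False by (intro hausdorff_null_UN assms(2) from_nat_into)
  ultimately show ?thesis by simp
qed simp

text \<open>
  Points with fewer than \<open>d\<close> coordinates off the grid lie in countably many coordinate planes of
  dimension below \<open>d\<close>.
\<close>

lemma hausdorff_grid_skeleton: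
  fixes v :: "'a::euclidean_space \<Rightarrow> int" and h :: real
  shows "hausdorff d {z. \<exists>J\<subseteq>Basis. card J < d \<and> (\<forall>i\<in>Basis - J. \<exists>k::int. z \<bullet> i = h * (k + v i / m))} = 0"
proof -
  define Cs where "Cs = (\<lambda>k::'a \<Rightarrow> int. \<Sum>i\<in>Basis. (h * (k i + v i / m)) *\<^sub>R i) ` PiE Basis (\<lambda>_. UNIV)"
  have cC: "countable Cs" unfolding Cs_def by (intro countable_image countable_PiE) auto
  define I where "I = {J. J \<subseteq> (Basis::'a set) \<and> card J < d} \<times> Cs \<times> (UNIV :: nat set)"
  have "finite {J. J \<subseteq> (Basis::'a set) \<and> card J < d}"
    by (rule finite_subset[of _ "Pow Basis"]) auto
  then have "countable {J. J \<subseteq> (Basis::'a set) \<and> card J < d}" by (rule countable_finite)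
  then have cI: "countable I" unfolding I_def by (intro countable_SIGMA cC) simp_all
  define X where "X = (\<lambda>(J, c::'a, r::nat). {z. (\<forall>i\<in>Basis - J. z \<bullet> i = c \<bullet> i) \<and> (\<forall>i\<in>J. \<bar>z \<bullet> i\<bar> \<le> real r)})"
  have "hausdorff d (\<Union>p\<in>I. X p) = 0"
  proof (rule hausdorff_null_countable_UN[OF cI])
    fix p assume "p \<in> I"
    then obtain J c r where p: "p = (J, c, r)" "J \<subseteq> Basis" "card J < d" by (auto simp: I_def)
    show "hausdorff d (X p) = 0"
      by (rule hausdorff_box_null[OF p(2,3), where c = c and r = r]) (auto simp: X_def p(1))
  qed
  moreover have "{z. \<exists>J\<subseteq>Basis. card J < d \<and> (\<forall>i\<in>Basis - J. \<exists>k::int. z \<bullet> i = h * (k + v i / m))} \<subseteq> (\<Union>p\<in>I. X p)"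
  proof
    fix z :: 'a assume "z \<in> {z. \<exists>J\<subseteq>Basis. card J < d \<and> (\<forall>i\<in>Basis - J. \<exists>k::int. z \<bullet> i = h * (k + v i / m))}"
    then obtain J where J: "J \<subseteq> Basis" "card J < d" "\<forall>i\<in>Basis - J. \<exists>k::int. z \<bullet> i = h * (k + v i / m)" by blast
    then obtain k :: "'a \<Rightarrow> int" where k: "\<And>i. i \<in> Basis - J \<Longrightarrow> z \<bullet> i = h * (k i + v i / m)" by metis
    define c where "c = (\<Sum>i\<in>Basis. (h * (restrict k Basis i + v i / m)) *\<^sub>R i)"
    have cCs: "c \<in> Cs" unfolding Cs_def c_def by (rule image_eqI[where x = "restrict k Basis"]) simp_all
    have ci: "c \<bullet> i = h * (k i + v i / m)" if "i \<in> Basis" for i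
      using that by (simp add: c_def inner_sum_left_Basis)
    obtain r :: nat where r: "norm z \<le> r" using real_arch_simple by blast
    have "\<bar>z \<bullet> i\<bar> \<le> real r" if "i \<in> J" for i using Basis_le_norm[of i z] that J(1) r by (meson order_trans subsetD)
    then have "z \<in> X (J, c, r)" using k ci by (simp add: X_def)
    moreover have "(J, c, r) \<in> I" using J cCs by (simp add: I_def)
    ultimately show "z \<in> (\<Union>p\<in>I. X p)" by blast
  qed
  ultimately show ?thesis by (rule hausdorff_null_subset)
qed

text \<open>
  A deformation in the manner of Federer and Fleming. The shift is chosen to be good for \<open>N\<close> and, among
  these, to satisfy the area bound for \<open>E\<close>. The constant in the area bound depends on the dimensions only,
  although the Lipschitz constant of \<open>F\<close>, which is of order \<open>m\<close>, is not controlled: it depends on how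
  finely \<open>N\<close> has to be covered.
\<close>

lemma grid_deformation:
  fixes N E :: "'a::euclidean_space set" and h :: real and l :: "'a \<Rightarrow> real"
  assumes d: "1 \<le> d" and N: "compact N" "hausdorff d N = 0" and h: "0 < h" "h \<le> 1"
    and l: "\<And>y. 0 \<le> l y" "\<And>y. l y \<le> 1" and l_lip: "1-lipschitz_on UNIV l"
  obtains F :: "'a \<Rightarrow> 'a" and \<kappa> L
  where "0 < \<kappa>" "L-lipschitz_on UNIV F" "\<And>y. l y = 0 \<Longrightarrow> F y = y"
    "\<And>y. norm (F y - y) \<le> DIM('a) * h"
    "hausdorff d (F ` {y. l y = 1 \<and> (\<exists>z\<in>N. dist z y < \<kappa>)}) = 0"
    "hausdorff d (F ` E) \<le> ennreal (3 ^ DIM('a) * (real DIM('a) * 4) ^ d * (2 * 2 ^ DIM('a))) * hausdorff d E"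
proof -
  obtain m :: nat and U :: "'a set" and V :: "('a \<Rightarrow> int) set"
    where m: "1 \<le> m" and U: "open U" "N \<subseteq> U" and V: "V \<subseteq> shifts m" "2 * card V < m ^ DIM('a)"
    "\<And>v y. v \<in> shifts m - V \<Longrightarrow> y \<in> U \<Longrightarrow> card {i\<in>Basis. digit m h (y \<bullet> i) = v i} < d"
    by (rule few_shifts_meet_null_compact[OF N h(1)]) (rule that)
  obtain v where v: "v \<in> shifts m - V"
    and Q: "(\<Sum>B\<in>Pow Basis. ennreal (real m ^ card B) * hausdorff d (E \<inter> {y. \<forall>i\<in>B. digit m h (y \<bullet> i) = v i}))
      \<le> ennreal (2 * 2 ^ DIM('a)) * hausdorff d E"
    using exists_good_shift[OF V(1,2)] by blast
  have vi: "v i \<in> {0..<int m}" if "i \<in> Basis" for i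
    using v that unfolding shifts_def by (blast dest: PiE_mem)
  obtain \<kappa> where \<kappa>: "0 < \<kappa>" "(\<Union>x\<in>N. ball x \<kappa>) \<subseteq> U"
    using compact_subset_open_imp_ball_epsilon_subset[OF N(1) U] by blast
  let ?F = "grid_map m h v l"
  have "?F ` {y. l y = 1 \<and> (\<exists>z\<in>N. dist z y < \<kappa>)}
      \<subseteq> {z. \<exists>J\<subseteq>Basis. card J < d \<and> (\<forall>i\<in>Basis - J. \<exists>k::int. z \<bullet> i = h * (k + v i / m))}"
  proof clarify
    fix y z assume y: "l y = 1" "z \<in> N" "dist z y < \<kappa>"
    have "y \<in> ball z \<kappa>" using y(3) by simp
    then have yU: "y \<in> U" using \<kappa>(2) y(2) by blast
    let ?J = "{i\<in>Basis. digit m h (y \<bullet> i) = v i}"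
    have "\<exists>k::int. ?F y \<bullet> i = h * (k + v i / m)" if i: "i \<in> Basis - ?J" for i
    proof -
      have "?F y \<bullet> i = grid_stair m h (v i) (y \<bullet> i)" using i y(1) by (simp add: grid_map_inner)
      moreover have iB: "i \<in> Basis" and ne: "digit m h (y \<bullet> i) \<noteq> v i" using i by blast+
      ultimately have "?F y \<bullet> i = h * (of_int (\<lfloor>y \<bullet> i / h - v i / m\<rfloor> + 1) + v i / m)"
        using grid_stair_flat[OF m vi[OF iB] ne] by simp
      then show ?thesis by (rule exI)
    qed
    then show "\<exists>J\<subseteq>Basis. card J < d \<and> (\<forall>i\<in>Basis - J. \<exists>k::int. ?F y \<bullet> i = h * (k + v i / m))"
      using V(3)[OF v yU] by (intro exI[of _ ?J] conjI ballI) simp_all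
  qed
  then have null: "hausdorff d (?F ` {y. l y = 1 \<and> (\<exists>z\<in>N. dist z y < \<kappa>)}) = 0"
    by (rule hausdorff_null_subset[OF hausdorff_grid_skeleton])
  have "hausdorff d (?F ` E) \<le> ennreal (3 ^ DIM('a) * (real DIM('a) * 4) ^ d) * (ennreal (2 * 2 ^ DIM('a)) * hausdorff d E)"
    by (rule order_trans[OF hausdorff_grid_map_le[OF m h l l_lip d vi] mult_left_mono[OF Q]]) simp_all
  also have "\<dots> = ennreal (3 ^ DIM('a) * (real DIM('a) * 4) ^ d * (2 * 2 ^ DIM('a))) * hausdorff d E"
    by (subst ennreal_mult[of "3 ^ DIM('a) * (real DIM('a) * 4) ^ d"]) (simp_all add: mult.assoc)
  finally have area: "hausdorff d (?F ` E) \<le> \<dots>" .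
  have near: "norm (?F y - y) \<le> DIM('a) * h" for y
    by (rule grid_map_near) (use m h l in simp_all)
  show thesis
    by (rule that[OF \<kappa>(1) grid_map_lipschitz[OF m h l l_lip] grid_map_id near null area])
qed


section \<open>Lipschitz maps and sliding maps\<close>

definition clamp01 :: "real \<Rightarrow> real" where
  "clamp01 s = max 0 (min 1 s)"

lemma clamp01_range: "0 \<le> clamp01 s" "clamp01 s \<le> 1"
  by (auto simp: clamp01_def)

lemma clamp01_eq_0: "s \<le> 0 \<Longrightarrow> clamp01 s = 0"
  by (simp add: clamp01_def)

lemma clamp01_eq_1: "1 \<le> s \<Longrightarrow> clamp01 s = 1"
  by (simp add: clamp01_def)

lemma clamp01_diff_le: "\<bar>clamp01 s - clamp01 t\<bar> \<le> \<bar>s - t\<bar>"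
  by (simp add: clamp01_def max_def min_def)

lemma clamp01_lipschitz:
  assumes "L-lipschitz_on X f" shows "L-lipschitz_on X (\<lambda>x. clamp01 (f x))"
proof (rule lipschitz_onI)
  show "dist (clamp01 (f x)) (clamp01 (f y)) \<le> L * dist x y" if "x \<in> X" "y \<in> X" for x y
    using clamp01_diff_le[of "f x" "f y"] lipschitz_onD[OF assms that] by (simp add: dist_real_def)
qed (rule lipschitz_on_nonneg[OF assms])

lemma norm_lipschitz: "1-lipschitz_on X (norm :: 'a::real_normed_vector \<Rightarrow> real)"
  by (rule lipschitz_onI) (simp_all add: dist_real_def norm_triangle_ineq3 dist_norm)

lemma infdist_lipschitz: "1-lipschitz_on X (\<lambda>x. infdist x A)"
  by (rule lipschitz_onI) (simp_all add: dist_real_def infdist_triangle_abs)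

lemma lipschitz_on_scaleR_bounded:
  fixes g :: "'a::metric_space \<Rightarrow> 'b::real_normed_vector"
  assumes f: "Lf-lipschitz_on X f" and g: "Lg-lipschitz_on X g"
    and bf: "\<And>x. x \<in> X \<Longrightarrow> \<bar>f x\<bar> \<le> Bf" and bg: "\<And>x. x \<in> X \<Longrightarrow> norm (g x) \<le> Bg"
    and B: "0 \<le> Bf" "0 \<le> Bg"
  shows "(Bf * Lg + Lf * Bg)-lipschitz_on X (\<lambda>x. f x *\<^sub>R g x)"
proof (rule lipschitz_onI)
  fix x y assume xy: "x \<in> X" "y \<in> X"
  have "f x *\<^sub>R g x - f y *\<^sub>R g y = f x *\<^sub>R (g x - g y) + (f x - f y) *\<^sub>R g y"
    by (simp add: scaleR_diff_right scaleR_diff_left)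
  then have "norm (f x *\<^sub>R g x - f y *\<^sub>R g y) \<le> \<bar>f x\<bar> * norm (g x - g y) + \<bar>f x - f y\<bar> * norm (g y)"
    by (metis norm_scaleR norm_triangle_ineq)
  also have "\<dots> \<le> Bf * (Lg * dist x y) + (Lf * dist x y) * Bg"
  proof (intro add_mono mult_mono)
    show "norm (g x - g y) \<le> Lg * dist x y" using lipschitz_onD[OF g xy] by (simp add: dist_norm)
    show "\<bar>f x - f y\<bar> \<le> Lf * dist x y" using lipschitz_onD[OF f xy] by (simp add: dist_real_def)
  qed (use bf bg xy B lipschitz_on_nonneg[OF f] in auto)
  finally show "dist (f x *\<^sub>R g x) (f y *\<^sub>R g y) \<le> (Bf * Lg + Lf * Bg) * dist x y"
    by (simp add: dist_norm algebra_simps)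
qed (use B lipschitz_on_nonneg[OF f] lipschitz_on_nonneg[OF g] in simp)

definition clip :: "real \<Rightarrow> 'a::euclidean_space \<Rightarrow> 'a" where
  "clip r = closest_point (cball 0 r)"

lemma clip_lipschitz: "0 \<le> r \<Longrightarrow> 1-lipschitz_on X (clip r)"
  by (rule lipschitz_onI) (simp_all add: clip_def closest_point_lipschitz)

lemma clip_eq: "norm x \<le> r \<Longrightarrow> clip r x = x"
  by (simp add: clip_def closest_point_self)

lemma norm_clip_le: "0 \<le> r \<Longrightarrow> norm (clip r x) \<le> r"
  using closest_point_in_set[of "cball 0 r" x] by (simp add: clip_def)

lemma lipschitz_null_image:
  fixes f :: "'a::euclidean_space \<Rightarrow> 'b::euclidean_space"
  assumes "L-lipschitz_on X f" "hausdorff d X = 0"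
  shows "hausdorff d (f ` X) = 0"
proof -
  have "(L + 1)-lipschitz_on X f" by (rule lipschitz_on_mono[OF assms(1)]) auto
  then show ?thesis
    using hausdorff_lipschitz_image_le[of "L + 1" X f d] lipschitz_on_nonneg[OF assms(1)] assms(2) by simp
qed

lemma hausdorff_singleton:
  fixes a :: "'a::euclidean_space"
  assumes "1 \<le> d" shows "hausdorff d {a} = 0"
proof -
  have "hausdorff_premeasure d \<delta> {a} \<le> 0" if "0 < \<delta>" for \<delta>
    using hausdorff_premeasure_small[of "{a}" 0 \<delta> d] assms that by (simp add: power_0_left)
  then have "hausdorff d {a} \<le> 0" by (rule hausdorff_leI)
  then show ?thesis by simp
qed

lemma sliding_mapsE:
  fixes \<phi> :: "'a::euclidean_space \<Rightarrow> 'a"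
  assumes "\<phi> \<in> sliding_maps H"
  obtains L and \<Phi> :: "real \<Rightarrow> 'a \<Rightarrow> 'a" where "L-lipschitz_on UNIV \<phi>" "0 < L"
    "continuous_on ({0..1} \<times> UNIV) (\<lambda>(t, x). \<Phi> t x)" "\<Phi> 1 = \<phi>" "\<Phi> 0 = id"
    "\<And>t x. t \<in> {0..1} \<Longrightarrow> x \<in> H \<Longrightarrow> \<Phi> t x \<in> H"
proof -
  obtain L and \<Phi> :: "real \<Rightarrow> 'a \<Rightarrow> 'a" where *: "L-lipschitz_on UNIV \<phi>"
    "continuous_on ({0..1} \<times> UNIV) (\<lambda>(t, x). \<Phi> t x)" "\<Phi> 1 = \<phi>" "\<Phi> 0 = id"
    "\<forall>t\<in>{0..1}. \<Phi> t ` H \<subseteq> H"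
    using assms unfolding sliding_maps_def by blast
  have "(L + 1)-lipschitz_on UNIV \<phi>" by (rule lipschitz_on_mono[OF *(1)]) auto
  moreover have "0 < L + 1" using lipschitz_on_nonneg[OF *(1)] by simp
  ultimately show thesis using that[of "L + 1" \<Phi>] * by blast
qed

lemma sliding_mapsI:
  fixes \<Phi> :: "real \<Rightarrow> 'a::euclidean_space \<Rightarrow> 'a"
  assumes "L-lipschitz_on UNIV \<phi>" "continuous_on ({0..1} \<times> UNIV) (\<lambda>(t, x). \<Phi> t x)" "\<Phi> 1 = \<phi>" "\<Phi> 0 = id"
    "\<And>t x. t \<in> {0..1} \<Longrightarrow> x \<in> H \<Longrightarrow> \<Phi> t x \<in> H"
  shows "\<phi> \<in> sliding_maps H"
  using assms unfolding sliding_maps_def by blast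

lemma sliding_maps_id: "id \<in> sliding_maps H"
  by (rule sliding_mapsI[of 1 _ "\<lambda>_. id"])
    (auto intro!: lipschitz_onI continuous_intros simp: case_prod_unfold)

text \<open>
  The two homotopies are run simultaneously.
\<close>

lemma sliding_maps_comp:
  fixes \<phi> :: "'a::euclidean_space \<Rightarrow> 'a"
  assumes "\<phi> \<in> sliding_maps H" "\<psi> \<in> sliding_maps H"
  shows "\<psi> \<circ> \<phi> \<in> sliding_maps H"
proof -
  obtain L and \<Phi> :: "real \<Rightarrow> 'a \<Rightarrow> 'a" where \<Phi>: "L-lipschitz_on UNIV \<phi>" "0 < L"
    "continuous_on ({0..1} \<times> UNIV) (\<lambda>(t, x). \<Phi> t x)" "\<Phi> 1 = \<phi>" "\<Phi> 0 = id"
    "\<And>t x. t \<in> {0..1} \<Longrightarrow> x \<in> H \<Longrightarrow> \<Phi> t x \<in> H"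
    using assms(1) by (rule sliding_mapsE) (rule that)
  obtain M and \<Psi> :: "real \<Rightarrow> 'a \<Rightarrow> 'a" where \<Psi>: "M-lipschitz_on UNIV \<psi>" "0 < M"
    "continuous_on ({0..1} \<times> UNIV) (\<lambda>(t, x). \<Psi> t x)" "\<Psi> 1 = \<psi>" "\<Psi> 0 = id"
    "\<And>t x. t \<in> {0..1} \<Longrightarrow> x \<in> H \<Longrightarrow> \<Psi> t x \<in> H"
    using assms(2) by (rule sliding_mapsE) (rule that)
  show ?thesis
  proof (rule sliding_mapsI[where \<Phi> = "\<lambda>t x. \<Psi> t (\<Phi> t x)"])
    show "(M * L)-lipschitz_on UNIV (\<psi> \<circ> \<phi>)"
      using lipschitz_on_compose[OF \<Phi>(1) lipschitz_on_subset[OF \<Psi>(1)]] by simp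
    have "continuous_on ({0..1} \<times> UNIV) (\<lambda>p. (fst p, case p of (t, x) \<Rightarrow> \<Phi> t x))"
      by (intro continuous_on_Pair continuous_on_fst continuous_on_id \<Phi>(3))
    then have "continuous_on ({0..1} \<times> UNIV) (\<lambda>p. (case (fst p, case p of (t, x) \<Rightarrow> \<Phi> t x) of (t, x) \<Rightarrow> \<Psi> t x))"
      by (rule continuous_on_compose2[OF \<Psi>(3)]) auto
    then show "continuous_on ({0..1} \<times> UNIV) (\<lambda>(t, x). \<Psi> t (\<Phi> t x))"
      by (simp add: case_prod_unfold)
  qed (use \<Phi> \<Psi> in \<open>auto simp: fun_eq_iff\<close>)
qed

text \<open>
  Only the behaviour on \<open>H\<close> matters: adding \<open>t *\<^sub>R (f x - P x)\<close> to a homotopy for \<open>P\<close> does not change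
  it on \<open>H\<close>.
\<close>

lemma sliding_maps_eq_on:
  fixes P :: "'a::euclidean_space \<Rightarrow> 'a"
  assumes P: "P \<in> sliding_maps H" and f: "L-lipschitz_on UNIV f" and eq: "\<And>x. x \<in> H \<Longrightarrow> f x = P x"
  shows "f \<in> sliding_maps H"
proof -
  obtain M and \<Phi> :: "real \<Rightarrow> 'a \<Rightarrow> 'a" where \<Phi>: "M-lipschitz_on UNIV P" "0 < M"
    "continuous_on ({0..1} \<times> UNIV) (\<lambda>(t, x). \<Phi> t x)" "\<Phi> 1 = P" "\<Phi> 0 = id"
    "\<And>t x. t \<in> {0..1} \<Longrightarrow> x \<in> H \<Longrightarrow> \<Phi> t x \<in> H"
    using P by (rule sliding_mapsE) (rule that)
  have cP: "continuous_on UNIV P" and cf: "continuous_on UNIV f"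
    using \<Phi>(1) f by (auto intro: lipschitz_on_continuous_on)
  show ?thesis
  proof (rule sliding_mapsI[where \<Phi> = "\<lambda>t x. \<Phi> t x + t *\<^sub>R (f x - P x)"])
    have "continuous_on ({0..1} \<times> UNIV) (\<lambda>p. (case p of (t, x) \<Rightarrow> \<Phi> t x) + fst p *\<^sub>R (f (snd p) - P (snd p)))"
      by (intro continuous_intros \<Phi>(3) continuous_on_compose2[OF cP] continuous_on_compose2[OF cf]) auto
    then show "continuous_on ({0..1} \<times> UNIV) (\<lambda>(t, x). \<Phi> t x + t *\<^sub>R (f x - P x))"
      by (simp add: case_prod_unfold)
  qed (use \<Phi> f eq in \<open>auto simp: fun_eq_iff\<close>)
qed

lemma sliding_class_self: "K \<in> sliding_class H K"
  unfolding sliding_class_def using sliding_maps_id[of H] by (auto intro!: bexI[of _ id])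

lemma sliding_class_image:
  assumes "\<psi> \<in> sliding_maps H" "J \<in> sliding_class H K" shows "\<psi> ` J \<in> sliding_class H K"
proof -
  obtain \<phi> where "\<phi> \<in> sliding_maps H" "J = \<phi> ` K" using assms(2) by (auto simp: sliding_class_def)
  then show ?thesis
    using sliding_maps_comp[OF _ assms(1)] unfolding sliding_class_def by (auto intro!: bexI[of _ "\<psi> \<circ> \<phi>"])
qed

text \<open>
  Polynomials are used to make the homotopies Lipschitz, which are merely continuous by definition.
\<close>

lemma real_polynomial_function_lipschitz:
  fixes p :: "'a::real_normed_vector \<Rightarrow> real"
  assumes "real_polynomial_function p" "bounded S"
  shows "\<exists>L. L-lipschitz_on S p"
  using assms(1)
proof (induction rule: real_polynomial_function.induct)
  case (linear f)
  then show ?case by (metis bounded_linear.lipschitz_boundE)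
next
  case (const c)
  then show ?case by (blast intro: lipschitz_on_constant)
next
  case (add f g)
  then show ?case by (blast intro: lipschitz_on_add)
next
  case (mult f g)
  then obtain Lf Lg where L: "Lf-lipschitz_on S f" "Lg-lipschitz_on S g" by blast
  have bd: "\<exists>B\<ge>0. \<forall>x\<in>S. \<bar>u x\<bar> \<le> B" if u: "Lu-lipschitz_on S u" for u :: "'a \<Rightarrow> real" and Lu
  proof (cases "S = {}")
    case False
    then obtain a where a: "a \<in> S" by blast
    obtain D where D: "\<And>x. x \<in> S \<Longrightarrow> dist a x \<le> D"
      using assms(2) bounded_any_center[of S a] by blast
    have "\<bar>u x\<bar> \<le> \<bar>u a\<bar> + Lu * D" if "x \<in> S" for x
    proof -
      have "\<bar>u x - u a\<bar> \<le> Lu * dist x a" using lipschitz_onD[OF u that a] by (simp add: dist_real_def)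
      also have "\<dots> \<le> Lu * D"
        using D[OF that] lipschitz_on_nonneg[OF u] by (intro mult_left_mono) (simp_all add: dist_commute)
      finally show ?thesis by linarith
    qed
    moreover have "0 \<le> \<bar>u a\<bar> + Lu * D"
      using lipschitz_on_nonneg[OF u] D[OF a] by simp
    ultimately show ?thesis by blast
  qed auto
  obtain Bf Bg where "0 \<le> Bf" "\<forall>x\<in>S. \<bar>f x\<bar> \<le> Bf" "0 \<le> Bg" "\<forall>x\<in>S. \<bar>g x\<bar> \<le> Bg"
    using bd[OF L(1)] bd[OF L(2)] by blast
  then show ?case
    using lipschitz_on_scaleR_bounded[OF L, of Bf Bg] by auto
qed

lemma polynomial_function_lipschitz:
  fixes p :: "'a::real_normed_vector \<Rightarrow> 'b::euclidean_space"
  assumes "polynomial_function p" "bounded S"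
  shows "\<exists>L. L-lipschitz_on S p"
proof -
  have "\<exists>L. L-lipschitz_on S (\<lambda>x. p x \<bullet> i)" for i
  proof -
    have "bounded_linear (\<lambda>y::'b. y \<bullet> i)" by (rule bounded_linear_inner_left)
    then have "real_polynomial_function ((\<lambda>y. y \<bullet> i) \<circ> p)"
      using assms(1) unfolding polynomial_function_def by blast
    then show ?thesis
      using real_polynomial_function_lipschitz[OF _ assms(2)] by (auto simp: o_def)
  qed
  then obtain L where L: "\<And>i. (L i)-lipschitz_on S (\<lambda>x. p x \<bullet> i)" by metis
  have "(\<Sum>i\<in>Basis. L i)-lipschitz_on S p"
  proof (rule lipschitz_onI)
    fix x y assume "x \<in> S" "y \<in> S"
    have "dist (p x) (p y) \<le> (\<Sum>i\<in>Basis. \<bar>(p x - p y) \<bullet> i\<bar>)"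
      unfolding dist_norm by (rule norm_le_l1)
    also have "\<dots> \<le> (\<Sum>i\<in>Basis. L i * dist x y)"
    proof (rule sum_mono)
      fix i
      show "\<bar>(p x - p y) \<bullet> i\<bar> \<le> L i * dist x y"
        using lipschitz_onD[OF L \<open>x \<in> S\<close> \<open>y \<in> S\<close>, of i] by (simp add: dist_real_def inner_diff_left)
    qed
    finally show "dist (p x) (p y) \<le> (\<Sum>i\<in>Basis. L i) * dist x y" by (simp add: sum_distrib_right)
  qed (use L in \<open>auto intro: sum_nonneg lipschitz_on_nonneg\<close>)
  then show ?thesis ..
qed

text \<open>
  A polynomial approximation of the homotopy, corrected by an affine function of time so that the two
  ends are attained exactly.
\<close>

lemma lipschitz_homotopy_approx:
  fixes \<Phi> :: "real \<Rightarrow> 'a::euclidean_space \<Rightarrow> 'a"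
  assumes c: "continuous_on ({0..1} \<times> UNIV) (\<lambda>(t, x). \<Phi> t x)" and \<Phi>0: "\<Phi> 0 = id"
    and \<phi>: "M-lipschitz_on UNIV (\<Phi> 1)" and e: "0 < e"
  obtains \<Psi> :: "real \<times> 'a \<Rightarrow> 'a" and L where "L-lipschitz_on ({0..1} \<times> cball 0 r) \<Psi>"
    "\<And>x. norm x \<le> r \<Longrightarrow> \<Psi> (0, x) = x" "\<And>x. norm x \<le> r \<Longrightarrow> \<Psi> (1, x) = \<Phi> 1 x"
    "\<And>t x. t \<in> {0..1} \<Longrightarrow> norm x \<le> r \<Longrightarrow> dist (\<Psi> (t, x)) (\<Phi> t x) < e"
proof -
  let ?S = "{0..1::real} \<times> cball (0::'a) r"
  have compS: "compact ?S" by (intro compact_Times compact_cball) simp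
  have cS: "continuous_on ?S (\<lambda>(t, x). \<Phi> t x)" by (rule continuous_on_subset[OF c]) auto
  obtain g where g: "polynomial_function g" "\<And>p. p \<in> ?S \<Longrightarrow> norm ((case p of (t, x) \<Rightarrow> \<Phi> t x) - g p) < e / 3"
    using Stone_Weierstrass_polynomial_function[OF compS cS, of "e / 3"] e by auto
  obtain Lg where Lg: "Lg-lipschitz_on ?S g"
    using polynomial_function_lipschitz[OF g(1) compact_imp_bounded[OF compS]] by blast
  define a where "a = (\<lambda>p::real \<times> 'a. snd p - g (0, snd p))"
  define b where "b = (\<lambda>p::real \<times> 'a. \<Phi> 1 (snd p) - g (1, snd p))"
  define \<Psi> where "\<Psi> = (\<lambda>p. g p + ((1 - fst p) *\<^sub>R a p + fst p *\<^sub>R b p))"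
  have lsnd: "1-lipschitz_on ?S (snd :: real \<times> 'a \<Rightarrow> 'a)" and lfst: "1-lipschitz_on ?S (fst :: real \<times> 'a \<Rightarrow> real)"
    by (rule lipschitz_onI; simp only: mult_1 dist_snd_le dist_fst_le zero_le_one)+
  have lpair: "1-lipschitz_on ?S (\<lambda>p. (c, snd p))" for c :: real
    by (rule lipschitz_onI) (simp_all add: dist_Pair_Pair dist_snd_le)
  have gc: "(Lg * 1)-lipschitz_on ?S (\<lambda>p. g (c, snd p))" if "c \<in> {0..1}" for c
    by (rule lipschitz_on_compose2[OF lpair lipschitz_on_subset[OF Lg]]) (use that in auto)
  have La: "(1 + Lg * 1)-lipschitz_on ?S a"
    unfolding a_def by (rule lipschitz_on_diff[OF lsnd gc]) simp
  have Lb: "(M * 1 + Lg * 1)-lipschitz_on ?S b"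
    unfolding b_def by (rule lipschitz_on_diff[OF lipschitz_on_compose2[OF lsnd lipschitz_on_subset[OF \<phi>]] gc]) simp_all
  have na: "norm (a p) \<le> e / 3" if "p \<in> ?S" for p
    using g(2)[of "(0, snd p)"] that \<Phi>0 by (cases p) (auto simp: a_def)
  have nb: "norm (b p) \<le> e / 3" if "p \<in> ?S" for p
    using g(2)[of "(1, snd p)"] that by (cases p) (auto simp: b_def)
  have l1: "(0 + 1)-lipschitz_on ?S (\<lambda>p::real \<times> 'a. 1 - fst p)"
    by (rule lipschitz_on_diff[OF lipschitz_on_constant lfst])
  have "(Lg + ((1 * (1 + Lg * 1) + (0 + 1) * (e / 3)) + (1 * (M * 1 + Lg * 1) + 1 * (e / 3))))-lipschitz_on ?S \<Psi>"
    unfolding \<Psi>_def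
    by (intro lipschitz_on_add Lg lipschitz_on_scaleR_bounded l1 La lfst Lb na nb) (use e in auto)
  moreover have "\<Psi> (0, x) = x" "\<Psi> (1, x) = \<Phi> 1 x" if "norm x \<le> r" for x
    by (simp_all add: \<Psi>_def a_def b_def)
  moreover have "dist (\<Psi> (t, x)) (\<Phi> t x) < e" if t: "t \<in> {0..1}" "norm x \<le> r" for t x
  proof -
    have p: "(t, x) \<in> ?S" using t by simp
    have "norm ((1 - t) *\<^sub>R a (t, x) + t *\<^sub>R b (t, x)) \<le> norm ((1 - t) *\<^sub>R a (t, x)) + norm (t *\<^sub>R b (t, x))"
      by (rule norm_triangle_ineq)
    also have "\<dots> \<le> (1 - t) * (e / 3) + t * (e / 3)"
      unfolding norm_scaleR using t na[OF p] nb[OF p] by (intro add_mono mult_mono) auto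
    also have "\<dots> = e / 3" unfolding distrib_right[symmetric] by simp
    finally have 1: "norm ((1 - t) *\<^sub>R a (t, x) + t *\<^sub>R b (t, x)) \<le> e / 3" .
    have 2: "norm (g (t, x) - \<Phi> t x) < e / 3" using g(2)[OF p] by (simp add: norm_minus_commute)
    have "\<Psi> (t, x) - \<Phi> t x = (g (t, x) - \<Phi> t x) + ((1 - t) *\<^sub>R a (t, x) + t *\<^sub>R b (t, x))"
      by (simp add: \<Psi>_def)
    then have "norm (\<Psi> (t, x) - \<Phi> t x) \<le> norm (g (t, x) - \<Phi> t x) + norm ((1 - t) *\<^sub>R a (t, x) + t *\<^sub>R b (t, x))"
      by (metis norm_triangle_ineq)
    then show ?thesis using 1 2 e by (simp add: dist_norm)
  qed
  ultimately show thesis by (rule that)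
qed


section \<open>Area cannot escape to infinity\<close>

lemma mem_nbhd_iff: "x \<in> nbhd \<delta> H \<longleftrightarrow> (\<exists>z\<in>H. dist z x < \<delta>)"
  by (auto simp: nbhd_def)

lemma open_nbhd: "open (nbhd \<delta> H)"
  unfolding nbhd_def by (intro open_UN ballI open_ball)

text \<open>
  Uniform continuity on a compact set: points close to \<open>H\<close> stay close to \<open>H\<close> during the homotopy.
\<close>

lemma homotopy_near_constraint:
  fixes \<Phi> :: "real \<Rightarrow> 'a::euclidean_space \<Rightarrow> 'a"
  assumes c: "continuous_on ({0..1} \<times> UNIV) (\<lambda>(t, x). \<Phi> t x)"
    and \<Phi>H: "\<And>t x. t \<in> {0..1} \<Longrightarrow> x \<in> H \<Longrightarrow> \<Phi> t x \<in> H"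
    and H: "H \<noteq> {}" and e: "0 < e"
  obtains \<epsilon> where "0 < \<epsilon>"
    "\<And>t x. t \<in> {0..1} \<Longrightarrow> norm x \<le> r \<Longrightarrow> infdist x H < \<epsilon> \<Longrightarrow> \<exists>z\<in>H. dist z (\<Phi> t x) < e"
proof -
  let ?S = "{0..1::real} \<times> cball (0::'a) (r + 1)"
  have "compact ?S" by (intro compact_Times compact_cball) simp
  moreover have "continuous_on ?S (\<lambda>(t, x). \<Phi> t x)" by (rule continuous_on_subset[OF c]) auto
  ultimately have "uniformly_continuous_on ?S (\<lambda>(t, x). \<Phi> t x)" by (rule compact_uniformly_continuous[rotated])
  then have "\<exists>\<delta>>0. \<forall>p\<in>?S. \<forall>q\<in>?S. dist q p < \<delta> \<longrightarrow>
      dist (case q of (t, x) \<Rightarrow> \<Phi> t x) (case p of (t, x) \<Rightarrow> \<Phi> t x) < e"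
    using e by (simp only: uniformly_continuous_on_def)
  then obtain \<delta> where \<delta>: "0 < \<delta>" "\<forall>p\<in>?S. \<forall>q\<in>?S. dist q p < \<delta> \<longrightarrow>
      dist (case q of (t, x) \<Rightarrow> \<Phi> t x) (case p of (t, x) \<Rightarrow> \<Phi> t x) < e"
    by (elim exE conjE)
  show thesis
  proof (rule that[of "min \<delta> 1"])
    show "0 < min \<delta> 1" using \<delta>(1) by simp
    fix t :: real and x :: 'a
    assume t: "t \<in> {0..1}" and x: "norm x \<le> r" "infdist x H < min \<delta> 1"
    have "(INF z\<in>H. dist x z) < min \<delta> 1" using x(2) H by (simp add: infdist_def)
    moreover have "bdd_below (dist x ` H)" by (rule bdd_belowI2[of _ 0]) simp
    ultimately obtain z where z: "z \<in> H" "dist x z < min \<delta> 1"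
      using cINF_less_iff[OF H] by (metis (no_types, lifting))
    have "norm z \<le> norm x + dist x z" using norm_triangle_ineq2[of z x] by (simp add: dist_norm norm_minus_commute)
    then have S: "(t, z) \<in> ?S" "(t, x) \<in> ?S" using t x(1) z(2) by simp_all
    have "dist (t, z) (t, x) < \<delta>" using z(2) by (simp add: dist_Pair_Pair dist_commute)
    then have "dist (\<Phi> t z) (\<Phi> t x) < e" using bspec[OF bspec[OF \<delta>(2) S(2)] S(1)] by simp
    then show "\<exists>z\<in>H. dist z (\<Phi> t x) < e" using \<Phi>H[OF t z(1)] by (rule bexI)
  qed
qed

text \<open>
  The competitor is \<open>G (\<Psi> (\<tau> x, x))\<close> with \<open>\<Psi>\<close> a Lipschitz approximation of the homotopy of \<open>\<phi>\<close> and
  \<open>\<tau>\<close> the distance to \<open>H\<close>, rescaled and cut off at \<open>1\<close>. Away from the collar this is \<open>G (\<phi> x)\<close>. In the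
  collar \<open>\<Psi> (\<tau> x, x)\<close> is close to \<open>H\<close>, whatever the time is. On \<open>H\<close> the time is \<open>0\<close>, and the map is \<open>G\<close>,
  which equals \<open>P\<close> there as long as \<open>x\<close> is not far from the origin; farther out, where \<open>K0\<close> has no
  points, it is replaced by \<open>P\<close>.
\<close>

lemma collar_competitor:
  fixes H K0 :: "'a::euclidean_space set" and G :: "'a \<Rightarrow> 'a"
  assumes H: "H \<noteq> {}" and P: "P \<in> sliding_maps H" and \<phi>: "\<phi> \<in> sliding_maps H"
    and K0: "K0 \<subseteq> cball 0 R" and R: "0 \<le> R"
    and G: "LG-lipschitz_on UNIV G" "\<And>y. norm (G y) \<le> M"
    and GP: "\<And>x. norm x \<le> R + 1 \<Longrightarrow> x \<in> H \<Longrightarrow> G x = P x"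
    and PM: "\<And>x. norm x \<le> R + 1 \<Longrightarrow> norm (P x) \<le> M"
    and \<kappa>: "0 < \<kappa>"
  obtains f where "f \<in> sliding_maps H" "f ` K0 \<subseteq> G ` (\<phi> ` K0) \<union> G ` nbhd \<kappa> H"
proof -
  obtain L1 and \<Phi> :: "real \<Rightarrow> 'a \<Rightarrow> 'a" where \<Phi>: "L1-lipschitz_on UNIV \<phi>" "0 < L1"
    "continuous_on ({0..1} \<times> UNIV) (\<lambda>(t, x). \<Phi> t x)" "\<Phi> 1 = \<phi>" "\<Phi> 0 = id"
    "\<And>t x. t \<in> {0..1} \<Longrightarrow> x \<in> H \<Longrightarrow> \<Phi> t x \<in> H"
    using \<phi> by (rule sliding_mapsE) (rule that)
  obtain L2 where LP: "L2-lipschitz_on UNIV P" using P by (rule sliding_mapsE)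
  have R1: "0 \<le> R + 1" using R by simp
  have M0: "0 \<le> M" using G(2)[of 0] norm_ge_zero order_trans by blast
  have \<kappa>2: "0 < \<kappa> / 2" using \<kappa> by simp
  have \<Phi>lip: "L1-lipschitz_on UNIV (\<Phi> 1)" using \<Phi>(1,4) by simp
  obtain \<Psi> :: "real \<times> 'a \<Rightarrow> 'a" and L where \<Psi>: "L-lipschitz_on ({0..1} \<times> cball 0 (R + 1)) \<Psi>"
    "\<And>x. norm x \<le> R + 1 \<Longrightarrow> \<Psi> (0, x) = x" "\<And>x. norm x \<le> R + 1 \<Longrightarrow> \<Psi> (1, x) = \<Phi> 1 x"
    "\<And>t x. t \<in> {0..1} \<Longrightarrow> norm x \<le> R + 1 \<Longrightarrow> dist (\<Psi> (t, x)) (\<Phi> t x) < \<kappa> / 2"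
    using \<Phi>(3,5) \<Phi>lip \<kappa>2 by (rule lipschitz_homotopy_approx) (rule that)
  obtain \<epsilon> where \<epsilon>: "0 < \<epsilon>"
    "\<And>t x. t \<in> {0..1} \<Longrightarrow> norm x \<le> R + 1 \<Longrightarrow> infdist x H < \<epsilon> \<Longrightarrow> \<exists>z\<in>H. dist z (\<Phi> t x) < \<kappa> / 2"
  proof (rule homotopy_near_constraint[OF \<Phi>(3) _ H \<kappa>2, where r = "R + 1"])
    show "\<Phi> t x \<in> H" if "t \<in> {0..1}" "x \<in> H" for t x using that by (rule \<Phi>(6))
  qed (rule that)
  define \<tau> where "\<tau> = (\<lambda>x. clamp01 (infdist x H / \<epsilon>))"
  define w where "w = (\<lambda>x::'a. clamp01 (R + 1 - norm x))"
  define c where "c = (\<lambda>x. G (\<Psi> (\<tau> x, clip (R + 1) x)))"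
  \<comment> \<open>Clipping the argument makes both terms of the difference bounded, so that the product with the
    cutoff function \<open>w\<close> is Lipschitz.\<close>
  define f where "f = (\<lambda>x. P x + w x *\<^sub>R (c x - P (clip (R + 1) x)))"
  have \<tau>01: "\<tau> x \<in> {0..1}" for x using clamp01_range by (simp add: \<tau>_def)
  have "(1 / \<epsilon> * 1)-lipschitz_on UNIV (\<lambda>x. 1 / \<epsilon> * infdist x H)"
    by (rule lipschitz_on_cmult_real_nonneg[OF infdist_lipschitz]) (use \<epsilon>(1) in simp)
  then have \<tau>lip: "(1 / \<epsilon>)-lipschitz_on UNIV \<tau>"
    unfolding \<tau>_def by (intro clamp01_lipschitz) simp
  have wlip: "(0 + 1)-lipschitz_on UNIV w"
    unfolding w_def by (intro clamp01_lipschitz lipschitz_on_diff lipschitz_on_constant norm_lipschitz)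
  have pairlip: "(sqrt ((1 / \<epsilon>)\<^sup>2 + 1\<^sup>2))-lipschitz_on UNIV (\<lambda>x. (\<tau> x, clip (R + 1) x))"
    by (rule lipschitz_on_Pair[OF \<tau>lip clip_lipschitz[OF R1]])
  have sub: "(\<lambda>x. (\<tau> x, clip (R + 1) x)) ` UNIV \<subseteq> {0..1} \<times> cball 0 (R + 1)"
    using \<tau>01 norm_clip_le[OF R1] by auto
  have clip_lip: "(LG * (L * sqrt ((1 / \<epsilon>)\<^sup>2 + 1\<^sup>2)))-lipschitz_on UNIV c"
    unfolding c_def
    by (intro lipschitz_on_compose2 lipschitz_on_subset[OF G(1)] lipschitz_on_subset[OF \<Psi>(1)] pairlip sub) simp
  have dlip: "(LG * (L * sqrt ((1 / \<epsilon>)\<^sup>2 + 1\<^sup>2)) + L2 * 1)-lipschitz_on UNIV (\<lambda>x. c x - P (clip (R + 1) x))"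
    by (intro lipschitz_on_diff clip_lip lipschitz_on_compose2[OF clip_lipschitz[OF R1] lipschitz_on_subset[OF LP]]) simp
  have dbd: "norm (c x - P (clip (R + 1) x)) \<le> 2 * M" for x
    using norm_triangle_ineq4[of "c x" "P (clip (R + 1) x)"] G(2)[of "\<Psi> (\<tau> x, clip (R + 1) x)"]
      PM[OF norm_clip_le[OF R1], of x] by (simp add: c_def)
  have f_lip: "(L2 + (1 * (LG * (L * sqrt ((1 / \<epsilon>)\<^sup>2 + 1\<^sup>2)) + L2 * 1) + (0 + 1) * (2 * M)))-lipschitz_on UNIV f"
    unfolding f_def
    by (intro lipschitz_on_add LP lipschitz_on_scaleR_bounded[OF wlip dlip])
      (use dbd M0 clamp01_range in \<open>auto simp: w_def\<close>)
  have fP: "f x = P x" if x: "x \<in> H" for x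
  proof (cases "norm x \<le> R + 1")
    case True
    have "\<tau> x = 0" using x by (simp add: \<tau>_def clamp01_def)
    then have "c x = P x" using True x GP \<Psi>(2) by (simp add: c_def clip_eq)
    then show ?thesis using True by (simp add: f_def clip_eq)
  next
    case False
    then show ?thesis by (simp add: f_def w_def clamp01_eq_0)
  qed
  have "f \<in> sliding_maps H" by (rule sliding_maps_eq_on[OF P f_lip fP])
  moreover have "f ` K0 \<subseteq> G ` (\<phi> ` K0) \<union> G ` nbhd \<kappa> H"
  proof (rule image_subsetI)
    fix x assume x: "x \<in> K0"
    then have nx: "norm x \<le> R" using K0 by auto
    have "w x = 1" using nx by (simp add: w_def clamp01_eq_1)
    then have fx: "f x = G (\<Psi> (\<tau> x, x))" using nx by (simp add: f_def c_def clip_eq)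
    show "f x \<in> G ` (\<phi> ` K0) \<union> G ` nbhd \<kappa> H"
    proof (cases "infdist x H < \<epsilon>")
      case True
      obtain z where z: "z \<in> H" "dist z (\<Phi> (\<tau> x) x) < \<kappa> / 2"
        using \<epsilon>(2)[OF \<tau>01 _ True] nx by auto
      have "dist (\<Psi> (\<tau> x, x)) (\<Phi> (\<tau> x) x) < \<kappa> / 2" using \<Psi>(4)[OF \<tau>01] nx by simp
      then have "dist z (\<Psi> (\<tau> x, x)) < \<kappa>"
        using z(2) by (metis dist_triangle_half_r dist_commute)
      then have "\<Psi> (\<tau> x, x) \<in> nbhd \<kappa> H" using z(1) by (auto simp: mem_nbhd_iff)
      then show ?thesis using fx by blast
    next
      case False
      then have "1 \<le> infdist x H / \<epsilon>" using \<epsilon>(1) by simp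
      then have "\<tau> x = 1" by (simp add: \<tau>_def clamp01_eq_1)
      then have "f x = G (\<phi> x)" using fx \<Psi>(3)[of x] nx \<Phi>(4) by simp
      then show ?thesis using x by blast
    qed
  qed
  ultimately show thesis by (rule that)
qed

text \<open>
  The map \<open>G\<close> of the previous lemma is \<open>g \<circ> F\<close>, where \<open>g\<close> is \<open>P\<close>, clipped to a ball of radius \<open>M\<close> and
  scaled to \<open>0\<close> when \<open>norm z\<close> grows from \<open>S + 2\<close> to \<open>S + 3\<close>, and \<open>F\<close> is a grid deformation with mesh
  so small that it moves points by less than \<open>\<delta> / 2\<close> and \<open>1 / 2\<close>. It acts fully from radius \<open>S + 1\<close> on
  and is the identity up to radius \<open>S\<close>. A point near \<open>H\<close> is sent to \<open>clip M ` H\<close> if its norm is at most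
  \<open>S + 1\<close>, because \<open>F\<close> does not leave \<open>nbhd \<delta> H\<close> and \<open>g\<close> is not yet scaled; it is sent to the image
  of the skeleton otherwise, or to \<open>0\<close>. Clipping bounds \<open>P\<close>, so that the Lipschitz constant of \<open>g\<close>, and
  with it \<open>C\<close>, does not depend on \<open>S\<close>.
\<close>

lemma area_outside_shell:
  fixes H K0 :: "'a::euclidean_space set"
  assumes d: "1 \<le> d" and H: "closed H" "H \<noteq> {}" "hausdorff d H = 0"
    and P: "P \<in> sliding_maps H" "\<Lambda>-lipschitz_on UNIV P" "0 < \<Lambda>" "P ` nbhd \<delta> H \<subseteq> H" "0 < \<delta>"
    and K0: "K0 \<subseteq> cball 0 R" and R: "0 \<le> R"
  obtains C :: real where "0 < C"
    "\<And>S \<phi>. R + 1 \<le> S \<Longrightarrow> \<phi> \<in> sliding_maps H \<Longrightarrow>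
       (INF J\<in>sliding_class H K0. hausdorff d J)
         \<le> ennreal (\<Lambda> ^ d) * hausdorff d (\<phi> ` K0 \<inter> cball 0 S - nbhd \<delta> H)
           + ennreal C * hausdorff d (\<phi> ` K0 \<inter> (cball 0 (S + 5) - ball 0 S))"
proof -
  define h where "h = min (1 / (2 * DIM('a))) (\<delta> / (4 * DIM('a)))"
  have D1: "1 \<le> real DIM('a)" using DIM_positive[where 'a='a] by linarith
  have h: "0 < h" "h \<le> 1" and hn: "DIM('a) * h \<le> 1 / 2" "DIM('a) * h < \<delta> / 2"
  proof -
    show "0 < h" using P(5) D1 by (simp add: h_def)
    have "1 \<le> 2 * real DIM('a)" using D1 by linarith
    then have "1 / (2 * real DIM('a)) \<le> 1" by simp
    then show "h \<le> 1" unfolding h_def by linarith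
    have "DIM('a) * h \<le> DIM('a) * (1 / (2 * DIM('a)))" by (rule mult_left_mono) (simp_all add: h_def)
    then show "DIM('a) * h \<le> 1 / 2" by simp
    have "DIM('a) * h \<le> DIM('a) * (\<delta> / (4 * DIM('a)))" by (rule mult_left_mono) (simp_all add: h_def)
    then show "DIM('a) * h < \<delta> / 2" using P(5) by simp
  qed
  define M where "M = norm (P 0) + \<Lambda> * (R + 1)"
  have M0: "0 \<le> M" using P(3) R by (simp add: M_def)
  have PM: "norm (P x) \<le> M" if "norm x \<le> R + 1" for x
  proof -
    have "norm (P x - P 0) \<le> \<Lambda> * norm x" using lipschitz_onD[OF P(2), of x 0] by (simp add: dist_norm)
    also have "\<dots> \<le> \<Lambda> * (R + 1)" using that P(3) by (intro mult_left_mono) auto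
    finally show ?thesis using norm_triangle_sub[of "P x" "P 0"] by (simp add: M_def)
  qed
  define LG where "LG = \<Lambda> + M"
  have LG: "0 < LG" using P(3) M0 by (simp add: LG_def)
  define C where "C = LG ^ d * (3 ^ DIM('a) * (real DIM('a) * 4) ^ d * (2 * 2 ^ DIM('a)))"
  have C: "0 < C" using LG D1 by (simp add: C_def)
  have main: "(INF J\<in>sliding_class H K0. hausdorff d J)
         \<le> ennreal (\<Lambda> ^ d) * hausdorff d (\<phi> ` K0 \<inter> cball 0 S - nbhd \<delta> H)
           + ennreal C * hausdorff d (\<phi> ` K0 \<inter> (cball 0 (S + 5) - ball 0 S))"
    if S: "R + 1 \<le> S" and \<phi>: "\<phi> \<in> sliding_maps H" for S and \<phi> :: "'a \<Rightarrow> 'a"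
  proof -
    define E where "E = \<phi> ` K0 \<inter> (cball 0 (S + 5) - ball 0 S)"
    \<comment> \<open>One unit larger than the region where \<open>G\<close> matters, so that it contains the points of \<open>H\<close> next to it.\<close>
    define N where "N = H \<inter> cball 0 (S + 6)"
    have N: "compact N" "hausdorff d N = 0"
      using H hausdorff_null_subset[OF H(3), of N] by (auto simp: N_def closed_Int_compact)
    define l where "l = (\<lambda>y::'a. clamp01 (norm y - S))"
    have l: "0 \<le> l y" "l y \<le> 1" for y using clamp01_range by (auto simp: l_def)
    have "(1 + 0)-lipschitz_on UNIV l"
      unfolding l_def by (intro clamp01_lipschitz lipschitz_on_diff norm_lipschitz lipschitz_on_constant)
    then have l_lip: "1-lipschitz_on UNIV l" by simp
    obtain F :: "'a \<Rightarrow> 'a" and \<kappa> L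
      where \<kappa>: "0 < \<kappa>" and F: "L-lipschitz_on UNIV F" "\<And>y. l y = 0 \<Longrightarrow> F y = y"
      "\<And>y. norm (F y - y) \<le> DIM('a) * h"
      and Fnull: "hausdorff d (F ` {y. l y = 1 \<and> (\<exists>z\<in>N. dist z y < \<kappa>)}) = 0"
      and FE: "hausdorff d (F ` E) \<le> ennreal (3 ^ DIM('a) * (real DIM('a) * 4) ^ d * (2 * 2 ^ DIM('a))) * hausdorff d E"
      by (rule grid_deformation[OF d N h l l_lip, where E = E]) (rule that)
    have Fnear: "norm (F y) \<le> norm y + 1 / 2" "norm y \<le> norm (F y) + 1 / 2" for y
      using F(3)[of y] hn(1) norm_triangle_ineq2[of "F y" y] norm_triangle_ineq3[of "F y" y] by linarith+
    define g where "g = (\<lambda>z. (1 - clamp01 (norm z - (S + 2))) *\<^sub>R clip M (P z))"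
    have g_eq: "g z = clip M (P z)" if "norm z \<le> S + 2" for z
      using that by (simp add: g_def clamp01_eq_0)
    have g_0: "g z = 0" if "S + 3 \<le> norm z" for z
      using that by (simp add: g_def clamp01_eq_1)
    have PR_lip: "(1 * \<Lambda>)-lipschitz_on UNIV (\<lambda>z. clip M (P z))"
      by (rule lipschitz_on_compose2[OF P(2) clip_lipschitz[OF M0]])
    have "(0 + (1 + 0))-lipschitz_on UNIV (\<lambda>z::'a. 1 - clamp01 (norm z - (S + 2)))"
      by (intro lipschitz_on_diff clamp01_lipschitz norm_lipschitz lipschitz_on_constant)
    then have "(1 * (1 * \<Lambda>) + (0 + (1 + 0)) * M)-lipschitz_on UNIV g"
      unfolding g_def
      by (rule lipschitz_on_scaleR_bounded[OF _ PR_lip])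
        (use clamp01_range norm_clip_le[OF M0] M0 in \<open>auto simp: abs_le_iff add_increasing2\<close>)
    then have g_lip: "LG-lipschitz_on UNIV g" by (simp add: LG_def)
    have g_bd: "norm (g z) \<le> M" for z
    proof -
      have "\<bar>1 - clamp01 (norm z - (S + 2))\<bar> * norm (clip M (P z)) \<le> 1 * M"
        using clamp01_range[of "norm z - (S + 2)"] norm_clip_le[OF M0] by (intro mult_mono) auto
      then show ?thesis by (simp add: g_def)
    qed
    define G where "G = (\<lambda>y. g (F y))"
    have G_lip: "(LG * L)-lipschitz_on UNIV G"
      unfolding G_def by (rule lipschitz_on_compose2[OF F(1) lipschitz_on_subset[OF g_lip]]) simp
    have G_inner: "G y = clip M (P y)" if "norm y \<le> S" for y
      using that by (simp add: G_def F(2) l_def clamp01_eq_0 g_eq)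
    have G_outer: "G y = 0" if "S + 5 \<le> norm y" for y
      using that Fnear(2)[of y] by (auto simp: G_def intro!: g_0)
    \<comment> \<open>\<open>\<delta> / 2\<close> leaves room for the displacement by \<open>F\<close>, and \<open>1\<close> keeps nearby points of \<open>H\<close> in \<open>N\<close>.\<close>
    define \<kappa>' where "\<kappa>' = min \<kappa> (min (\<delta> / 2) 1)"
    have \<kappa>': "0 < \<kappa>'" using \<kappa> P(5) by (simp add: \<kappa>'_def)
    define Z where "Z = clip M ` H \<union> g ` (F ` {y. l y = 1 \<and> (\<exists>z\<in>N. dist z y < \<kappa>)}) \<union> {0::'a}"
    have Z: "hausdorff d Z = 0"
      unfolding Z_def
      by (intro hausdorff_null_Un hausdorff_singleton[OF d]
          lipschitz_null_image[OF clip_lipschitz[OF M0] H(3)]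
          lipschitz_null_image[OF lipschitz_on_subset[OF g_lip subset_UNIV] Fnull])
    have GZ: "G ` nbhd \<kappa>' H \<subseteq> Z"
    proof (rule image_subsetI)
      fix y assume "y \<in> nbhd \<kappa>' H"
      then obtain z where z: "z \<in> H" "dist z y < \<kappa>'" by (auto simp: mem_nbhd_iff)
      consider "norm y \<le> S + 1" | "S + 1 \<le> norm y" "norm y \<le> S + 5" | "S + 5 \<le> norm y" by linarith
      then show "G y \<in> Z"
      proof cases
        case 1
        have "dist y (F y) < \<delta> / 2" using F(3)[of y] hn(2) by (simp add: dist_norm norm_minus_commute)
        moreover have "dist z y < \<delta> / 2" using z(2) by (simp add: \<kappa>'_def)
        ultimately have "dist z (F y) < \<delta>" using dist_triangle[of z "F y" y] by simp
        then have "F y \<in> nbhd \<delta> H" using z(1) unfolding mem_nbhd_iff by (rule bexI)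
        then have "P (F y) \<in> H" using P(4) by (simp only: image_subset_iff)
        then have "clip M (P (F y)) \<in> clip M ` H" by (rule imageI)
        moreover have "norm (F y) \<le> S + 2" using Fnear(1)[of y] 1 by linarith
        then have "G y = clip M (P (F y))" by (simp add: G_def g_eq)
        ultimately show ?thesis by (simp add: Z_def)
      next
        case 2
        have "norm z \<le> norm y + dist z y" using norm_triangle_sub[of z y] by (simp add: dist_norm)
        moreover have "dist z y < 1" using z(2) by (simp add: \<kappa>'_def)
        ultimately have "z \<in> N" using z(1) 2 by (simp add: N_def)
        moreover have "l y = 1" using 2 by (simp add: l_def clamp01_eq_1)
        moreover have "dist z y < \<kappa>" using z(2) by (simp add: \<kappa>'_def)
        ultimately have "y \<in> {y. l y = 1 \<and> (\<exists>z\<in>N. dist z y < \<kappa>)}" by blast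
        then have "G y \<in> g ` (F ` {y. l y = 1 \<and> (\<exists>z\<in>N. dist z y < \<kappa>)})"
          unfolding G_def by (intro imageI)
        then show ?thesis unfolding Z_def by blast
      next
        case 3
        then have "G y = 0" by (rule G_outer)
        then show ?thesis by (simp add: Z_def)
      qed
    qed
    obtain f where f: "f \<in> sliding_maps H" "f ` K0 \<subseteq> G ` (\<phi> ` K0) \<union> G ` nbhd \<kappa>' H"
    proof (rule collar_competitor[OF H(2) P(1) \<phi> K0 R G_lip _ _ _ \<kappa>'])
      show "norm (P x) \<le> M" if "norm x \<le> R + 1" for x using that by (rule PM)
      show "norm (G y) \<le> M" for y using g_bd by (simp add: G_def)
      show "G x = P x" if "norm x \<le> R + 1" for x
        using that S PM[OF that] by (simp add: G_inner clip_eq)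
    qed (rule that)
    let ?A = "\<phi> ` K0 \<inter> cball 0 S - nbhd \<delta> H"
    have "G ` (\<phi> ` K0) \<subseteq> (\<lambda>z. clip M (P z)) ` ?A \<union> g ` (F ` E) \<union> Z"
    proof (rule image_subsetI)
      fix y assume y: "y \<in> \<phi> ` K0"
      consider "norm y \<le> S" "y \<in> nbhd \<delta> H" | "norm y \<le> S" "y \<notin> nbhd \<delta> H"
        | "S \<le> norm y" "norm y \<le> S + 5" | "S + 5 \<le> norm y" by linarith
      then show "G y \<in> (\<lambda>z. clip M (P z)) ` ?A \<union> g ` (F ` E) \<union> Z"
      proof cases
        case 1
        then have "P y \<in> H" using P(4) by (simp only: image_subset_iff)
        then have "clip M (P y) \<in> clip M ` H" by (rule imageI)
        then show ?thesis using G_inner[OF 1(1)] by (simp add: Z_def)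
      next
        case 2
        then have "y \<in> ?A" using y by simp
        then have "clip M (P y) \<in> (\<lambda>z. clip M (P z)) ` ?A" by (rule imageI)
        then show ?thesis unfolding G_inner[OF 2(1)] by (rule UnI1[OF UnI1])
      next
        case 3
        then have "y \<in> E" using y by (simp add: E_def)
        then have "G y \<in> g ` (F ` E)" unfolding G_def by (intro imageI)
        then show ?thesis by (rule UnI1[OF UnI2])
      next
        case 4
        then have "G y = 0" by (rule G_outer)
        then show ?thesis by (simp add: Z_def)
      qed
    qed
    from Un_least[OF this order_trans[OF GZ Un_upper2]]
    have fK: "f ` K0 \<subseteq> ((\<lambda>z. clip M (P z)) ` ?A \<union> g ` (F ` E)) \<union> Z"
      by (rule order_trans[OF f(2)])
    have "(INF J\<in>sliding_class H K0. hausdorff d J) \<le> hausdorff d (f ` K0)"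
    proof (rule INF_lower)
      show "f ` K0 \<in> sliding_class H K0" unfolding sliding_class_def by (intro CollectI bexI[OF refl f(1)])
    qed
    also have "\<dots> \<le> hausdorff d ((\<lambda>z. clip M (P z)) ` ?A) + hausdorff d (g ` (F ` E)) + hausdorff d Z"
      by (rule order_trans[OF hausdorff_mono[OF fK] order_trans[OF hausdorff_Un_le add_right_mono[OF hausdorff_Un_le]]])
    also have "\<dots> = hausdorff d ((\<lambda>z. clip M (P z)) ` ?A) + hausdorff d (g ` (F ` E))"
      by (simp add: Z)
    also have "\<dots> \<le> ennreal (\<Lambda> ^ d) * hausdorff d ?A + ennreal C * hausdorff d E"
    proof (rule add_mono)
      have "\<Lambda>-lipschitz_on ?A (\<lambda>z. clip M (P z))"
        using lipschitz_on_subset[OF PR_lip subset_UNIV] by simp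
      then show "hausdorff d ((\<lambda>z. clip M (P z)) ` ?A) \<le> ennreal (\<Lambda> ^ d) * hausdorff d ?A"
        by (rule hausdorff_lipschitz_image_le) (rule P(3))
      have "hausdorff d (g ` (F ` E)) \<le> ennreal (LG ^ d) * hausdorff d (F ` E)"
        by (rule hausdorff_lipschitz_image_le[OF lipschitz_on_subset[OF g_lip subset_UNIV] LG])
      also have "\<dots> \<le> ennreal (LG ^ d) * (ennreal (3 ^ DIM('a) * (real DIM('a) * 4) ^ d * (2 * 2 ^ DIM('a))) * hausdorff d E)"
        by (rule mult_left_mono[OF FE]) simp
      also have "\<dots> = ennreal C * hausdorff d E"
      proof -
        have CE: "ennreal C = ennreal (LG ^ d) * ennreal (3 ^ DIM('a) * (real DIM('a) * 4) ^ d * (2 * 2 ^ DIM('a)))"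
          unfolding C_def by (rule ennreal_mult) (use LG in simp_all)
        show ?thesis unfolding CE by (rule mult.assoc[symmetric])
      qed
      finally show "hausdorff d (g ` (F ` E)) \<le> ennreal C * hausdorff d E" .
    qed
    finally show ?thesis by (simp only: E_def)
  qed
  show thesis
  proof (rule that[OF C])
    fix S :: real and \<phi> :: "'a \<Rightarrow> 'a"
    assume "R + 1 \<le> S" "\<phi> \<in> sliding_maps H"
    then show "(INF J\<in>sliding_class H K0. hausdorff d J)
         \<le> ennreal (\<Lambda> ^ d) * hausdorff d (\<phi> ` K0 \<inter> cball 0 S - nbhd \<delta> H)
           + ennreal C * hausdorff d (\<phi> ` K0 \<inter> (cball 0 (S + 5) - ball 0 S))"
      by (rule main)
  qed
qed


section \<open>Weak convergence and conservation of mass\<close>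

definition test_fun :: "'a::euclidean_space set \<Rightarrow> ('a \<Rightarrow> real) \<Rightarrow> bool" where
  "test_fun U f \<longleftrightarrow> continuous_on UNIV f \<and> compact (closure {x. f x \<noteq> 0}) \<and> closure {x. f x \<noteq> 0} \<subseteq> U
     \<and> (\<forall>x. 0 \<le> f x \<and> f x \<le> 1)"

lemma exists_test_fun:
  fixes C V :: "'a::euclidean_space set"
  assumes C: "compact C" "C \<subseteq> V" and V: "open V"
  obtains f where "test_fun V f" "\<And>x. x \<in> C \<Longrightarrow> f x = 1"
proof (cases "C = {}")
  case True
  have "test_fun V (\<lambda>_. 0)" by (simp add: test_fun_def)
  then show thesis using True by (intro that) auto
next
  case False
  obtain e where e: "0 < e" "{x. infdist x C \<le> e} \<subseteq> V"
    using compact_in_open_separated[OF False C(1) V C(2)] by blast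
  define f where "f = (\<lambda>x. clamp01 (2 - 2 / e * infdist x C))"
  have clC: "closed {x. infdist x C \<le> e}"
    by (intro closed_Collect_le continuous_intros)
  have sup: "closure {x. f x \<noteq> 0} \<subseteq> {x. infdist x C \<le> e}"
  proof (rule closure_minimal[OF _ clC], rule subsetI, rule ccontr)
    fix x assume x: "x \<in> {x. f x \<noteq> 0}" "x \<notin> {x. infdist x C \<le> e}"
    then have "e \<le> infdist x C" by simp
    then have "2 \<le> 2 / e * infdist x C" using e(1) by (simp add: field_simps)
    then show False using x(1) by (simp add: f_def clamp01_eq_0)
  qed
  have "test_fun V f"
    unfolding test_fun_def
  proof (intro conjI allI)
    have "continuous_on UNIV (\<lambda>x. 2 - 2 / e * infdist x C)" by (intro continuous_intros)
    then show "continuous_on UNIV f" unfolding f_def clamp01_def by (intro continuous_intros)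
    show "compact (closure {x. f x \<noteq> 0})"
      using compact_Int_closed[OF compact_infdist_le[OF False C(1) e(1)] closed_closure, of "{x. f x \<noteq> 0}"]
      by (simp only: Int_absorb1[OF sup])
    show "closure {x. f x \<noteq> 0} \<subseteq> V" using sup e(2) by (rule order_trans)
  qed (simp_all add: f_def clamp01_range)
  moreover have "f x = 1" if "x \<in> C" for x using that by (simp add: f_def clamp01_eq_1)
  ultimately show thesis by (rule that)
qed

lemma test_fun_integrable:
  assumes M: "radon_on U M" and f: "test_fun U f"
  shows "integrable M f"
proof -
  let ?C = "closure {x. f x \<noteq> 0}"
  have sM: "sets M = sets borel" using M by (simp add: radon_on_def)
  have "emeasure M ?C < \<infinity>" using M f by (auto simp: radon_on_def test_fun_def)
  then have i: "integrable M (indicator ?C :: _ \<Rightarrow> real)"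
    using sM by (intro integrable_real_indicator) auto
  have mf: "f \<in> borel_measurable M"
    using f measurable_cong_sets[OF sM refl] by (auto simp: test_fun_def intro: borel_measurable_continuous_onI)
  show ?thesis
  proof (rule Bochner_Integration.integrable_bound[OF i mf], rule AE_I2)
    fix x
    show "norm (f x) \<le> norm (indicator ?C x :: real)"
      using f closure_subset[of "{x. f x \<noteq> 0}"] by (cases "f x = 0") (auto simp: test_fun_def indicator_def)
  qed
qed

lemma emeasure_le_test_integral:
  assumes M: "radon_on U M" and f: "test_fun U f" and C: "C \<in> sets borel" "\<And>x. x \<in> C \<Longrightarrow> f x = 1"
  shows "emeasure M C \<le> ennreal (integral\<^sup>L M f)"
proof -
  have sM: "sets M = sets borel" using M by (simp add: radon_on_def)
  have f0: "0 \<le> f x" for x using f by (simp add: test_fun_def)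
  have "emeasure M C = (\<integral>\<^sup>+x. indicator C x \<partial>M)" using C(1) sM by simp
  also have "\<dots> \<le> (\<integral>\<^sup>+x. ennreal (f x) \<partial>M)"
    using C(2) by (intro nn_integral_mono) (auto simp: indicator_def)
  also have "\<dots> = ennreal (integral\<^sup>L M f)"
    using f0 by (intro nn_integral_eq_integral test_fun_integrable[OF M f]) auto
  finally show ?thesis .
qed

lemma test_integral_le_emeasure:
  assumes M: "radon_on U M" and f: "test_fun U f" and V: "V \<in> sets borel" "closure {x. f x \<noteq> 0} \<subseteq> V"
  shows "ennreal (integral\<^sup>L M f) \<le> emeasure M V"
proof -
  have sM: "sets M = sets borel" using M by (simp add: radon_on_def)
  have f0: "0 \<le> f x" and f1: "f x \<le> 1" for x using f by (simp_all add: test_fun_def)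
  have "ennreal (integral\<^sup>L M f) = (\<integral>\<^sup>+x. ennreal (f x) \<partial>M)"
    using f0 by (intro nn_integral_eq_integral[symmetric] test_fun_integrable[OF M f]) auto
  also have "\<dots> \<le> (\<integral>\<^sup>+x. indicator V x \<partial>M)"
  proof (rule nn_integral_mono)
    fix x
    show "ennreal (f x) \<le> indicator V x"
    proof (cases "f x = 0")
      case False
      then have "x \<in> V" using V(2) closure_subset[of "{x. f x \<noteq> 0}"] by blast
      then show ?thesis using f1[of x] by simp
    qed simp
  qed
  also have "\<dots> = emeasure M V" using V(1) sM by simp
  finally show ?thesis .
qed

lemma weak_star_compact_upper:
  assumes w: "weak_star_conv_on U M \<mu>" and C: "compact C" "C \<subseteq> V" and V: "open V" "V \<subseteq> U" and e: "0 < e"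
  shows "eventually (\<lambda>j. emeasure (M j) C \<le> emeasure \<mu> V + ennreal e) sequentially"
proof -
  obtain f where f: "test_fun V f" "\<And>x. x \<in> C \<Longrightarrow> f x = 1" using exists_test_fun[OF C V(1)] by metis
  have fU: "test_fun U f" using f(1) V(2) by (auto simp: test_fun_def)
  have r: "radon_on U (M j)" "radon_on U \<mu>" for j using w by (auto simp: weak_star_conv_on_def)
  have "(\<lambda>j. integral\<^sup>L (M j) f) \<longlonglongrightarrow> integral\<^sup>L \<mu> f"
    using w fU by (auto simp: weak_star_conv_on_def test_fun_def)
  then have ev: "eventually (\<lambda>j. integral\<^sup>L (M j) f < integral\<^sup>L \<mu> f + e) sequentially"
    by (rule order_tendstoD) (use e in simp)
  have nn: "0 \<le> integral\<^sup>L \<mu> f" using f(1) by (intro Bochner_Integration.integral_nonneg) (simp add: test_fun_def)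
  have le: "ennreal (integral\<^sup>L \<mu> f) \<le> emeasure \<mu> V"
    by (rule test_integral_le_emeasure[OF r(2) fU]) (use f(1) V(1) in \<open>auto simp: test_fun_def\<close>)
  show ?thesis
  proof (rule eventually_mono[OF ev])
    fix j assume j: "integral\<^sup>L (M j) f < integral\<^sup>L \<mu> f + e"
    have "emeasure (M j) C \<le> ennreal (integral\<^sup>L (M j) f)"
      by (rule emeasure_le_test_integral[OF r(1) fU]) (use f(2) C(1) in \<open>auto intro: borel_compact\<close>)
    also have "\<dots> \<le> ennreal (integral\<^sup>L \<mu> f + e)" using j by (intro ennreal_leI) simp
    also have "\<dots> = ennreal (integral\<^sup>L \<mu> f) + ennreal e" using nn e by simp
    also have "\<dots> \<le> emeasure \<mu> V + ennreal e" using le by (rule add_right_mono)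
    finally show "emeasure (M j) C \<le> emeasure \<mu> V + ennreal e" .
  qed
qed

lemma weak_star_open_lower:
  assumes w: "weak_star_conv_on U M \<mu>" and C: "compact C" "C \<subseteq> V" and V: "open V" "V \<subseteq> U" and e: "0 < e"
  shows "eventually (\<lambda>j. emeasure \<mu> C \<le> emeasure (M j) V + ennreal e) sequentially"
proof -
  obtain f where f: "test_fun V f" "\<And>x. x \<in> C \<Longrightarrow> f x = 1" using exists_test_fun[OF C V(1)] by metis
  have fU: "test_fun U f" using f(1) V(2) by (auto simp: test_fun_def)
  have r: "radon_on U (M j)" "radon_on U \<mu>" for j using w by (auto simp: weak_star_conv_on_def)
  have "(\<lambda>j. integral\<^sup>L (M j) f) \<longlonglongrightarrow> integral\<^sup>L \<mu> f"
    using w fU by (auto simp: weak_star_conv_on_def test_fun_def)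
  then have ev: "eventually (\<lambda>j. integral\<^sup>L \<mu> f - e < integral\<^sup>L (M j) f) sequentially"
    by (rule order_tendstoD) (use e in simp)
  have le: "emeasure \<mu> C \<le> ennreal (integral\<^sup>L \<mu> f)"
    by (rule emeasure_le_test_integral[OF r(2) fU]) (use f(2) C(1) in \<open>auto intro: borel_compact\<close>)
  show ?thesis
  proof (rule eventually_mono[OF ev])
    fix j assume j: "integral\<^sup>L \<mu> f - e < integral\<^sup>L (M j) f"
    have nn: "0 \<le> integral\<^sup>L (M j) f" using f(1) by (intro Bochner_Integration.integral_nonneg) (simp add: test_fun_def)
    note le
    also have "ennreal (integral\<^sup>L \<mu> f) \<le> ennreal (integral\<^sup>L (M j) f + e)" using j by (intro ennreal_leI) simp
    also have "\<dots> = ennreal (integral\<^sup>L (M j) f) + ennreal e" using nn e by simp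
    also have "\<dots> \<le> emeasure (M j) V + ennreal e"
      by (intro add_right_mono test_integral_le_emeasure[OF r(1) fU])
        (use f(1) V(1) in \<open>auto simp: test_fun_def\<close>)
    finally show "emeasure \<mu> C \<le> emeasure (M j) V + ennreal e" .
  qed
qed

lemma hausdorff_split_borel:
  fixes B :: "'a::euclidean_space set"
  assumes "B \<in> sets borel"
  shows "hausdorff d A = hausdorff d (A \<inter> B) + hausdorff d (A - B)"
proof -
  let ?M = "hausdorff_restrict d A"
  have "emeasure ?M UNIV = emeasure ?M B + emeasure ?M (- B)"
    using assms by (subst plus_emeasure) auto
  then show ?thesis using assms
    by (simp add: emeasure_hausdorff_restrict Int_commute Diff_eq)
qed

text \<open>
  The complement of \<open>H\<close> is exhausted by compact sets.
\<close>

lemma weak_star_lower_semicontinuous: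
  fixes H :: "'a::euclidean_space set"
  assumes w: "weak_star_conv_on (- H) (\<lambda>j. hausdorff_restrict d (A j)) \<mu>" and H: "closed H"
    and lim: "(\<lambda>j. hausdorff d (A j)) \<longlonglongrightarrow> m"
  shows "emeasure \<mu> (- H) \<le> m"
proof -
  define C where "C = (\<lambda>n::nat. cball (0::'a) (real n) - nbhd (1 / Suc n) H)"
  have comp: "compact (C n)" for n unfolding C_def by (intro compact_diff compact_cball open_nbhd)
  have sub: "C n \<subseteq> - H" for n by (force simp: C_def mem_nbhd_iff)
  have s\<mu>: "sets \<mu> = sets borel" using w by (simp add: weak_star_conv_on_def radon_on_def)
  have inc: "incseq C"
  proof (rule incseq_SucI)
    fix n
    have "1 / real (Suc (Suc n)) \<le> 1 / real (Suc n)" by (rule divide_left_mono) simp_all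
    then have "nbhd (1 / real (Suc (Suc n))) H \<subseteq> nbhd (1 / real (Suc n)) H"
      unfolding nbhd_def by (intro UN_mono subset_ball) simp_all
    moreover have "cball (0::'a) (real n) \<subseteq> cball 0 (real (Suc n))" by (rule subset_cball) simp
    ultimately show "C n \<le> C (Suc n)" unfolding C_def by (rule Diff_mono[rotated])
  qed
  have un: "(\<Union>n. C n) = - H"
  proof (intro antisym UN_least sub subsetI)
    fix x assume "x \<in> - H"
    then obtain e where e: "0 < e" "ball x e \<subseteq> - H" using H open_contains_ball[of "- H"] by auto
    obtain n1 :: nat where n1: "norm x \<le> real n1" using real_arch_simple by blast
    obtain n2 :: nat where n2: "1 / e \<le> real n2" using real_arch_simple by blast
    define n where "n = max n1 n2"
    have "1 / e \<le> real (Suc n)" using n2 by (simp add: n_def)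
    then have "1 / real (Suc n) \<le> e" using e(1) by (simp add: field_simps)
    then have "x \<notin> nbhd (1 / Suc n) H" using e(2) by (force simp: mem_nbhd_iff dist_commute)
    moreover have "norm x \<le> real n" using n1 by (simp add: n_def)
    ultimately have "x \<in> C n" by (simp add: C_def)
    then show "x \<in> (\<Union>n. C n)" by blast
  qed
  have "emeasure \<mu> (C n) \<le> m" for n
  proof (rule ennreal_le_epsilon)
    fix e :: real assume e: "0 < e"
    have "eventually (\<lambda>j. emeasure \<mu> (C n) \<le> emeasure (hausdorff_restrict d (A j)) (- H) + ennreal e) sequentially"
      by (rule weak_star_open_lower[OF w comp sub _ order_refl e]) (use H in auto)
    then have ev: "eventually (\<lambda>j. emeasure \<mu> (C n) \<le> hausdorff d (A j) + ennreal e) sequentially"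
    proof (rule eventually_mono)
      fix j assume "emeasure \<mu> (C n) \<le> emeasure (hausdorff_restrict d (A j)) (- H) + ennreal e"
      also have "\<dots> \<le> hausdorff d (A j) + ennreal e"
        using H by (intro add_right_mono) (auto simp: emeasure_hausdorff_restrict intro: hausdorff_mono)
      finally show "emeasure \<mu> (C n) \<le> hausdorff d (A j) + ennreal e" .
    qed
    have "(\<lambda>j. hausdorff d (A j) + ennreal e) \<longlonglongrightarrow> m + ennreal e"
      by (intro tendsto_add lim tendsto_const)
    then show "emeasure \<mu> (C n) \<le> m + ennreal e"
      by (rule tendsto_lowerbound[OF _ ev]) simp
  qed
  then have "(SUP n. emeasure \<mu> (C n)) \<le> m" by (rule SUP_least)
  moreover have "(SUP n. emeasure \<mu> (C n)) = emeasure \<mu> (\<Union>n. C n)"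
    using inc comp s\<mu> by (intro SUP_emeasure_incseq) (auto intro: borel_compact)
  ultimately show ?thesis by (simp add: un)
qed

lemma ennreal_limit_eventually_le:
  fixes a :: "nat \<Rightarrow> ennreal"
  assumes "a \<longlonglongrightarrow> m" "m < top" "0 < e"
  shows "eventually (\<lambda>j. a j \<le> m + ennreal e) sequentially"
proof -
  have "m < m + ennreal e"
    using assms(2,3) by (auto simp: ennreal_add_left_cancel_less[where b=0, simplified])
  then have "eventually (\<lambda>j. a j < m + ennreal e) sequentially" by (rule order_tendstoD(2)[OF assms(1)])
  then show ?thesis by (rule eventually_mono) (rule less_imp_le)
qed

text \<open>
  Otherwise the almost retraction would produce a set in the class with area below the infimum.
\<close>

lemma near_constraint_mass:
  fixes H K0 :: "'a::euclidean_space set"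
  assumes H: "hausdorff d H = 0"
    and retract: "\<forall>\<eta>>0. \<exists>\<delta>>0. \<exists>P\<in>sliding_maps H. (1 + \<eta>)-lipschitz_on UNIV P \<and> P ` nbhd \<delta> H \<subseteq> H"
    and A: "\<And>j. A j \<in> sliding_class H K0"
    and lim: "(\<lambda>j. hausdorff d (A j)) \<longlonglongrightarrow> (INF J\<in>sliding_class H K0. hausdorff d J)"
    and fin: "(INF J\<in>sliding_class H K0. hausdorff d J) < top" and e: "0 < e"
  obtains \<delta> where "0 < \<delta>" "eventually (\<lambda>j. hausdorff d (A j \<inter> nbhd \<delta> H) \<le> ennreal e) sequentially"
proof -
  define m where "m = (INF J\<in>sliding_class H K0. hausdorff d J)"
  define mr where "mr = enn2real m"
  have m: "m = ennreal mr" "0 \<le> mr" using fin by (auto simp: mr_def m_def less_top)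
  have "((\<lambda>\<eta>. mr - mr / (1 + \<eta>) ^ d) \<longlongrightarrow> mr - mr / (1 + 0) ^ d) (at_right 0)"
    by (intro tendsto_intros) simp
  then have "eventually (\<lambda>\<eta>. mr - mr / (1 + \<eta>) ^ d < e / 2) (at_right 0)"
    by (rule order_tendstoD) (use e in simp)
  then obtain b where b: "0 < b" "\<And>\<eta>. 0 < \<eta> \<Longrightarrow> \<eta> < b \<Longrightarrow> mr - mr / (1 + \<eta>) ^ d < e / 2"
    unfolding eventually_at_right_field by blast
  define \<eta> where "\<eta> = b / 2"
  have \<eta>: "0 < \<eta>" "mr - mr / (1 + \<eta>) ^ d < e / 2" using b(1) b(2)[of \<eta>] by (auto simp: \<eta>_def)
  obtain \<delta> P where P: "0 < \<delta>" "P \<in> sliding_maps H" "(1 + \<eta>)-lipschitz_on UNIV P" "P ` nbhd \<delta> H \<subseteq> H"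
    using retract \<eta>(1) by blast
  define q where "q = (1 + \<eta>) ^ d"
  have q: "0 < q" using \<eta>(1) by (simp add: q_def)
  have "eventually (\<lambda>j. hausdorff d (A j) \<le> m + ennreal (e / 2)) sequentially"
    using lim fin e unfolding m_def by (intro ennreal_limit_eventually_le) auto
  then have "eventually (\<lambda>j. hausdorff d (A j \<inter> nbhd \<delta> H) \<le> ennreal e) sequentially"
  proof (rule eventually_mono)
    fix j assume j: "hausdorff d (A j) \<le> m + ennreal (e / 2)"
    define x where "x = hausdorff d (A j \<inter> nbhd \<delta> H)"
    define y where "y = hausdorff d (A j - nbhd \<delta> H)"
    have xy: "hausdorff d (A j) = x + y"
      unfolding x_def y_def by (rule hausdorff_split_borel) (simp add: open_nbhd)
    have "m \<le> hausdorff d (P ` A j)"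
      unfolding m_def by (rule INF_lower) (rule sliding_class_image[OF P(2) A])
    also have "\<dots> \<le> hausdorff d (P ` (A j - nbhd \<delta> H) \<union> H)"
      using P(4) by (intro hausdorff_mono) blast
    also have "\<dots> \<le> hausdorff d (P ` (A j - nbhd \<delta> H))"
      using hausdorff_Un_le[of d "P ` (A j - nbhd \<delta> H)" H] H by simp
    also have "\<dots> \<le> ennreal q * y"
      unfolding y_def q_def using \<eta>(1)
      by (intro hausdorff_lipschitz_image_le[OF lipschitz_on_subset[OF P(3)]]) auto
    finally have my: "m \<le> ennreal q * y" .
    have fin_xy: "x + y < top" by (rule order_le_less_trans[OF j[unfolded xy m(1)]]) simp
    then obtain xr yr where r: "x = ennreal xr" "0 \<le> xr" "y = ennreal yr" "0 \<le> yr"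
      by (cases x; cases y) auto
    have "mr \<le> q * yr" using my m q r by (simp add: ennreal_mult[symmetric] ennreal_le_iff)
    then have "mr / q \<le> yr" using q by (simp add: pos_divide_le_eq mult.commute)
    moreover have "xr + yr \<le> mr + e / 2"
      using j m e r by (simp add: xy ennreal_plus[symmetric] ennreal_le_iff del: ennreal_plus)
    ultimately have "xr \<le> e" using \<eta>(2) unfolding q_def by argo
    then show "hausdorff d (A j \<inter> nbhd \<delta> H) \<le> ennreal e"
      using r by (simp add: x_def[symmetric] ennreal_leI)
  qed
  with P(1) show thesis by (rule that)
qed

text \<open>
  For given \<open>\<eta>\<close> the choices are made in the following order: the almost retraction \<open>P\<close> and with it the
  constant \<open>C\<close>; then a neighbourhood of \<open>H\<close> in which the sequence eventually has area at most
  \<open>\<eta> / C\<close>; then a radius beyond which \<open>\<mu>\<close> has mass at most \<open>\<eta> / C\<close>; finally an index.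
\<close>

lemma no_mass_loss:
  fixes H K0 :: "'a::euclidean_space set"
  assumes d: "1 \<le> d" and H: "closed H" "H \<noteq> {}" "hausdorff d H = 0"
    and K0: "bounded K0"
    and retract: "\<forall>\<eta>>0. \<exists>\<delta>>0. \<exists>P\<in>sliding_maps H. (1 + \<eta>)-lipschitz_on UNIV P \<and> P ` nbhd \<delta> H \<subseteq> H"
    and A: "\<And>j. A j \<in> sliding_class H K0"
    and lim: "(\<lambda>j. hausdorff d (A j)) \<longlonglongrightarrow> (INF J\<in>sliding_class H K0. hausdorff d J)"
    and fin: "(INF J\<in>sliding_class H K0. hausdorff d J) < top"
    and w: "weak_star_conv_on (- H) (\<lambda>j. hausdorff_restrict d (A j)) \<mu>"
  shows "(INF J\<in>sliding_class H K0. hausdorff d J) \<le> emeasure \<mu> (- H)"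
proof -
  define m where "m = (INF J\<in>sliding_class H K0. hausdorff d J)"
  have "emeasure \<mu> (- H) \<le> m" unfolding m_def by (rule weak_star_lower_semicontinuous[OF w H(1) lim])
  then have tfin: "emeasure \<mu> (- H) < top" using fin by (simp add: m_def order_le_less_trans)
  define tr where "tr = enn2real (emeasure \<mu> (- H))"
  define mr where "mr = enn2real m"
  have t: "emeasure \<mu> (- H) = ennreal tr" "0 \<le> tr" using tfin by (auto simp: tr_def less_top)
  have mm: "m = ennreal mr" "0 \<le> mr" using fin by (auto simp: mr_def m_def less_top)
  obtain R where R: "0 \<le> R" "K0 \<subseteq> cball 0 R"
  proof -
    obtain B where "\<forall>x\<in>K0. norm x \<le> B" using K0 by (auto simp: bounded_iff)
    then have "K0 \<subseteq> cball 0 (max B 0)" by force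
    then show thesis by (intro that[of "max B 0"]) auto
  qed
  have s\<mu>: "sets \<mu> = sets borel" using w by (simp add: weak_star_conv_on_def radon_on_def)
  have main: "mr \<le> (1 + \<eta>) ^ d * (tr + \<eta>) + 3 * \<eta>" if \<eta>: "0 < \<eta>" for \<eta>
  proof -
    obtain \<delta> P where P: "0 < \<delta>" "P \<in> sliding_maps H" "(1 + \<eta>)-lipschitz_on UNIV P" "P ` nbhd \<delta> H \<subseteq> H"
      using retract \<eta> by blast
    have \<eta>1: "0 < 1 + \<eta>" using \<eta> by simp
    obtain C where C: "0 < C" and area:
      "\<And>S \<phi>. R + 1 \<le> S \<Longrightarrow> \<phi> \<in> sliding_maps H \<Longrightarrow>
       (INF J\<in>sliding_class H K0. hausdorff d J)
         \<le> ennreal ((1 + \<eta>) ^ d) * hausdorff d (\<phi> ` K0 \<inter> cball 0 S - nbhd \<delta> H)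
           + ennreal C * hausdorff d (\<phi> ` K0 \<inter> (cball 0 (S + 5) - ball 0 S))"
      by (rule area_outside_shell[OF d H P(2,3) \<eta>1 P(4,1) R(2,1)]) (rule that)
    have eC: "0 < \<eta> / C" using \<eta> C by simp
    obtain \<delta>' where \<delta>': "0 < \<delta>'" "eventually (\<lambda>j. hausdorff d (A j \<inter> nbhd \<delta>' H) \<le> ennreal (\<eta> / C)) sequentially"
      by (rule near_constraint_mass[where A = A, OF H(3) retract A lim fin eC]) (rule that)
    define V where "V = (\<lambda>n::nat. - H - cball 0 (real n))"
    have Vopen: "open (V n)" for n using H(1) by (auto simp: V_def)
    have "(\<lambda>n. emeasure \<mu> (V n)) \<longlonglongrightarrow> emeasure \<mu> (\<Inter>n. V n)"
    proof (rule Lim_emeasure_decseq)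
      show "range V \<subseteq> sets \<mu>" using Vopen s\<mu> by auto
      show "decseq V"
        unfolding V_def by (rule antimonoI) (auto simp: subset_iff)
      show "emeasure \<mu> (V n) \<noteq> \<infinity>" for n
      proof -
        have "emeasure \<mu> (V n) \<le> emeasure \<mu> (- H)"
          using H(1) s\<mu> by (intro emeasure_mono) (auto simp: V_def)
        then show ?thesis using tfin by (auto simp: less_top[symmetric] top_unique)
      qed
    qed
    moreover have "(\<Inter>n. V n) = {}"
    proof -
      have "x \<notin> (\<Inter>n. V n)" for x
        using real_arch_simple[of "norm x"] by (auto simp: V_def)
      then show ?thesis by blast
    qed
    ultimately have "(\<lambda>n. emeasure \<mu> (V n)) \<longlonglongrightarrow> 0" by simp
    then have "eventually (\<lambda>n. emeasure \<mu> (V n) < ennreal (\<eta> / C)) sequentially"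
      by (rule order_tendstoD) (use eC in simp)
    then obtain n0 where n0: "\<And>n. n0 \<le> n \<Longrightarrow> emeasure \<mu> (V n) < ennreal (\<eta> / C)"
      unfolding eventually_sequentially by blast
    obtain n1 :: nat where n1: "R + 1 \<le> real n1" using real_arch_simple by blast
    define n where "n = max n0 n1"
    define S where "S = real n + 1"
    have S: "R + 1 \<le> S" using n1 by (simp add: S_def n_def)
    have Vn: "emeasure \<mu> (V n) \<le> ennreal (\<eta> / C)" using n0[of n] by (simp add: n_def)
    let ?C1 = "cball 0 S - nbhd \<delta> H" and ?sh = "cball 0 (S + 5) - ball (0::'a) S"
    have in_nbhd: "H \<subseteq> nbhd r H" if "0 < r" for r using that by (force simp: mem_nbhd_iff)
    have ev1: "eventually (\<lambda>j. emeasure (hausdorff_restrict d (A j)) ?C1 \<le> emeasure \<mu> (- H) + ennreal \<eta>) sequentially"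
    proof (rule weak_star_compact_upper[OF w _ _ _ order_refl \<eta>])
      show "compact ?C1" by (intro compact_diff compact_cball open_nbhd)
      show "?C1 \<subseteq> - H" using in_nbhd[OF P(1)] by blast
    qed (use H(1) in auto)
    have ev2: "eventually (\<lambda>j. emeasure (hausdorff_restrict d (A j)) (?sh - nbhd \<delta>' H) \<le> emeasure \<mu> (V n) + ennreal (\<eta> / C)) sequentially"
    proof (rule weak_star_compact_upper[OF w _ _ Vopen _ eC])
      show "compact (?sh - nbhd \<delta>' H)" by (intro compact_diff compact_cball open_nbhd open_ball)
      show "?sh - nbhd \<delta>' H \<subseteq> V n" using in_nbhd[OF \<delta>'(1)] by (auto simp: V_def S_def)
    qed (auto simp: V_def)
    obtain j where j: "hausdorff d (A j \<inter> nbhd \<delta>' H) \<le> ennreal (\<eta> / C)"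
      "emeasure (hausdorff_restrict d (A j)) ?C1 \<le> emeasure \<mu> (- H) + ennreal \<eta>"
      "emeasure (hausdorff_restrict d (A j)) (?sh - nbhd \<delta>' H) \<le> emeasure \<mu> (V n) + ennreal (\<eta> / C)"
      using eventually_happens'[OF _ eventually_conj[OF \<delta>'(2) eventually_conj[OF ev1 ev2]]] by auto
    obtain \<phi> where \<phi>: "\<phi> \<in> sliding_maps H" "A j = \<phi> ` K0" using A[of j] by (auto simp: sliding_class_def)
    have b1: "hausdorff d (A j \<inter> cball 0 S - nbhd \<delta> H) \<le> ennreal (tr + \<eta>)"
    proof -
      have "hausdorff d (A j \<inter> cball 0 S - nbhd \<delta> H) = emeasure (hausdorff_restrict d (A j)) ?C1"
        by (subst emeasure_hausdorff_restrict) (auto simp: open_nbhd intro!: arg_cong[where f="hausdorff d"])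
      then show ?thesis using j(2) t \<eta> by simp
    qed
    have b2: "hausdorff d (A j \<inter> ?sh) \<le> ennreal (3 * (\<eta> / C))"
    proof -
      have "hausdorff d (A j \<inter> ?sh) \<le> hausdorff d (A j \<inter> nbhd \<delta>' H \<union> (?sh - nbhd \<delta>' H) \<inter> A j)"
        by (rule hausdorff_mono) auto
      also have "\<dots> \<le> hausdorff d (A j \<inter> nbhd \<delta>' H) + hausdorff d ((?sh - nbhd \<delta>' H) \<inter> A j)"
        by (rule hausdorff_Un_le)
      also have "hausdorff d ((?sh - nbhd \<delta>' H) \<inter> A j) = emeasure (hausdorff_restrict d (A j)) (?sh - nbhd \<delta>' H)"
        by (subst emeasure_hausdorff_restrict) (auto simp: open_nbhd)
      also have "hausdorff d (A j \<inter> nbhd \<delta>' H) + \<dots> \<le> ennreal (\<eta> / C) + (ennreal (\<eta> / C) + ennreal (\<eta> / C))"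
        by (intro add_mono j(1) order_trans[OF j(3)] Vn) simp
      also have "\<dots> = ennreal (3 * (\<eta> / C))" using eC by (simp add: ennreal_plus[symmetric] del: ennreal_plus)
      finally show ?thesis .
    qed
    have "ennreal mr \<le> ennreal ((1 + \<eta>) ^ d) * hausdorff d (A j \<inter> cball 0 S - nbhd \<delta> H) + ennreal C * hausdorff d (A j \<inter> ?sh)"
      using area[OF S \<phi>(1)] mm(1) by (simp only: m_def \<phi>(2))
    also have "\<dots> \<le> ennreal ((1 + \<eta>) ^ d) * ennreal (tr + \<eta>) + ennreal C * ennreal (3 * (\<eta> / C))"
      by (intro add_mono mult_left_mono b1 b2) simp_all
    also have "\<dots> = ennreal ((1 + \<eta>) ^ d * (tr + \<eta>) + C * (3 * (\<eta> / C)))"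
    proof -
      have "0 \<le> (1 + \<eta>) ^ d" "0 \<le> tr + \<eta>" "0 \<le> C" "0 \<le> 3 * (\<eta> / C)" using C \<eta> t(2) by simp_all
      then show ?thesis by (simp only: ennreal_mult ennreal_plus mult_nonneg_nonneg)
    qed
    also have "C * (3 * (\<eta> / C)) = 3 * \<eta>" using C by simp
    finally show ?thesis
      using \<eta> t(2) by (subst (asm) ennreal_le_iff) simp_all
  qed
  have "((\<lambda>\<eta>. (1 + \<eta>) ^ d * (tr + \<eta>) + 3 * \<eta>) \<longlongrightarrow> (1 + 0) ^ d * (tr + 0) + 3 * 0) (at_right 0)"
    by (intro tendsto_intros)
  then have lim0: "((\<lambda>\<eta>. (1 + \<eta>) ^ d * (tr + \<eta>) + 3 * \<eta>) \<longlongrightarrow> tr) (at_right 0)" by simp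
  have "mr \<le> tr"
  proof (rule tendsto_lowerbound[OF lim0])
    show "eventually (\<lambda>\<eta>. mr \<le> (1 + \<eta>) ^ d * (tr + \<eta>) + 3 * \<eta>) (at_right 0)"
      by (rule eventually_mono[OF eventually_at_right_less]) (rule main)
  qed simp
  then show ?thesis using mm t by (simp add: m_def[symmetric] ennreal_leI)
qed


section \<open>Lipschitz retractions onto rectifiable sets\<close>

lemma C1_on_locally_lipschitz:
  fixes f :: "'a::euclidean_space \<Rightarrow> 'b::euclidean_space"
  assumes f: "C1_on U f" and U: "open U" "x \<in> U"
  obtains r L where "0 < r" "ball x r \<subseteq> U" "L-lipschitz_on (ball x r) f"
proof -
  obtain f' :: "'a \<Rightarrow> 'a \<Rightarrow>\<^sub>L 'b" where f': "\<And>x. x \<in> U \<Longrightarrow> (f has_derivative blinfun_apply (f' x)) (at x)"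
    "continuous_on U f'"
    using f unfolding C1_on_def by blast
  obtain r1 where r1: "0 < r1" "ball x r1 \<subseteq> U" using U open_contains_ball by blast
  have "\<exists>r2>0. \<forall>y\<in>U. dist y x < r2 \<longrightarrow> dist (f' y) (f' x) < 1"
    using f'(2) U(2) unfolding continuous_on_iff by (meson zero_less_one)
  then obtain r2 where r2: "0 < r2" "\<And>y. y \<in> U \<Longrightarrow> dist y x < r2 \<Longrightarrow> dist (f' y) (f' x) < 1" by blast
  define r where "r = min r1 r2"
  have sub: "ball x r \<subseteq> U" using r1(2) by (auto simp: r_def)
  have "(norm (f' x) + 1)-lipschitz_on (ball x r) f"
  proof (rule bounded_derivative_imp_lipschitz)
    fix y assume y: "y \<in> ball x r"
    then have yU: "y \<in> U" using sub by blast
    show "(f has_derivative blinfun_apply (f' y)) (at y within ball x r)"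
      by (rule has_derivative_at_withinI[OF f'(1)[OF yU]])
    have "dist (f' y) (f' x) < 1" using r2(2)[OF yU] y by (simp add: r_def dist_commute)
    then have "norm (f' y) \<le> norm (f' x) + 1"
      using norm_triangle_ineq2[of "f' y" "f' x"] by (simp add: dist_norm)
    then show "onorm (blinfun_apply (f' y)) \<le> norm (f' x) + 1" by (simp add: norm_blinfun.rep_eq)
  qed simp_all
  moreover have "0 < r" using r1 r2 by (simp add: r_def)
  ultimately show thesis using sub by (intro that)
qed

text \<open>
  An isometry carries a coordinate subspace to \<open>T\<close>.
\<close>

lemma hausdorff_subspace_ball_finite:
  fixes T :: "'a::euclidean_space set"
  assumes T: "subspace T" "dim T = d"
  shows "hausdorff d (T \<inter> ball w r) < top"
proof -
  have "d \<le> card (Basis :: 'a set)" using dim_subset_UNIV[of T] T(2) by simp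
  then obtain B where B: "B \<subseteq> (Basis :: 'a set)" "card B = d" by (meson obtain_subset_with_card_n)
  have "independent B" using independent_mono[OF independent_Basis B(1)] .
  then have "dim (span B) = d" using B(2) by (simp add: dim_eq_card_independent)
  then have dimeq: "dim (span B) = dim T" using T(2) by simp
  obtain f :: "'a \<Rightarrow> 'a" where f: "linear f" "f ` span B = T" "\<And>x. x \<in> span B \<Longrightarrow> norm (f x) = norm x"
  proof (rule isometries_subspaces[OF subspace_span T(1) dimeq])
    fix f g :: "'a \<Rightarrow> 'a"
    assume "linear f" "f ` span B = T" "\<And>x. x \<in> span B \<Longrightarrow> norm (f x) = norm x"
    then show thesis by (rule that)
  qed
  obtain n :: nat where n: "norm w + r \<le> real n" using real_arch_simple by blast
  let ?X = "span B \<inter> cball 0 (real n)"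
  have "hausdorff d ?X < top"
  proof (rule hausdorff_box_finite[OF B, where c = 0 and r = n])
    fix x i assume x: "x \<in> ?X"
    show "x \<bullet> i = 0 \<bullet> i" if "i \<in> Basis - B" using x that span_substd_basis[OF B(1)] by auto
    show "\<bar>x \<bullet> i\<bar> \<le> real n" if "i \<in> B"
    proof -
      have "\<bar>x \<bullet> i\<bar> \<le> norm x" using that B(1) by (intro Basis_le_norm) blast
      then show ?thesis using x by simp
    qed
  qed
  moreover have "1-lipschitz_on ?X f"
  proof (rule lipschitz_onI)
    fix x y assume "x \<in> ?X" "y \<in> ?X"
    then have "norm (f (x - y)) = norm (x - y)" by (intro f(3) span_diff) auto
    then show "dist (f x) (f y) \<le> 1 * dist x y" using linear_diff[OF f(1)] by (simp add: dist_norm)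
  qed simp
  then have "hausdorff d (f ` ?X) \<le> ennreal (1 ^ d) * hausdorff d ?X"
    by (rule hausdorff_lipschitz_image_le) simp
  moreover have "T \<inter> ball w r \<subseteq> f ` ?X"
  proof
    fix y assume y: "y \<in> T \<inter> ball w r"
    then have "y \<in> f ` span B" using f(2) by simp
    then obtain x where x: "x \<in> span B" "y = f x" by (elim imageE)
    have "norm y \<le> norm w + dist w y" using norm_triangle_sub[of y w] by (simp add: dist_norm norm_minus_commute)
    then have "norm x \<le> real n" using y n f(3)[OF x(1)] x(2) by simp
    then have "x \<in> ?X" using x(1) by simp
    then show "y \<in> f ` ?X" unfolding x(2) by (rule imageI)
  qed
  ultimately show ?thesis
    using hausdorff_mono[of "T \<inter> ball w r" "f ` ?X" d] by (simp add: order_le_less_trans)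
qed

text \<open>
  In a chart, project orthogonally to the linear subspace \<open>T\<close>.
\<close>

lemma C1_submanifold_local_retraction:
  fixes M W :: "'a::euclidean_space set"
  assumes M: "C1_submanifold d M" and z: "z \<in> M" and W: "open W" "z \<in> W"
  obtains r P L where "0 < r" "ball z r \<subseteq> W" "L-lipschitz_on (ball z r) P" "P ` ball z r \<subseteq> M"
    "\<And>x. x \<in> M \<inter> ball z r \<Longrightarrow> P x = x" "hausdorff d (M \<inter> ball z r) < top"
proof -
  obtain U V :: "'a set" and \<psi> \<psi>' T where c: "open U" "z \<in> U" "open V" "homeomorphism U V \<psi> \<psi>'"
    "C1_on U \<psi>" "C1_on V \<psi>'" "subspace T" "dim T = d" "\<psi> ` (M \<inter> U) = T \<inter> V"
    using M z unfolding C1_submanifold_def by metis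
  define w where "w = \<psi> z"
  have inv: "\<psi>' (\<psi> x) = x" if "x \<in> U" for x using homeomorphism_apply1[OF c(4) that] .
  have w: "w \<in> T" "w \<in> V" using c(2,9) z by (auto simp: w_def)
  obtain r2 L2 where r2: "0 < r2" "ball w r2 \<subseteq> V" "L2-lipschitz_on (ball w r2) \<psi>'"
    by (rule C1_on_locally_lipschitz[OF c(6,3) w(2)])
  obtain r1 L1 where r1: "0 < r1" "ball z r1 \<subseteq> U" "L1-lipschitz_on (ball z r1) \<psi>"
    by (rule C1_on_locally_lipschitz[OF c(5,1,2)])
  obtain r3 where r3: "0 < r3" "ball z r3 \<subseteq> W" using W open_contains_ball by blast
  have L1: "0 \<le> L1" by (rule lipschitz_on_nonneg[OF r1(3)])
  define r where "r = min (min r1 r3) (r2 / (L1 + 1))"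
  have r: "0 < r" using r1(1) r2(1) r3(1) L1 by (simp add: r_def)
  have rU: "ball z r \<subseteq> ball z r1" by (simp add: r_def subset_ball)
  have rW: "ball z r \<subseteq> W" using r3(2) by (auto simp: r_def)
  have \<psi>r: "\<psi> x \<in> ball w r2" if x: "x \<in> ball z r" for x
  proof -
    have "z \<in> ball z r1" using r1(1) by simp
    moreover have "x \<in> ball z r1" using x rU by blast
    ultimately have "dist w (\<psi> x) \<le> L1 * dist z x" unfolding w_def by (rule lipschitz_onD[OF r1(3)])
    also have "\<dots> \<le> (L1 + 1) * dist z x" by (rule mult_right_mono) simp_all
    also have "\<dots> < (L1 + 1) * (r2 / (L1 + 1))"
      using x L1 by (intro mult_strict_left_mono) (simp_all add: r_def)
    also have "\<dots> = r2" using L1 by simp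
    finally show ?thesis by simp
  qed
  have T: "convex T" "closed T" "T \<noteq> {}"
    using c(7) subspace_imp_convex closed_subspace w(1) by auto
  let ?\<pi> = "closest_point T"
  have \<pi>: "?\<pi> y \<in> T \<inter> ball w r2" if "y \<in> ball w r2" for y
  proof -
    have "dist (?\<pi> w) (?\<pi> y) \<le> dist w y" by (rule closest_point_lipschitz[OF T])
    then show ?thesis using that closest_point_self[OF w(1)] closest_point_in_set[OF T(2,3)] by auto
  qed
  define P where "P = (\<lambda>x. \<psi>' (?\<pi> (\<psi> x)))"
  have "1-lipschitz_on (\<psi> ` ball z r) ?\<pi>"
    by (rule lipschitz_onI) (simp_all add: closest_point_lipschitz[OF T])
  then have "(1 * L1)-lipschitz_on (ball z r) (\<lambda>x. ?\<pi> (\<psi> x))"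
    by (rule lipschitz_on_compose2[OF lipschitz_on_subset[OF r1(3) rU]])
  then have "(L2 * (1 * L1))-lipschitz_on (ball z r) P"
    unfolding P_def
    by (rule lipschitz_on_compose2[OF _ lipschitz_on_subset[OF r2(3)]]) (use \<psi>r \<pi> in blast)
  moreover have "P ` ball z r \<subseteq> M"
  proof (rule image_subsetI)
    fix x assume "x \<in> ball z r"
    then have "?\<pi> (\<psi> x) \<in> T \<inter> V" using \<pi>[OF \<psi>r] r2(2) by blast
    then obtain y where "y \<in> M \<inter> U" "?\<pi> (\<psi> x) = \<psi> y" unfolding c(9)[symmetric] by (elim imageE)
    then show "P x \<in> M" using inv by (simp add: P_def)
  qed
  moreover have fxd: "P x = x" "\<psi> x \<in> T" "x \<in> U" if x: "x \<in> M \<inter> ball z r" for x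
  proof -
    show xU: "x \<in> U" using x rU r1(2) by blast
    then have "\<psi> x \<in> T \<inter> V" using x c(9) by blast
    then show xT: "\<psi> x \<in> T" by simp
    show "P x = x" using closest_point_self[OF xT] inv[OF xU] by (simp add: P_def)
  qed
  moreover have "hausdorff d (M \<inter> ball z r) < top"
  proof -
    have "M \<inter> ball z r \<subseteq> \<psi>' ` (T \<inter> ball w r2)"
    proof
      fix x assume x: "x \<in> M \<inter> ball z r"
      have "\<psi> x \<in> T \<inter> ball w r2" using fxd(2)[OF x] \<psi>r x by blast
      then show "x \<in> \<psi>' ` (T \<inter> ball w r2)" by (rule image_eqI[rotated]) (simp add: inv fxd(3)[OF x])
    qed
    then have "hausdorff d (M \<inter> ball z r) \<le> hausdorff d (\<psi>' ` (T \<inter> ball w r2))" by (rule hausdorff_mono)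
    also have "(L2 + 1)-lipschitz_on (T \<inter> ball w r2) \<psi>'"
      by (rule lipschitz_on_mono[OF r2(3)]) auto
    then have "hausdorff d (\<psi>' ` (T \<inter> ball w r2)) \<le> ennreal ((L2 + 1) ^ d) * hausdorff d (T \<inter> ball w r2)"
      using lipschitz_on_nonneg[OF r2(3)] by (intro hausdorff_lipschitz_image_le) auto
    also have "\<dots> < top"
      using hausdorff_subspace_ball_finite[OF c(7,8)] by (simp add: ennreal_mult_less_top)
    finally show ?thesis .
  qed
  ultimately show thesis using r rW by (intro that)
qed

lemma mem_nbhd_infdist:
  assumes "K \<noteq> {}" shows "x \<in> nbhd s K \<longleftrightarrow> infdist x K < s"
proof -
  have "infdist x K < s \<longleftrightarrow> (\<exists>k\<in>K. dist x k < s)"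
    using assms by (simp add: infdist_notempty cINF_less_iff)
  then show ?thesis by (simp add: mem_nbhd_iff dist_commute)
qed

lemma nbhd_mono: "s \<le> t \<Longrightarrow> nbhd s K \<subseteq> nbhd t K"
  unfolding nbhd_def by (intro UN_mono subset_ball order_refl)

lemma subset_nbhd: "0 < s \<Longrightarrow> K \<subseteq> nbhd s K"
  by (force simp: mem_nbhd_iff)

lemma emeasure_nbhd_shrinks:
  fixes K :: "'a::euclidean_space set"
  assumes K: "compact K" and M: "sets M = sets borel" "emeasure M UNIV < top" and e: "0 < e"
  obtains s where "0 < s" "emeasure M (nbhd s K - K) < ennreal e"
proof -
  define D where "D = (\<lambda>n::nat. nbhd (1 / real (Suc n)) K - K)"
  have cK: "closed K" by (rule compact_imp_closed[OF K])
  have sD: "D n \<in> sets M" for n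
    unfolding M(1) D_def by (intro sets.Diff borel_open borel_closed open_nbhd cK)
  have "(\<lambda>n. emeasure M (D n)) \<longlonglongrightarrow> emeasure M (\<Inter>n. D n)"
  proof (rule Lim_emeasure_decseq)
    show "range D \<subseteq> sets M" using sD by blast
    show "decseq D"
    proof (rule decseq_SucI)
      fix n
      have "1 / real (Suc (Suc n)) \<le> 1 / real (Suc n)" by (rule divide_left_mono) simp_all
      then show "D (Suc n) \<le> D n" unfolding D_def by (intro Diff_mono nbhd_mono order_refl)
    qed
    show "emeasure M (D n) \<noteq> \<infinity>" for n
      using emeasure_mono[of "D n" UNIV M] M by (auto simp: top_unique)
  qed
  moreover have "(\<Inter>n. D n) = {}"
  proof (rule equals0I)
    fix x assume x: "x \<in> (\<Inter>n. D n)"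
    then have "x \<in> D n" for n by blast
    then have xK: "x \<notin> K" and xn: "\<And>n. x \<in> nbhd (1 / real (Suc n)) K" by (auto simp: D_def)
    then have ne: "K \<noteq> {}" using xn[of 0] by (auto simp: nbhd_def)
    have "infdist x K > 0"
      using in_closed_iff_infdist_zero[OF cK ne, of x] infdist_nonneg[of x K] xK by linarith
    then obtain n where "inverse (real (Suc n)) < infdist x K" using reals_Archimedean by blast
    moreover have "infdist x K < 1 / real (Suc n)" using xn[of n] mem_nbhd_infdist[OF ne] by blast
    ultimately show False by (simp add: inverse_eq_divide)
  qed
  ultimately have "(\<lambda>n. emeasure M (D n)) \<longlonglongrightarrow> 0" by simp
  then have "eventually (\<lambda>n. emeasure M (D n) < ennreal e) sequentially"
    by (rule order_tendstoD) (use e in simp)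
  then obtain n where "emeasure M (D n) < ennreal e" by (auto simp: eventually_sequentially)
  then show thesis by (intro that[of "1 / real (Suc n)"]) (simp_all add: D_def)
qed

text \<open>
  Some neighbourhood of the compact set \<open>K\<close> is mapped by a Lipschitz map fixing \<open>K\<close> into a set that, close to
  \<open>K\<close>, is hardly larger than \<open>K\<close> as measured by \<open>d\<close>-dimensional area.
\<close>

definition retractable :: "nat \<Rightarrow> 'a::euclidean_space set \<Rightarrow> bool" where
  "retractable d K \<longleftrightarrow> compact K \<and>
     (\<exists>\<sigma>>0. \<exists>p. \<exists>L. L-lipschitz_on (nbhd \<sigma> K) p \<and> (\<forall>x\<in>K. p x = x) \<and>
       (\<forall>e>0. \<exists>s>0. hausdorff d (p ` nbhd s K - K) < ennreal e))"

lemma retractable_empty: "retractable d ({} :: 'a::euclidean_space set)"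
proof -
  have nb: "nbhd s {} = ({} :: 'a set)" for s by (simp add: nbhd_def)
  have "\<forall>e>0. \<exists>s>0::real. hausdorff d ((\<lambda>x. x) ` nbhd s {} - ({} :: 'a set)) < ennreal e"
    unfolding nb by (auto intro: exI[of _ "1::real"])
  moreover have "0-lipschitz_on (nbhd 1 {}) (\<lambda>x::'a. x)" unfolding nb by simp
  ultimately show ?thesis
    unfolding retractable_def by (intro conjI compact_empty exI[of _ 1]) (auto simp: nb)
qed

text \<open>
  The image of \<open>nbhd s K\<close> lies in the part of \<open>M\<close> close to \<open>K\<close>; this set decreases to \<open>K\<close> and has
  finite area.
\<close>

lemma retractable_chart:
  fixes M :: "'a::euclidean_space set"
  assumes P: "L-lipschitz_on (ball z r) P" "P ` ball z r \<subseteq> M" "\<And>x. x \<in> M \<inter> ball z r \<Longrightarrow> P x = x"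
    "hausdorff d (M \<inter> ball z r) < top"
    and K: "compact K" "K \<subseteq> M \<inter> ball z r"
  shows "retractable d K"
proof -
  obtain \<sigma> where \<sigma>: "0 < \<sigma>" "(\<Union>x\<in>K. ball x \<sigma>) \<subseteq> ball z r"
    using compact_subset_open_imp_ball_epsilon_subset[OF K(1) open_ball, of z r] K(2) by (metis le_inf_iff)
  have n\<sigma>: "nbhd \<sigma> K \<subseteq> ball z r" using \<sigma>(2) by (simp add: nbhd_def)
  have L: "0 \<le> L" by (rule lipschitz_on_nonneg[OF P(1)])
  let ?N = "hausdorff_restrict d (M \<inter> ball z r)"
  have "\<exists>s>0. hausdorff d (P ` nbhd s K - K) < ennreal e" if e: "0 < e" for e
  proof -
    have finN: "emeasure ?N UNIV < top" using P(4) by (simp add: emeasure_hausdorff_restrict)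
    obtain s1 where s1: "0 < s1" "emeasure ?N (nbhd s1 K - K) < ennreal e"
      by (rule emeasure_nbhd_shrinks[OF K(1) sets_hausdorff_restrict finN e])
    define s where "s = min \<sigma> s1 / (L + 1)"
    have s: "0 < s" using \<sigma>(1) s1(1) L by (simp add: s_def)
    have Ls: "(L + 1) * s = min \<sigma> s1" using L by (simp add: s_def)
    have "s * 1 \<le> s * (L + 1)" using s L by (intro mult_left_mono) auto
    then have s\<sigma>: "s \<le> \<sigma>" using Ls by (simp add: mult.commute)
    have "P ` nbhd s K - K \<subseteq> (nbhd s1 K - K) \<inter> (M \<inter> ball z r)"
    proof
      fix y assume y: "y \<in> P ` nbhd s K - K"
      then obtain x where x: "x \<in> nbhd s K" "y = P x" by blast
      then obtain k where k: "k \<in> K" "dist k x < s" by (auto simp: mem_nbhd_iff)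
      have xb: "x \<in> ball z r" using x(1) nbhd_mono[OF s\<sigma>] n\<sigma> by blast
      have kb: "k \<in> M \<inter> ball z r" using k(1) K(2) by blast
      have "dist k (P x) = dist (P k) (P x)" using P(3)[OF kb] by simp
      also have "\<dots> \<le> L * dist k x" by (rule lipschitz_onD[OF P(1) _ xb]) (use kb in blast)
      also have "\<dots> \<le> L * s" using k(2) L by (intro mult_left_mono) auto
      also have "\<dots> < (L + 1) * s" using s by (simp add: algebra_simps)
      finally have "dist k y < min \<sigma> s1" by (simp add: Ls x(2))
      then have "y \<in> nbhd s1 K" "y \<in> nbhd \<sigma> K" using k(1) by (auto simp: mem_nbhd_iff)
      moreover have "y \<in> M" using P(2) xb x(2) by blast
      ultimately show "y \<in> (nbhd s1 K - K) \<inter> (M \<inter> ball z r)" using y n\<sigma> by blast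
    qed
    then have "hausdorff d (P ` nbhd s K - K) \<le> hausdorff d ((nbhd s1 K - K) \<inter> (M \<inter> ball z r))"
      by (rule hausdorff_mono)
    also have "\<dots> = emeasure ?N (nbhd s1 K - K)"
      using compact_imp_closed[OF K(1)] by (subst emeasure_hausdorff_restrict) (auto simp: open_nbhd)
    also have "\<dots> < ennreal e" by (rule s1(2))
    finally show ?thesis using s by blast
  qed
  moreover have "L-lipschitz_on (nbhd \<sigma> K) P" by (rule lipschitz_on_subset[OF P(1) n\<sigma>])
  moreover have "\<forall>x\<in>K. P x = x" using P(3) K(2) by blast
  ultimately show ?thesis unfolding retractable_def using K(1) \<sigma>(1) by metis
qed

text \<open>
  Disjoint compact sets have a positive distance, so the two maps can be used side by side.
\<close>

lemma retractable_Un: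
  fixes A B :: "'a::euclidean_space set"
  assumes A: "retractable d A" and B: "retractable d B" and disj: "A \<inter> B = {}"
  shows "retractable d (A \<union> B)"
proof -
  obtain \<sigma>A pA LA where A': "compact A" "0 < \<sigma>A" "LA-lipschitz_on (nbhd \<sigma>A A) pA" "\<And>x. x \<in> A \<Longrightarrow> pA x = x"
    "\<And>e. 0 < e \<Longrightarrow> \<exists>s>0. hausdorff d (pA ` nbhd s A - A) < ennreal e"
    using A unfolding retractable_def by blast
  obtain \<sigma>B pB LB where B': "compact B" "0 < \<sigma>B" "LB-lipschitz_on (nbhd \<sigma>B B) pB" "\<And>x. x \<in> B \<Longrightarrow> pB x = x"
    "\<And>e. 0 < e \<Longrightarrow> \<exists>s>0. hausdorff d (pB ` nbhd s B - B) < ennreal e"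
    using B unfolding retractable_def by blast
  obtain g where g: "0 < g" "\<And>a b. a \<in> A \<Longrightarrow> b \<in> B \<Longrightarrow> g \<le> dist a b"
    using separate_compact_closed[OF A'(1) compact_imp_closed[OF B'(1)] disj] by blast
  \<comment> \<open>A third of the gap: points near \<open>A\<close> and points near \<open>B\<close> are then at least \<open>\<sigma>\<close> apart.\<close>
  define \<sigma> where "\<sigma> = min (min \<sigma>A \<sigma>B) (g / 3)"
  have \<sigma>: "0 < \<sigma>" "\<sigma> \<le> \<sigma>A" "\<sigma> \<le> \<sigma>B" "3 * \<sigma> \<le> g" using A'(2) B'(2) g(1) by (auto simp: \<sigma>_def)
  have LA: "0 \<le> LA" and LB: "0 \<le> LB"
    using lipschitz_on_nonneg[OF A'(3)] lipschitz_on_nonneg[OF B'(3)] by auto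
  have far: "\<sigma> \<le> dist x y \<and> dist (pA x) (pB y) \<le> (LA + LB + 3) * dist x y"
    if x: "x \<in> nbhd \<sigma> A" and y: "y \<in> nbhd \<sigma> B" for x y
  proof -
    obtain a b where a: "a \<in> A" "dist a x < \<sigma>" and b: "b \<in> B" "dist b y < \<sigma>"
      using x y by (auto simp: mem_nbhd_iff)
    have "dist a b \<le> dist a x + dist x y + dist b y"
      using dist_triangle[of a b x] dist_triangle[of x b y] by (simp add: dist_commute)
    then have s: "\<sigma> \<le> dist x y" using g(2)[OF a(1) b(1)] a(2) b(2) \<sigma>(4) by linarith
    have xa: "x \<in> nbhd \<sigma>A A" "a \<in> nbhd \<sigma>A A"
      using x nbhd_mono[OF \<sigma>(2)] subset_nbhd[OF A'(2)] a(1) by blast+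
    have yb: "y \<in> nbhd \<sigma>B B" "b \<in> nbhd \<sigma>B B"
      using y nbhd_mono[OF \<sigma>(3)] subset_nbhd[OF B'(2)] b(1) by blast+
    have "dist (pA x) a \<le> LA * dist x a" using lipschitz_onD[OF A'(3) xa] A'(4)[OF a(1)] by simp
    also have "\<dots> \<le> LA * dist x y" using LA a(2) s by (intro mult_left_mono) (auto simp: dist_commute)
    finally have 1: "dist (pA x) a \<le> LA * dist x y" .
    have "dist (pB y) b \<le> LB * dist y b" using lipschitz_onD[OF B'(3) yb] B'(4)[OF b(1)] by simp
    also have "\<dots> \<le> LB * dist x y" using LB b(2) s by (intro mult_left_mono) (auto simp: dist_commute)
    finally have 2: "dist (pB y) b \<le> LB * dist x y" .
    have "dist (pA x) (pB y) \<le> dist (pA x) a + dist a b + dist (pB y) b"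
      using dist_triangle[of "pA x" "pB y" a] dist_triangle[of a "pB y" b] by (simp add: dist_commute)
    also have "\<dots> \<le> LA * dist x y + 3 * dist x y + LB * dist x y"
      using 1 2 \<open>dist a b \<le> dist a x + dist x y + dist b y\<close> a(2) b(2) s by linarith
    also have "\<dots> = (LA + LB + 3) * dist x y" by (simp add: algebra_simps)
    finally show ?thesis using s by blast
  qed
  have notA: "y \<notin> nbhd \<sigma> A" if "y \<in> nbhd \<sigma> B" for y using far[OF _ that, of y] \<sigma>(1) by force
  define p where "p = (\<lambda>x. if x \<in> nbhd \<sigma> A then pA x else pB x)"
  have un: "nbhd s (A \<union> B) = nbhd s A \<union> nbhd s B" for s by (simp add: nbhd_def)
  have "(LA + LB + 3)-lipschitz_on (nbhd \<sigma> (A \<union> B)) p"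
  proof (rule lipschitz_onI)
    fix x y assume xy: "x \<in> nbhd \<sigma> (A \<union> B)" "y \<in> nbhd \<sigma> (A \<union> B)"
    have LLA: "LA * dist x y \<le> (LA + LB + 3) * dist x y" and LLB: "LB * dist x y \<le> (LA + LB + 3) * dist x y"
      using LA LB by (auto intro: mult_right_mono)
    consider "x \<in> nbhd \<sigma> A" "y \<in> nbhd \<sigma> A" | "x \<in> nbhd \<sigma> A" "y \<in> nbhd \<sigma> B"
      | "x \<in> nbhd \<sigma> B" "y \<in> nbhd \<sigma> A" | "x \<in> nbhd \<sigma> B" "y \<in> nbhd \<sigma> B"
      using xy by (auto simp: un)
    then show "dist (p x) (p y) \<le> (LA + LB + 3) * dist x y"
    proof cases
      case 1
      then have "x \<in> nbhd \<sigma>A A" "y \<in> nbhd \<sigma>A A" using nbhd_mono[OF \<sigma>(2)] by blast+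
      then show ?thesis using order_trans[OF lipschitz_onD[OF A'(3)] LLA] 1 by (simp add: p_def)
    next
      case 2
      then show ?thesis using far[of x y] notA by (simp add: p_def)
    next
      case 3
      then show ?thesis using far[of y x] notA by (simp add: p_def dist_commute)
    next
      case 4
      then have "x \<in> nbhd \<sigma>B B" "y \<in> nbhd \<sigma>B B" using nbhd_mono[OF \<sigma>(3)] by blast+
      then show ?thesis using order_trans[OF lipschitz_onD[OF B'(3)] LLB] 4 notA by (simp add: p_def)
    qed
  qed (use LA LB in simp)
  moreover have "\<forall>x\<in>A \<union> B. p x = x"
    using A'(4) B'(4) subset_nbhd[OF \<sigma>(1), of A] subset_nbhd[OF \<sigma>(1), of B] notA
    by (auto simp: p_def)
  moreover have "\<exists>s>0. hausdorff d (p ` nbhd s (A \<union> B) - (A \<union> B)) < ennreal e" if e: "0 < e" for e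
  proof -
    have e2: "0 < e / 2" using e by simp
    obtain sA where sA: "0 < sA" "hausdorff d (pA ` nbhd sA A - A) < ennreal (e / 2)" using A'(5)[OF e2] by blast
    obtain sB where sB: "0 < sB" "hausdorff d (pB ` nbhd sB B - B) < ennreal (e / 2)" using B'(5)[OF e2] by blast
    define s where "s = min \<sigma> (min sA sB)"
    have s: "0 < s" "s \<le> \<sigma>" "s \<le> sA" "s \<le> sB" using \<sigma>(1) sA(1) sB(1) by (auto simp: s_def)
    have "p ` nbhd s (A \<union> B) - (A \<union> B) \<subseteq> (pA ` nbhd sA A - A) \<union> (pB ` nbhd sB B - B)"
    proof
      fix y assume y: "y \<in> p ` nbhd s (A \<union> B) - (A \<union> B)"
      then obtain x where x: "x \<in> nbhd s A \<or> x \<in> nbhd s B" "y = p x" by (auto simp: un)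
      show "y \<in> (pA ` nbhd sA A - A) \<union> (pB ` nbhd sB B - B)"
      proof (cases "x \<in> nbhd s A")
        case True
        then have "x \<in> nbhd \<sigma> A" "x \<in> nbhd sA A" using nbhd_mono[OF s(2)] nbhd_mono[OF s(3)] by blast+
        then show ?thesis using y x(2) by (auto simp: p_def)
      next
        case False
        then have "x \<in> nbhd \<sigma> B" "x \<in> nbhd sB B" using x(1) nbhd_mono[OF s(2)] nbhd_mono[OF s(4)] by blast+
        then show ?thesis using y x(2) notA by (auto simp: p_def)
      qed
    qed
    then have "hausdorff d (p ` nbhd s (A \<union> B) - (A \<union> B))
        \<le> hausdorff d (pA ` nbhd sA A - A) + hausdorff d (pB ` nbhd sB B - B)"
      by (rule order_trans[OF hausdorff_mono hausdorff_Un_le])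
    also have "\<dots> < ennreal (e / 2) + ennreal (e / 2)" by (rule add_strict_mono[OF sA(2) sB(2)])
    also have "\<dots> = ennreal e" using e by (simp add: ennreal_plus[symmetric] del: ennreal_plus)
    finally show ?thesis using s(1) by blast
  qed
  ultimately show ?thesis unfolding retractable_def
    using compact_Un[OF A'(1) B'(1)] \<sigma>(1) by metis
qed

lemma retractable_UN:
  assumes "finite I" "\<And>i. i \<in> I \<Longrightarrow> retractable d (C i)" "disjoint_family_on C I"
  shows "retractable d (\<Union>i\<in>I. C i)"
  using assms
proof (induction rule: finite_induct)
  case (insert i I)
  have "C i \<inter> C k = {}" if k: "k \<in> I" for k
  proof -
    have "i \<noteq> k" using k insert.hyps(2) by metis
    then show ?thesis using disjoint_family_onD[OF insert.prems(2), of i k] k by simp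
  qed
  then have "C i \<inter> (\<Union>k\<in>I. C k) = {}" by blast
  moreover have "disjoint_family_on C I"
    using insert.prems(2) unfolding disjoint_family_on_def by simp
  then have "retractable d (\<Union>k\<in>I. C k)"
    by (intro insert.IH) (simp_all add: insert.prems(1))
  moreover have "retractable d (C i)" by (rule insert.prems(1)) simp
  ultimately have "retractable d (C i \<union> (\<Union>k\<in>I. C k))"
    by (intro retractable_Un)
  then show ?case by simp
qed (simp add: retractable_empty)

text \<open>
  The parts of \<open>M\<close> in chart balls are Borel sets, being the fixed points of a retraction; countably many
  of them suffice by the Lindelof property.
\<close>

lemma C1_submanifold_chart_cover:
  fixes M W :: "'a::euclidean_space set"
  assumes M: "C1_submanifold d M" and W: "open W"
  obtains \<G> where "countable \<G>" "M \<inter> W \<subseteq> \<Union>\<G>"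
    "\<And>G. G \<in> \<G> \<Longrightarrow> G \<in> sets borel"
    "\<And>G C. G \<in> \<G> \<Longrightarrow> compact C \<Longrightarrow> C \<subseteq> G \<Longrightarrow> retractable d C"
proof -
  have "\<exists>r P L. 0 < r \<and> L-lipschitz_on (ball z r) P \<and> P ` ball z r \<subseteq> M
      \<and> (\<forall>x\<in>M \<inter> ball z r. P x = x) \<and> hausdorff d (M \<inter> ball z r) < top" if "z \<in> M \<inter> W" for z
  proof -
    have z: "z \<in> M" "z \<in> W" using that by auto
    show ?thesis
    proof (rule C1_submanifold_local_retraction[OF M z(1) W z(2)])
      fix r P L
      assume "0 < r" "L-lipschitz_on (ball z r) P" "P ` ball z r \<subseteq> M"
        "\<And>x. x \<in> M \<inter> ball z r \<Longrightarrow> P x = x" "hausdorff d (M \<inter> ball z r) < top"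
      then show ?thesis by (intro exI[of _ r] exI[of _ P] exI[of _ L] conjI ballI)
    qed
  qed
  then obtain r P L where c: "\<And>z. z \<in> M \<inter> W \<Longrightarrow> 0 < r z \<and> (L z)-lipschitz_on (ball z (r z)) (P z)
      \<and> P z ` ball z (r z) \<subseteq> M \<and> (\<forall>x\<in>M \<inter> ball z (r z). P z x = x) \<and> hausdorff d (M \<inter> ball z (r z)) < top"
    by metis
  have op: "S \<in> (\<lambda>z. ball z (r z)) ` (M \<inter> W) \<Longrightarrow> open S" for S by (elim imageE) simp
  obtain \<F> where \<F>: "\<F> \<subseteq> (\<lambda>z. ball z (r z)) ` (M \<inter> W)" "countable \<F>"
      "\<Union>\<F> = \<Union>((\<lambda>z. ball z (r z)) ` (M \<inter> W))"
    by (rule Lindelof[OF op])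
  have "\<exists>Z. countable Z \<and> Z \<subseteq> M \<inter> W \<and> \<F> = (\<lambda>z. ball z (r z)) ` Z"
    using \<F>(1,2) countable_subset_image[of \<F> "\<lambda>z. ball z (r z)" "M \<inter> W"] by simp
  then obtain Z where Z: "countable Z" "Z \<subseteq> M \<inter> W" "\<F> = (\<lambda>z. ball z (r z)) ` Z"
    by (elim exE conjE)
  show thesis
  proof (rule that[of "(\<lambda>z. M \<inter> ball z (r z)) ` Z"])
    show "countable ((\<lambda>z. M \<inter> ball z (r z)) ` Z)" using Z(1) by simp
    show "M \<inter> W \<subseteq> \<Union>((\<lambda>z. M \<inter> ball z (r z)) ` Z)"
    proof
      fix x assume x: "x \<in> M \<inter> W"
      then have "x \<in> ball x (r x)" using c[OF x] by simp
      then have "x \<in> \<Union>\<F>" unfolding \<F>(3) using x by (rule UN_I[rotated])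
      then show "x \<in> \<Union>((\<lambda>z. M \<inter> ball z (r z)) ` Z)" using x Z(3) by auto
    qed
    fix G assume "G \<in> (\<lambda>z. M \<inter> ball z (r z)) ` Z"
    then obtain z where z: "z \<in> M \<inter> W" "G = M \<inter> ball z (r z)" using Z(2) by blast
    note cz = c[OF z(1)]
    have eq: "G = {x \<in> ball z (r z). P z x - x = 0}" using cz z(2) by force
    have "continuous_on (ball z (r z)) (\<lambda>x. P z x - x)"
      using cz by (intro continuous_intros) (auto intro: lipschitz_on_continuous_on)
    then have "closedin (top_of_set (ball z (r z))) G"
      unfolding eq by (rule continuous_closedin_preimage_constant)
    then obtain T where "closed T" "G = ball z (r z) \<inter> T" unfolding closedin_closed by blast
    then show "G \<in> sets borel" by auto
    show "retractable d C" if "compact C" "C \<subseteq> G" for C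
      using cz that z(2) by (intro retractable_chart[of "L z" z "r z" "P z" M d C]) auto
  qed
qed

text \<open>
  The chart pieces are made disjoint, all but finitely many are dropped, and the remaining ones are
  replaced by compact subsets.
\<close>

lemma rectifiable_retractable_approx:
  fixes K W :: "'a::euclidean_space set"
  assumes K: "rectifiable d K" "K \<in> sets borel" "K \<subseteq> W" "open W" "hausdorff d K < top" and e: "0 < e"
  obtains C where "C \<subseteq> K" "retractable d C" "hausdorff d (K - C) \<le> ennreal e"
proof -
  obtain M :: "nat \<Rightarrow> 'a set" where M: "\<And>i. C1_submanifold d (M i)" "hausdorff d (K - (\<Union>i. M i)) = 0"
    using K(1) unfolding rectifiable_def by (elim exE conjE) (rule that, simp_all)
  have "\<exists>\<G>. countable \<G> \<and> M i \<inter> W \<subseteq> \<Union>\<G> \<and> (\<forall>G\<in>\<G>. G \<in> sets borel) \<and>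
      (\<forall>G\<in>\<G>. \<forall>C. compact C \<longrightarrow> C \<subseteq> G \<longrightarrow> retractable d C)" for i
  proof (rule C1_submanifold_chart_cover[OF M(1)[of i] K(4)])
    fix \<G> :: "'a set set"
    assume "countable \<G>" "M i \<inter> W \<subseteq> \<Union>\<G>" "\<And>G. G \<in> \<G> \<Longrightarrow> G \<in> sets borel"
      "\<And>G C. G \<in> \<G> \<Longrightarrow> compact C \<Longrightarrow> C \<subseteq> G \<Longrightarrow> retractable d C"
    then show ?thesis by (intro exI[of _ \<G>] conjI ballI allI impI)
  qed
  then have "\<forall>i. \<exists>\<G>. countable \<G> \<and> M i \<inter> W \<subseteq> \<Union>\<G> \<and> (\<forall>G\<in>\<G>. G \<in> sets borel) \<and>
      (\<forall>G\<in>\<G>. \<forall>C. compact C \<longrightarrow> C \<subseteq> G \<longrightarrow> retractable d C)" by (rule allI)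
  from choice[OF this] obtain \<G> where \<G>': "\<forall>i. countable (\<G> i) \<and> M i \<inter> W \<subseteq> \<Union>(\<G> i) \<and>
      (\<forall>G\<in>\<G> i. G \<in> sets borel) \<and> (\<forall>G\<in>\<G> i. \<forall>C. compact C \<longrightarrow> C \<subseteq> G \<longrightarrow> retractable d C)"
    by (rule exE)
  have \<G>: "countable (\<G> i)" "M i \<inter> W \<subseteq> \<Union>(\<G> i)" "G \<in> \<G> i \<Longrightarrow> G \<in> sets borel"
    "G \<in> \<G> i \<Longrightarrow> compact C \<Longrightarrow> C \<subseteq> G \<Longrightarrow> retractable d C" for i G C
    using spec[OF \<G>', of i] by simp_all
  define \<A> where "\<A> = insert {} (\<Union>i. \<G> i)"
  have c\<A>: "countable \<A>" "\<A> \<noteq> {}" using \<G>(1) by (simp_all add: \<A>_def)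
  define G where "G = from_nat_into \<A>"
  have G\<A>: "G n \<in> \<A>" for n unfolding G_def by (rule from_nat_into[OF c\<A>(2)])
  have G_cases: "G n = {} \<or> (\<exists>i. G n \<in> \<G> i)" for n using G\<A>[of n] unfolding \<A>_def by simp
  have Gb: "G n \<in> sets borel" for n
    using G_cases[of n]
  proof (elim disjE exE)
    show "G n \<in> sets borel" if "G n = {}" unfolding that by simp
  qed (rule \<G>(3))
  have Gr: "retractable d C" if C: "compact C" "C \<subseteq> G n" for C n
    using G_cases[of n]
  proof (elim disjE exE)
    assume "G n = {}"
    then have "C = {}" using C(2) by simp
    then show "retractable d C" using retractable_empty by simp
  qed (rule \<G>(4)[OF _ C])
  have Gcov: "K - (\<Union>n. G n) \<subseteq> K - (\<Union>i. M i)"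
  proof
    fix x assume x: "x \<in> K - (\<Union>n. G n)"
    have "x \<notin> M i" for i
    proof
      assume "x \<in> M i"
      then have "x \<in> \<Union>(\<G> i)" using \<G>(2)[of i] x K(3) by blast
      then obtain A where A: "A \<in> \<G> i" "x \<in> A" by (elim UnionE)
      then have "A \<in> \<A>" unfolding \<A>_def by blast
      then obtain n where "from_nat_into \<A> n = A" using from_nat_into_surj[OF c\<A>(1)] by metis
      then have "x \<in> G n" using A(2) by (simp add: G_def)
      then show False using x by blast
    qed
    then show "x \<in> K - (\<Union>i. M i)" using x by blast
  qed
  let ?M = "hausdorff_restrict d K"
  define B where "B = (\<lambda>n. K \<inter> disjointed G n)"
  have Bb: "B n \<in> sets ?M" for n
  proof -
    have "range (disjointed G) \<subseteq> sets borel" by (rule sets.range_disjointed_sets) (use Gb in blast)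
    then have "disjointed G n \<in> sets borel" by (rule range_subsetD)
    then show ?thesis unfolding B_def sets_hausdorff_restrict by (rule sets.Int[OF K(2)])
  qed
  have BK: "B n \<subseteq> K" "B n \<subseteq> G n" for n
    unfolding B_def by (rule Int_lower1) (rule order_trans[OF Int_lower2 disjointed_subset])
  have Bdisj: "disjoint_family B"
    using disjoint_family_disjointed[of G] unfolding B_def disjoint_family_on_def by blast
  have BU: "(\<Union>n. B n) = K \<inter> (\<Union>n. G n)"
    unfolding B_def UN_disjointed_eq[of G, symmetric] by (rule Int_UN_distrib[symmetric])
  have tot: "emeasure ?M UNIV = hausdorff d K" by (simp add: emeasure_hausdorff_restrict)
  have finM: "emeasure ?M X < top" for X
  proof -
    have "emeasure ?M X \<le> emeasure ?M (space ?M)" by (rule emeasure_space)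
    then show ?thesis using K(5) tot by simp
  qed
  have e4: "0 < e / 2" using e by simp
  obtain N where N: "emeasure ?M (\<Union>n\<in>{N..}. B n) < ennreal (e / 2)"
  proof -
    have "(\<lambda>N. emeasure ?M (\<Union>n\<in>{N..}. B n)) \<longlonglongrightarrow> emeasure ?M (\<Inter>N. \<Union>n\<in>{N..}. B n)"
    proof (rule Lim_emeasure_decseq)
      show "range (\<lambda>N. \<Union>n\<in>{N..}. B n) \<subseteq> sets ?M" using Bb by blast
      show "decseq (\<lambda>N. \<Union>n\<in>{N..}. B n)" by (rule decseq_SucI) (auto intro: Suc_leD)
    qed (use finM in \<open>auto simp: less_top\<close>)
    moreover have "(\<Inter>N. \<Union>n\<in>{N..}. B n) = {}"
    proof (rule equals0I)
      fix x assume x: "x \<in> (\<Inter>N. \<Union>n\<in>{N..}. B n)"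
      then have "x \<in> (\<Union>n\<in>{0..}. B n)" by blast
      then obtain n where n: "x \<in> B n" by blast
      have "x \<in> (\<Union>k\<in>{Suc n..}. B k)" using x by blast
      then obtain k where k: "Suc n \<le> k" "x \<in> B k" by (elim UN_E) simp
      then have "B n \<inter> B k = {}" using disjoint_family_onD[OF Bdisj, of n k] by simp
      then show False using n k(2) by blast
    qed
    ultimately have "(\<lambda>N. emeasure ?M (\<Union>n\<in>{N..}. B n)) \<longlonglongrightarrow> 0" by simp
    then have "eventually (\<lambda>N. emeasure ?M (\<Union>n\<in>{N..}. B n) < ennreal (e / 2)) sequentially"
      by (rule order_tendstoD) (use e in simp)
    then show thesis using that by (auto simp: eventually_sequentially)
  qed
  \<comment> \<open>The remaining half of the error is shared by the \<open>N\<close> pieces.\<close>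
  define e' where "e' = e / 2 / real (Suc N)"
  have e': "0 < e'" using e by (simp add: e'_def)
  have "\<exists>C. compact C \<and> C \<subseteq> B n \<and> emeasure ?M (B n - C) \<le> ennreal e'" for n
  proof -
    have reg: "emeasure ?M (B n) = (SUP C\<in>{C. C \<subseteq> B n \<and> compact C}. emeasure ?M C)"
      by (rule inner_regular) (use finM[of UNIV] Bb in \<open>auto simp: less_top\<close>)
    have "\<exists>C\<in>{C. C \<subseteq> B n \<and> compact C}. emeasure ?M (B n) < emeasure ?M C + ennreal e'"
      by (rule SUP_approx_ennreal[OF _ _ reg]) (use e' finM[of "B n"] in \<open>auto simp: less_top\<close>)
    then obtain C where C: "C \<subseteq> B n" "compact C" "emeasure ?M (B n) < emeasure ?M C + ennreal e'" by blast
    have Cb: "C \<in> sets ?M" using C(2) by (simp add: borel_compact)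
    have "emeasure ?M (B n - C) = emeasure ?M (B n) - emeasure ?M C"
      by (rule emeasure_Diff) (use finM[of C] Bb Cb C(1) in \<open>auto simp: less_top\<close>)
    also have "\<dots> \<le> ennreal e'"
      using C(3) finM[of C] by (intro ennreal_minus_le_iff[THEN iffD2]) (auto simp: less_top)
    finally show ?thesis using C by blast
  qed
  then obtain C where C: "\<And>n. compact (C n)" "\<And>n. C n \<subseteq> B n" "\<And>n. emeasure ?M (B n - C n) \<le> ennreal e'" by metis
  let ?C = "\<Union>n\<in>{..<N}. C n"
  have retr: "retractable d ?C"
  proof (rule retractable_UN)
    show "retractable d (C n)" for n using C(1,2) BK(2) by (meson Gr order_trans)
    show "disjoint_family_on C {..<N}"
      using Bdisj C(2) unfolding disjoint_family_on_def by blast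
  qed simp
  have sub: "?C \<subseteq> K" using C(2) BK(1) by blast
  have rest: "hausdorff d (K - ?C) \<le> ennreal e"
  proof -
    have "K - ?C \<subseteq> (K - (\<Union>i. M i)) \<union> ((\<Union>n\<in>{N..}. B n) \<inter> K \<union> (\<Union>n\<in>{..<N}. (B n - C n) \<inter> K))"
    proof
      fix x assume x: "x \<in> K - ?C"
      show "x \<in> (K - (\<Union>i. M i)) \<union> ((\<Union>n\<in>{N..}. B n) \<inter> K \<union> (\<Union>n\<in>{..<N}. (B n - C n) \<inter> K))"
      proof (cases "x \<in> (\<Union>n. G n)")
        case True
        then obtain n where n: "x \<in> B n" using x BU by blast
        then show ?thesis using x by (cases "n < N") auto
      next
        case False
        then show ?thesis using x Gcov by blast
      qed
    qed
    then have "hausdorff d (K - ?C) \<le> hausdorff d (K - (\<Union>i. M i)) +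
        hausdorff d ((\<Union>n\<in>{N..}. B n) \<inter> K \<union> (\<Union>n\<in>{..<N}. (B n - C n) \<inter> K))"
      by (rule order_trans[OF hausdorff_mono hausdorff_Un_le])
    also have "\<dots> = hausdorff d ((\<Union>n\<in>{N..}. B n) \<inter> K \<union> (\<Union>n\<in>{..<N}. (B n - C n) \<inter> K))"
      unfolding M(2) by simp
    also have "\<dots> \<le> ennreal (e / 2) + (\<Sum>n<N. ennreal e')"
    proof (rule order_trans[OF hausdorff_Un_le add_mono])
      have "(\<Union>n\<in>{N..}. B n) \<in> sets ?M" by (rule sets.countable_UN) (use Bb in blast)
      then have "(\<Union>n\<in>{N..}. B n) \<in> sets borel" by simp
      then show "hausdorff d ((\<Union>n\<in>{N..}. B n) \<inter> K) \<le> ennreal (e / 2)"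
        using N by (simp add: emeasure_hausdorff_restrict less_imp_le)
      have Cn: "hausdorff d ((B n - C n) \<inter> K) \<le> ennreal e'" for n
        using C(3)[of n] Bb[of n] borel_compact[OF C(1)[of n]] by (simp add: emeasure_hausdorff_restrict)
      have "hausdorff d (\<Union>n\<in>{..<N}. (B n - C n) \<inter> K) \<le> (\<Sum>n<N. hausdorff d ((B n - C n) \<inter> K))"
        by (rule hausdorff_finite_UN_le) simp
      also have "\<dots> \<le> (\<Sum>n<N. ennreal e')" by (rule sum_mono) (rule Cn)
      finally show "hausdorff d (\<Union>n\<in>{..<N}. (B n - C n) \<inter> K) \<le> (\<Sum>n<N. ennreal e')" .
    qed
    also have "\<dots> = ennreal (e / 2 + real N * e')"
      using e e' by (simp add: ennreal_of_nat_eq_real_of_nat ennreal_mult)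
    also have "\<dots> \<le> ennreal e"
    proof (rule ennreal_leI)
      have "real N * e' \<le> real (Suc N) * e'" using e' by (intro mult_right_mono) auto
      also have "\<dots> = e / 2" unfolding e'_def by (simp del: of_nat_Suc)
      finally show "e / 2 + real N * e' \<le> e" by simp
    qed
    finally show ?thesis .
  qed
  show thesis by (rule that[OF sub retr rest])
qed


section \<open>Minimality of the limit\<close>

text \<open>
  The displacement \<open>p x - x\<close> is at most \<open>(L + 1) * (2 * s)\<close> in the region where the cutoff function,
  of slope \<open>1 / s\<close>, varies. Therefore the Lipschitz constant of \<open>q\<close> is independent of \<open>s\<close>.
\<close>

lemma retraction_cutoff:
  fixes K :: "'a::euclidean_space set"
  assumes K: "compact K" "K \<noteq> {}" and p: "L-lipschitz_on (nbhd \<sigma> K) p" "\<And>x. x \<in> K \<Longrightarrow> p x = x"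
    and s: "0 < s" "2 * s \<le> \<sigma>"
  obtains q where "(4 + 3 * L)-lipschitz_on UNIV q" "\<And>x. x \<in> nbhd s K \<Longrightarrow> q x = p x"
    "\<And>x. x \<notin> nbhd (2 * s) K \<Longrightarrow> q x = x"
proof -
  have L: "0 \<le> L" by (rule lipschitz_on_nonneg[OF p(1)])
  define w where "w = (\<lambda>x. clamp01 (2 - 1 / s * infdist x K))"
  define q where "q = (\<lambda>x. x + w x *\<^sub>R (p x - x))"
  have w_lip: "\<bar>w x - w y\<bar> \<le> dist x y / s" for x y
  proof -
    have "\<bar>w x - w y\<bar> \<le> \<bar>(2 - 1 / s * infdist x K) - (2 - 1 / s * infdist y K)\<bar>"
      unfolding w_def by (rule clamp01_diff_le)
    also have "\<dots> = \<bar>infdist x K - infdist y K\<bar> / s"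
    proof -
      have "(2 - 1 / s * infdist x K) - (2 - 1 / s * infdist y K) = (infdist y K - infdist x K) / s"
        by (simp add: diff_divide_distrib)
      then show ?thesis using s(1) by (simp add: abs_minus_commute)
    qed
    also have "\<dots> \<le> dist x y / s"
      using s(1) by (intro divide_right_mono infdist_triangle_abs) simp
    finally show ?thesis .
  qed
  have w01: "0 \<le> w x" "w x \<le> 1" for x by (simp_all add: w_def clamp01_range)
  have w0: "w x = 0" if "x \<notin> nbhd (2 * s) K" for x
  proof -
    have "2 * s \<le> infdist x K" using that mem_nbhd_infdist[OF K(2)] by force
    then show ?thesis using s(1) by (simp add: w_def clamp01_eq_0 pos_le_divide_eq)
  qed
  have w1: "w x = 1" if "x \<in> nbhd s K" for x
  proof -
    have "infdist x K < s" using that mem_nbhd_infdist[OF K(2)] by blast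
    then have "infdist x K / s \<le> 1" using s(1) by simp
    then show ?thesis by (simp add: w_def clamp01_eq_1)
  qed
  have s2: "nbhd (2 * s) K \<subseteq> nbhd \<sigma> K" by (rule nbhd_mono[OF s(2)])
  have u: "norm (p x - x) \<le> (L + 1) * (2 * s)" if x: "x \<in> nbhd (2 * s) K" for x
  proof -
    obtain k where k: "k \<in> K" "dist k x < 2 * s" using x by (auto simp: mem_nbhd_iff)
    have "k \<in> nbhd \<sigma> K" using k(1) subset_nbhd[of \<sigma> K] s by auto
    then have "dist (p x) k \<le> L * dist x k"
      using lipschitz_onD[OF p(1), of x k] x s2 p(2)[OF k(1)] by auto
    then have "dist (p x) x \<le> L * dist x k + dist x k"
      using dist_triangle[of "p x" x k] by (simp add: dist_commute)
    also have "\<dots> = (L + 1) * dist x k" by (simp add: algebra_simps)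
    also have "\<dots> \<le> (L + 1) * (2 * s)" using k(2) L by (intro mult_left_mono) (auto simp: dist_commute)
    finally show ?thesis by (simp add: dist_norm)
  qed
  have outside: "norm (w x *\<^sub>R (p x - x) - w y *\<^sub>R (p y - y)) \<le> 2 * (L + 1) * dist x y"
    if x: "x \<in> nbhd (2 * s) K" and y: "y \<notin> nbhd (2 * s) K" for x y
  proof -
    have "w x \<le> dist x y / s" using w_lip[of x y] w0[OF y] w01[of x] by simp
    then have "w x * norm (p x - x) \<le> dist x y / s * ((L + 1) * (2 * s))"
      using u[OF x] s(1) by (intro mult_mono) auto
    also have "\<dots> = 2 * (L + 1) * dist x y" using s(1) by simp
    finally show ?thesis using w0[OF y] w01[of x] by simp
  qed
  have diff: "norm (w x *\<^sub>R (p x - x) - w y *\<^sub>R (p y - y)) \<le> 3 * (L + 1) * dist x y" for x y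
  proof -
    have le: "2 * (L + 1) * dist x y \<le> 3 * (L + 1) * dist x y"
      using L by (intro mult_right_mono) auto
    consider "x \<in> nbhd (2 * s) K" "y \<in> nbhd (2 * s) K" | "x \<in> nbhd (2 * s) K" "y \<notin> nbhd (2 * s) K"
      | "x \<notin> nbhd (2 * s) K" "y \<in> nbhd (2 * s) K" | "x \<notin> nbhd (2 * s) K" "y \<notin> nbhd (2 * s) K" by blast
    then show ?thesis
    proof cases
      case 1
      have "dist (p x) (p y) \<le> L * dist x y" using 1 s2 by (intro lipschitz_onD[OF p(1)]) auto
      then have "norm ((p x - x) - (p y - y)) \<le> L * dist x y + dist x y"
        using norm_triangle_ineq4[of "p x - p y" "x - y"] by (simp add: dist_norm algebra_simps)
      then have d1: "norm ((p x - x) - (p y - y)) \<le> (L + 1) * dist x y" by (simp add: algebra_simps)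
      have "w x *\<^sub>R (p x - x) - w y *\<^sub>R (p y - y)
          = w x *\<^sub>R ((p x - x) - (p y - y)) + (w x - w y) *\<^sub>R (p y - y)"
        by (simp add: algebra_simps)
      then have "norm (w x *\<^sub>R (p x - x) - w y *\<^sub>R (p y - y))
          \<le> \<bar>w x\<bar> * norm ((p x - x) - (p y - y)) + \<bar>w x - w y\<bar> * norm (p y - y)"
        by (metis norm_scaleR norm_triangle_ineq)
      also have "\<dots> \<le> 1 * ((L + 1) * dist x y) + (dist x y / s) * ((L + 1) * (2 * s))"
        using w01[of x] s(1) by (intro add_mono mult_mono d1 w_lip u 1) auto
      also have "\<dots> = 3 * (L + 1) * dist x y" using s(1) by (simp add: algebra_simps)
      finally show ?thesis .
    next
      case 2
      then show ?thesis using order_trans[OF outside le] by blast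
    next
      case 3
      then show ?thesis
        using outside[of y x] le by (simp add: dist_commute norm_minus_commute)
    next
      case 4
      then show ?thesis using w0 L by simp
    qed
  qed
  have "(4 + 3 * L)-lipschitz_on UNIV q"
  proof (rule lipschitz_onI)
    fix x y
    have "q x - q y = (x - y) + (w x *\<^sub>R (p x - x) - w y *\<^sub>R (p y - y))" by (simp add: q_def)
    then have "norm (q x - q y) \<le> norm (x - y) + norm (w x *\<^sub>R (p x - x) - w y *\<^sub>R (p y - y))"
      by (metis norm_triangle_ineq)
    also have "\<dots> \<le> dist x y + 3 * (L + 1) * dist x y" using diff[of x y] by (simp add: dist_norm)
    also have "\<dots> = (4 + 3 * L) * dist x y" by (simp add: algebra_simps)
    finally show "dist (q x) (q y) \<le> (4 + 3 * L) * dist x y" by (simp add: dist_norm)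
  qed (use L in simp)
  moreover have "q x = p x" if "x \<in> nbhd s K" for x using w1[OF that] by (simp add: q_def)
  moreover have "q x = x" if "x \<notin> nbhd (2 * s) K" for x using w0[OF that] by (simp add: q_def)
  ultimately show thesis by (rule that)
qed

text \<open>
  The loss has two sources. The area \<open>e1\<close> of \<open>K - C\<close> is multiplied only by the Lipschitz factor of
  \<open>\<phi>\<close>, since \<open>q\<close> is the identity far from \<open>C\<close>. The Lipschitz factor \<open>Q ^ d\<close> of \<open>q\<close> depends on \<open>C\<close>,
  hence on \<open>e1\<close>, but it is multiplied by an area of order \<open>e2\<close>, which is chosen after \<open>C\<close>.
\<close>

lemma limit_beats_competitors:
  fixes H K K0 :: "'a::euclidean_space set"
  assumes d: "1 \<le> d" and H: "closed H" and KH: "K \<subseteq> - H" "K \<in> sets borel" "rectifiable d K"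
    and A: "\<And>j. A j \<in> sliding_class H K0"
    and lim: "(\<lambda>j. hausdorff d (A j)) \<longlonglongrightarrow> (INF J\<in>sliding_class H K0. hausdorff d J)"
    and w: "weak_star_conv_on (- H) (\<lambda>j. hausdorff_restrict d (A j)) (hausdorff_restrict d K)"
    and eq: "(INF J\<in>sliding_class H K0. hausdorff d J) = hausdorff d K"
    and fin: "hausdorff d K < top"
    and \<phi>: "\<phi> \<in> sliding_maps H"
  shows "hausdorff d K \<le> hausdorff d (\<phi> ` K)"
proof (rule ennreal_le_epsilon)
  fix e :: real assume e: "0 < e"
  obtain \<Lambda> where \<Lambda>: "\<Lambda>-lipschitz_on UNIV \<phi>" "0 < \<Lambda>" using \<phi> by (rule sliding_mapsE)
  define e1 where "e1 = e / 2 / (\<Lambda> ^ d + 1)"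
  have \<Lambda>d: "0 < \<Lambda> ^ d" using \<Lambda>(2) by simp
  have e1: "0 < e1" using e \<Lambda>d by (simp add: e1_def add_pos_pos)
  have "\<Lambda> ^ d + 1 \<noteq> 0" using \<Lambda>d by linarith
  then have e1_eq: "e1 * (\<Lambda> ^ d + 1) = e / 2" using e1_def by (rule nonzero_eq_divide_eq[THEN iffD1])
  have oH: "open (- H)" using H by auto
  obtain C where C: "C \<subseteq> K" "retractable d C" "hausdorff d (K - C) \<le> ennreal e1"
    by (rule rectifiable_retractable_approx[OF KH(3,2,1) oH fin e1])
  obtain \<sigma> p L where r: "compact C" "0 < \<sigma>" "L-lipschitz_on (nbhd \<sigma> C) p" "\<And>x. x \<in> C \<Longrightarrow> p x = x"
    "\<And>e. 0 < e \<Longrightarrow> \<exists>s>0. hausdorff d (p ` nbhd s C - C) < ennreal e"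
    using C(2) unfolding retractable_def by blast
  have L: "0 \<le> L" by (rule lipschitz_on_nonneg[OF r(3)])
  show "hausdorff d K \<le> hausdorff d (\<phi> ` K) + ennreal e"
  proof (cases "C = {}")
    case True
    have "e1 * 1 \<le> e1 * (\<Lambda> ^ d + 1)" using e1 \<Lambda>d by (intro mult_left_mono) auto
    also have "\<dots> = e / 2" by (rule e1_eq)
    finally have "e1 \<le> e" using e by simp
    then have "hausdorff d K \<le> ennreal e" using C(3) True by (simp add: ennreal_leI order_trans)
    also have "\<dots> \<le> hausdorff d (\<phi> ` K) + ennreal e" by simp
    finally show ?thesis .
  next
    case ne: False
    define Q where "Q = 4 + 3 * L"
    have Q: "0 < Q" using L by (simp add: Q_def)
    define D where "D = \<Lambda> ^ d * (3 + 3 * Q ^ d)"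
    have D: "0 < D" using \<Lambda>d Q by (simp add: D_def add_pos_pos)
    define e2 where "e2 = e / 2 / D"
    have e2: "0 < e2" using e D by (simp add: e2_def)
    have De2: "D * e2 = e / 2" using D by (simp add: e2_def)
    have \<Lambda>e1: "\<Lambda> ^ d * e1 \<le> e / 2"
    proof -
      have "\<Lambda> ^ d * e1 \<le> (\<Lambda> ^ d + 1) * e1" using e1 by (intro mult_right_mono) auto
      also have "\<dots> = e / 2" using e1_eq by (simp only: mult.commute)
      finally show ?thesis .
    qed
    let ?M = "hausdorff_restrict d K"
    have Mfin: "emeasure ?M UNIV < top" using fin by (simp add: emeasure_hausdorff_restrict)
    obtain s1 where s1: "0 < s1" "hausdorff d (p ` nbhd s1 C - C) < ennreal e2" using r(5)[OF e2] by blast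
    obtain s2 where s2: "0 < s2" "emeasure ?M (nbhd s2 C - C) < ennreal e2"
      by (rule emeasure_nbhd_shrinks[OF r(1) sets_hausdorff_restrict Mfin e2])
    obtain s3 where s3: "0 < s3" "(\<Union>x\<in>C. ball x s3) \<subseteq> - H"
      by (rule compact_subset_open_imp_ball_epsilon_subset[OF r(1) oH order_trans[OF C(1) KH(1)]])
    define s where "s = min (min \<sigma> s1) (min s2 s3) / 3"
    have s: "0 < s" "3 * s \<le> \<sigma>" "3 * s \<le> s1" "3 * s \<le> s2" "3 * s \<le> s3"
      using r(2) s1(1) s2(1) s3(1) by (auto simp: s_def)
    have sub3: "nbhd (3 * s) C \<subseteq> - H" using nbhd_mono[OF s(5), of C] s3(2) by (simp add: nbhd_def)
    have n12: "nbhd s C \<subseteq> nbhd (2 * s) C" and n23: "nbhd (2 * s) C \<subseteq> nbhd (3 * s) C"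
      using s(1) by (auto intro!: nbhd_mono)
    have s\<sigma>: "2 * s \<le> \<sigma>" using s(1,2) by linarith
    obtain q where q: "(4 + 3 * L)-lipschitz_on UNIV q" "\<And>x. x \<in> nbhd s C \<Longrightarrow> q x = p x"
      "\<And>x. x \<notin> nbhd (2 * s) C \<Longrightarrow> q x = x"
    proof (rule retraction_cutoff[OF r(1) ne r(3) _ s(1) s\<sigma>])
      show "p x = x" if "x \<in> C" for x using that by (rule r(4))
    qed (rule that)
    have qS: "q \<in> sliding_maps H"
    proof (rule sliding_maps_eq_on[OF sliding_maps_id q(1)])
      fix x assume "x \<in> H"
      then have "x \<notin> nbhd (2 * s) C" using sub3 n23 by blast
      then show "q x = id x" using q(3) by simp
    qed
    have clC: "compact {x. infdist x C \<le> 2 * s}" using s(1) by (intro compact_infdist_le ne r(1)) simp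
    have cl_sub: "{x. infdist x C \<le> 2 * s} \<subseteq> nbhd (3 * s) C" using s(1) by (auto simp: mem_nbhd_infdist[OF ne])
    have ev1: "eventually (\<lambda>j. emeasure (hausdorff_restrict d (A j)) {x. infdist x C \<le> 2 * s}
        \<le> emeasure ?M (nbhd (3 * s) C) + ennreal e2) sequentially"
      by (rule weak_star_compact_upper[OF w clC cl_sub open_nbhd sub3 e2])
    have ev2: "eventually (\<lambda>j. emeasure ?M C \<le> emeasure (hausdorff_restrict d (A j)) (nbhd s C) + ennreal e2) sequentially"
      by (rule weak_star_open_lower[OF w r(1) subset_nbhd[OF s(1)] open_nbhd _ e2]) (use sub3 n12 n23 in blast)
    have ev3: "eventually (\<lambda>j. hausdorff d (A j) \<le> hausdorff d K + ennreal e2) sequentially"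
      using lim fin e2 unfolding eq by (intro ennreal_limit_eventually_le)
    obtain j where j: "emeasure (hausdorff_restrict d (A j)) {x. infdist x C \<le> 2 * s} \<le> emeasure ?M (nbhd (3 * s) C) + ennreal e2"
      "emeasure ?M C \<le> emeasure (hausdorff_restrict d (A j)) (nbhd s C) + ennreal e2"
      "hausdorff d (A j) \<le> hausdorff d K + ennreal e2"
      using eventually_happens'[OF sequentially_bot eventually_conj[OF ev1 eventually_conj[OF ev2 ev3]]] by blast
    define X where "X = hausdorff d (A j \<inter> nbhd s C)"
    define Y where "Y = hausdorff d (A j \<inter> nbhd (2 * s) C - nbhd s C)"
    define Z where "Z = hausdorff d (A j - nbhd (2 * s) C)"
    define k where "k = hausdorff d C"
    have XY: "hausdorff d (A j \<inter> nbhd (2 * s) C) = X + Y"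
    proof -
      have "A j \<inter> nbhd (2 * s) C \<inter> nbhd s C = A j \<inter> nbhd s C" using n12 by blast
      then show ?thesis
        using hausdorff_split_borel[OF borel_open[OF open_nbhd], of d "A j \<inter> nbhd (2 * s) C" s C]
        by (simp add: X_def Y_def)
    qed
    have XYZ: "hausdorff d (A j) = X + Y + Z"
      using hausdorff_split_borel[OF borel_open[OF open_nbhd], of d "A j" "2 * s" C] XY by (simp add: Z_def)
    have bC: "C \<in> sets borel" using r(1) by (rule borel_compact)
    have MC: "emeasure ?M C = k"
      using bC C(1) by (simp add: emeasure_hausdorff_restrict k_def Int_absorb2)
    have f1: "X + Y \<le> k + ennreal e2 + ennreal e2"
    proof -
      have "X + Y = emeasure (hausdorff_restrict d (A j)) (nbhd (2 * s) C)"
        unfolding XY[symmetric] by (subst emeasure_hausdorff_restrict) (auto simp: open_nbhd Int_commute)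
      also have "\<dots> \<le> emeasure (hausdorff_restrict d (A j)) {x. infdist x C \<le> 2 * s}"
        using borel_compact[OF clC] by (intro emeasure_mono) (auto simp: mem_nbhd_infdist[OF ne])
      also have "\<dots> \<le> emeasure ?M (nbhd (3 * s) C) + ennreal e2" by (rule j(1))
      also have "emeasure ?M (nbhd (3 * s) C) \<le> emeasure ?M (C \<union> (nbhd s2 C - C))"
        using nbhd_mono[OF s(4), of C] bC by (intro emeasure_mono) (auto simp: open_nbhd)
      also have "\<dots> \<le> emeasure ?M C + emeasure ?M (nbhd s2 C - C)"
        using bC by (intro emeasure_subadditive) (auto simp: open_nbhd)
      also have "\<dots> \<le> k + ennreal e2" using s2(2) MC by (intro add_mono) auto
      finally show ?thesis by (simp add: add_right_mono)
    qed
    have f2: "k \<le> X + ennreal e2"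
      using j(2) MC by (simp add: emeasure_hausdorff_restrict open_nbhd X_def Int_commute)
    have f3: "X + Y + Z \<le> k + ennreal e1 + ennreal e2"
    proof -
      have "hausdorff d K \<le> k + hausdorff d (K - C)"
        using hausdorff_split_borel[OF bC, of d K] C(1) by (simp add: k_def Int_absorb1)
      also have "\<dots> \<le> k + ennreal e1" by (rule add_left_mono[OF C(3)])
      finally show ?thesis using j(3) XYZ by (metis add_right_mono order_trans)
    qed
    have kfin: "k < top" using hausdorff_mono[OF C(1), of d] fin by (simp add: k_def order_le_less_trans)
    have "X + Y + Z < top" by (rule order_le_less_trans[OF f3]) (use kfin in simp)
    then obtain x y z kk where re: "X = ennreal x" "0 \<le> x" "Y = ennreal y" "0 \<le> y" "Z = ennreal z" "0 \<le> z"
       "k = ennreal kk" "0 \<le> kk"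
      using kfin by (cases X; cases Y; cases Z; cases k) auto
    have g1: "x + y \<le> kk + e2 + e2" and g2: "kk \<le> x + e2" and g3: "x + y + z \<le> kk + e1 + e2"
      using f1 f2 f3 e1 e2 re by (simp_all add: ennreal_plus[symmetric] ennreal_le_iff del: ennreal_plus)
    have y: "y \<le> 3 * e2" and z: "z \<le> e1 + 2 * e2" using g1 g2 g3 re(4) by linarith+
    have "(\<phi> \<circ> q) ` A j \<in> sliding_class H K0"
      by (rule sliding_class_image[OF sliding_maps_comp[OF qS \<phi>] A])
    then have "hausdorff d K \<le> hausdorff d ((\<phi> \<circ> q) ` A j)"
      unfolding eq[symmetric] by (rule INF_lower)
    also have "\<dots> \<le> hausdorff d ((\<phi> ` K \<union> \<phi> ` (p ` nbhd s1 C - C)) \<union>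
        (\<phi> ` q ` (A j \<inter> nbhd (2 * s) C - nbhd s C) \<union> \<phi> ` (A j - nbhd (2 * s) C)))"
    proof (rule hausdorff_mono, rule image_subsetI)
      fix a assume a: "a \<in> A j"
      consider "a \<in> nbhd s C" | "a \<in> A j \<inter> nbhd (2 * s) C - nbhd s C" | "a \<in> A j - nbhd (2 * s) C"
        using a by blast
      then show "(\<phi> \<circ> q) a \<in> (\<phi> ` K \<union> \<phi> ` (p ` nbhd s1 C - C)) \<union>
          (\<phi> ` q ` (A j \<inter> nbhd (2 * s) C - nbhd s C) \<union> \<phi> ` (A j - nbhd (2 * s) C))"
      proof cases
        case 1
        have "s \<le> s1" using s(1,3) by linarith
        then have "a \<in> nbhd s1 C" using 1 nbhd_mono[of s s1 C] by blast
        then have "q a \<in> p ` nbhd s1 C" using q(2)[OF 1] by simp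
        then have "q a \<in> K \<or> q a \<in> p ` nbhd s1 C - C" using C(1) by blast
        then show ?thesis by auto
      next
        case 2
        then have "\<phi> (q a) \<in> \<phi> ` q ` (A j \<inter> nbhd (2 * s) C - nbhd s C)" by (intro imageI)
        then show ?thesis by simp
      next
        case 3
        then have "q a = a" using q(3) by simp
        then have "\<phi> (q a) \<in> \<phi> ` (A j - nbhd (2 * s) C)" using 3 by simp
        then show ?thesis by simp
      qed
    qed
    also have "\<dots> \<le> (hausdorff d (\<phi> ` K) + hausdorff d (\<phi> ` (p ` nbhd s1 C - C))) +
        (hausdorff d (\<phi> ` q ` (A j \<inter> nbhd (2 * s) C - nbhd s C)) + hausdorff d (\<phi> ` (A j - nbhd (2 * s) C)))"
      by (rule order_trans[OF hausdorff_Un_le add_mono[OF hausdorff_Un_le hausdorff_Un_le]])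
    also have "\<dots> \<le> (hausdorff d (\<phi> ` K) + ennreal (\<Lambda> ^ d) * ennreal e2) +
        (ennreal (\<Lambda> ^ d) * (ennreal (Q ^ d) * ennreal (3 * e2)) + ennreal (\<Lambda> ^ d) * ennreal (e1 + 2 * e2))"
    proof (intro add_mono order_refl)
      have lip: "hausdorff d (\<phi> ` B) \<le> ennreal (\<Lambda> ^ d) * hausdorff d B" for B
        by (rule hausdorff_lipschitz_image_le[OF lipschitz_on_subset[OF \<Lambda>(1) subset_UNIV] \<Lambda>(2)])
      show "hausdorff d (\<phi> ` (p ` nbhd s1 C - C)) \<le> ennreal (\<Lambda> ^ d) * ennreal e2"
        by (rule order_trans[OF lip mult_left_mono]) (use s1(2) in auto)
      have "hausdorff d (q ` (A j \<inter> nbhd (2 * s) C - nbhd s C)) \<le> ennreal (Q ^ d) * Y"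
        unfolding Y_def Q_def
        by (rule hausdorff_lipschitz_image_le[OF lipschitz_on_subset[OF q(1) subset_UNIV]]) (use L in simp)
      also have "\<dots> \<le> ennreal (Q ^ d) * ennreal (3 * e2)"
        using y re(3) by (intro mult_left_mono) (auto intro: ennreal_leI)
      finally show "hausdorff d (\<phi> ` q ` (A j \<inter> nbhd (2 * s) C - nbhd s C))
          \<le> ennreal (\<Lambda> ^ d) * (ennreal (Q ^ d) * ennreal (3 * e2))"
        by (intro order_trans[OF lip mult_left_mono]) auto
      show "hausdorff d (\<phi> ` (A j - nbhd (2 * s) C)) \<le> ennreal (\<Lambda> ^ d) * ennreal (e1 + 2 * e2)"
        by (rule order_trans[OF lip mult_left_mono])
          (use z re(5) in \<open>auto simp: Z_def[symmetric] intro: ennreal_leI\<close>)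
    qed
    also have "\<dots> = hausdorff d (\<phi> ` K) +
        ennreal (\<Lambda> ^ d * e2 + (\<Lambda> ^ d * (Q ^ d * (3 * e2)) + \<Lambda> ^ d * (e1 + 2 * e2)))"
    proof -
      have nn: "0 \<le> \<Lambda> ^ d" "0 \<le> e2" "0 \<le> Q ^ d" "0 \<le> 3 * e2" "0 \<le> e1 + 2 * e2"
        using \<Lambda>d e1 e2 Q by simp_all
      have "ennreal (\<Lambda> ^ d * e2 + (\<Lambda> ^ d * (Q ^ d * (3 * e2)) + \<Lambda> ^ d * (e1 + 2 * e2)))
        = ennreal (\<Lambda> ^ d) * ennreal e2 + (ennreal (\<Lambda> ^ d) * (ennreal (Q ^ d) * ennreal (3 * e2))
           + ennreal (\<Lambda> ^ d) * ennreal (e1 + 2 * e2))"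
        by (simp only: ennreal_mult ennreal_plus nn mult_nonneg_nonneg add_nonneg_nonneg)
      then show ?thesis by (simp only: add.assoc)
    qed
    also have "\<dots> \<le> hausdorff d (\<phi> ` K) + ennreal e"
    proof (intro add_left_mono ennreal_leI)
      have "\<Lambda> ^ d * e2 + (\<Lambda> ^ d * (Q ^ d * (3 * e2)) + \<Lambda> ^ d * (e1 + 2 * e2)) = D * e2 + \<Lambda> ^ d * e1"
        by (simp add: D_def algebra_simps)
      then show "\<Lambda> ^ d * e2 + (\<Lambda> ^ d * (Q ^ d * (3 * e2)) + \<Lambda> ^ d * (e1 + 2 * e2)) \<le> e"
        using De2 \<Lambda>e1 by simp
    qed
    finally show ?thesis .
  qed
qed

lemma closed_spt: "closed (spt \<mu>)"
proof -
  have "- spt \<mu> = \<Union>{V. open V \<and> \<not> emeasure \<mu> V > 0}" by (auto simp: spt_def)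
  then have "open (- spt \<mu>)" by (metis (mono_tags, lifting) mem_Collect_eq open_Union)
  then show ?thesis by (simp add: closed_def)
qed

text \<open>
  If \<open>H\<close> is empty there is no constraint, and a constant map shows that the infimum is zero; the distance
  to \<open>H\<close>, on which the collar construction depends, makes sense in the other case only.
\<close>

theorem theorem1p8:
  fixes d :: nat
    and H K0 K :: "(real ^ 'n) set"
    and Kseq :: "nat \<Rightarrow> (real ^ 'n) set"
    and r :: "nat \<Rightarrow> nat"
    and \<mu> :: "(real ^ 'n) measure"
  assumes d: "1 \<le> d" "d \<le> CARD('n)"
    and H: "closed H"
    and K0: "closedin (top_of_set (- H)) K0"
    and K0_bounded: "bounded K0"
    and K0_rectifiable: "rectifiable d K0"
    and K0_finite: "hausdorff d K0 < \<infinity>"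
    and H_null: "hausdorff d H = 0"
    and H_retract: "\<forall>\<eta>>0. \<exists>\<delta>>0. \<exists>P\<in>sliding_maps H.
                      (1 + \<eta>)-lipschitz_on UNIV P \<and> P ` nbhd \<delta> H \<subseteq> H"
    and Kseq: "\<forall>j. Kseq j \<in> sliding_class H K0"
    and minimizing: "(\<lambda>j. hausdorff d (Kseq j)) \<longlonglongrightarrow> (INF J\<in>sliding_class H K0. hausdorff d J)"
    and subseq: "strict_mono r"
    and conv: "weak_star_conv_on (- H) (\<lambda>j. hausdorff_restrict d (Kseq (r j))) \<mu>"
    and \<mu>: "\<mu> = hausdorff_restrict d K"
    and K: "K = spt \<mu> - H"
    and K_rectifiable: "rectifiable d K"
  shows "(INF J\<in>sliding_class H K0. hausdorff d J) = hausdorff d K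
       \<and> hausdorff d K = (INF J\<in>sliding_class H K. hausdorff d J)
       \<and> sliding_minimizer d H K"
proof -
  let ?m = "INF J\<in>sliding_class H K0. hausdorff d J"
  have fin: "?m < top"
    using INF_lower[OF sliding_class_self[of K0 H], of "hausdorff d"] K0_finite
    by (simp add: order_le_less_trans)
  have A: "Kseq (r j) \<in> sliding_class H K0" for j using Kseq by blast
  have lim: "(\<lambda>j. hausdorff d (Kseq (r j))) \<longlonglongrightarrow> ?m"
    using LIMSEQ_subseq_LIMSEQ[OF minimizing subseq] by (simp add: o_def)
  have mass: "emeasure \<mu> (- H) = hausdorff d K"
  proof -
    have "K \<subseteq> - H" using K by blast
    then have "- H \<inter> K = K" by blast
    moreover have "- H \<in> sets borel" using H by auto
    ultimately show ?thesis unfolding \<mu> by (simp add: emeasure_hausdorff_restrict)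
  qed
  have eq: "?m = hausdorff d K"
  proof (rule antisym)
    show "hausdorff d K \<le> ?m"
      using weak_star_lower_semicontinuous[OF conv H lim] mass by simp
    show "?m \<le> hausdorff d K"
    proof (cases "H = {}")
      case True
      have "(\<lambda>_. 0) \<in> sliding_maps H"
        unfolding True
        by (rule sliding_maps_eq_on[OF sliding_maps_id lipschitz_on_constant]) simp
      then have "(\<lambda>_. 0) ` K0 \<in> sliding_class H K0" unfolding sliding_class_def by blast
      then have "?m \<le> hausdorff d ((\<lambda>_. 0 :: real ^ 'n) ` K0)" by (rule INF_lower)
      also have "\<dots> \<le> hausdorff d {0 :: real ^ 'n}" by (rule hausdorff_mono) blast
      also have "\<dots> = 0" by (rule hausdorff_singleton[OF d(1)])
      finally show ?thesis by simp
    next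
      case False
      show ?thesis
        using no_mass_loss[OF d(1) H False H_null K0_bounded H_retract A lim fin conv] mass by simp
    qed
  qed
  have Kcl: "closedin (top_of_set (- H)) K"
  proof -
    have "K = - H \<inter> spt \<mu>" using K by blast
    then show ?thesis using closed_spt closedin_closed by blast
  qed
  have Kborel: "K \<in> sets borel"
    unfolding K by (intro sets.Diff borel_closed closed_spt H)
  have "hausdorff d K \<le> hausdorff d J" if "J \<in> sliding_class H K" for J
  proof -
    obtain \<phi> where \<phi>: "\<phi> \<in> sliding_maps H" "J = \<phi> ` K" using \<open>J \<in> sliding_class H K\<close>
      unfolding sliding_class_def by blast
    have "K \<subseteq> - H" using K by blast
    then show ?thesis
      unfolding \<phi>(2)
      using limit_beats_competitors[OF d(1) H _ Kborel K_rectifiable A lim conv[unfolded \<mu>] eq _ \<phi>(1)]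
        fin eq by simp
  qed
  then have min: "hausdorff d K = (INF J\<in>sliding_class H K. hausdorff d J)"
    by (intro antisym INF_greatest INF_lower sliding_class_self)
  show ?thesis
    using eq min Kcl unfolding sliding_minimizer_def by (intro conjI)
qed

end
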